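(* (Inner bound, rate distortion.) Let $D_1,D_2\ge0$. A triple $(R_0,R_X,R_Y)$ is achievable with distortions $D_1,D_2$ whenever \begin{align*} R_0 &> I(X;U|Y),\quad R_X > I(V;X|T,W),\quad R_Y > I(U,Y;W|V,T),\\ R_X+R_Y &> I(X,Y;V,T,W)+I(U;W|V,X,T,Y), \end{align*} for some random variables $T,U,V,W$ with finite alphabets $\mathcal T,\mathcal U,\mathcal V,\mathcal W$ jointly distributed with $(X,Y)$ such that $T-U-X-Y$ and $V-(X,T)-(U,Y)-W$ are Markov chains and there exist functions $g_1,g_2$ of $(V,T,W)$ (with values in $\mathcal F_1,\mathcal F_2$) with $\mathbb E\, d_i(f_i(X,Y),g_i(V,T,W))\le D_i$ for $i=1,2$. Moreover, one may restrict to $|\mathcal T|\le|\mathcal X|+4$, $|\mathcal V|\le(|\mathcal X|+4)|\mathcal X|+1$, $|\mathcal W|\le|\mathcal U|\cdot|\mathcal Y|+1$.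
   Context: Setup: $\mathcal X,\mathcal Y,\mathcal F_1,\mathcal F_2$ finite sets, $(X_i,Y_i)_{i\ge1}$ i.i.d. copies of $(X,Y)\sim p(x,y)$, functions $f_i:\mathcal X\times\mathcal Y\to\mathcal F_i$ and distortion measures $d_i:\mathcal F_i\times\mathcal F_i\to\mathbb R_{\ge0}$, $i=1,2$. An $(n,R_0,R_X,R_Y)$ code consists of encoders $\varphi_0:\mathcal X^n\to\{1,\dots,2^{nR_0}\}$ (transmitter-$X$ to transmitter-$Y$), $\varphi_X:\mathcal X^n\to\{1,\dots,2^{nR_X}\}$, $\varphi_Y:\mathcal Y^n\times\{1,\dots,2^{nR_0}\}\to\{1,\dots,2^{nR_Y}\}$ and decoders $\psi_i:\{1,\dots,2^{nR_X}\}\times\{1,\dots,2^{nR_Y}\}\to\mathcal F_i^n$, $i=1,2$. Writing $\hat F_i=\psi_i(\varphi_X(\mathbf X),\varphi_Y(\varphi_0(\mathbf X),\mathbf Y))$, its average distortions are $\frac1n\sum_{j=1}^n\mathbb E\,d_i(f_i(X_j,Y_j),(\hat F_i)_j)$. A triple is achievable with distortions $D_1,D_2$ if for every $\varepsilon>0$ and all large $n$ there is an $(n,R_0,R_X,R_Y)$ code whose average distortions are at most $D_1$ and $D_2$ respectively.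
   Formalization: Achievability is taken as average distortions at most D_1+ε and D_2+ε for every ε>0 and all large n; with exactly D_1, D_2 (ε unused) the claim fails, e.g. at D_1=D_2=0, where rates just above the entropy cannot give zero distortion. *)

theory Defs
  imports "HOL-Probability.Probability"
begin

text \<open>Random variables are functions A, B, C on the outcome space of a pmf P.
  Conditional mutual information I(A;B|C) in bits, defined by the usual finite sum
  (the relevant distributions are assumed finitely supported).\<close>

definition cmi :: "'o pmf \<Rightarrow> ('o \<Rightarrow> 'a) \<Rightarrow> ('o \<Rightarrow> 'b) \<Rightarrow> ('o \<Rightarrow> 'c) \<Rightarrow> real" where
  "cmi P A B C =
    (let Q   = map_pmf (\<lambda>s. (A s, B s, C s)) P;
         QC  = map_pmf C P;
         QAC = map_pmf (\<lambda>s. (A s, C s)) P;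
         QBC = map_pmf (\<lambda>s. (B s, C s)) P
     in (\<Sum>(a, b, c) \<in> set_pmf Q.
           pmf Q (a, b, c) *
           log 2 ((pmf Q (a, b, c) * pmf QC c) / (pmf QAC (a, c) * pmf QBC (b, c)))))"

definition mi :: "'o pmf \<Rightarrow> ('o \<Rightarrow> 'a) \<Rightarrow> ('o \<Rightarrow> 'b) \<Rightarrow> real" where
  "mi P A B = cmi P A B (\<lambda>_. ())"

definition markov3 :: "'o pmf \<Rightarrow> ('o \<Rightarrow> 'a) \<Rightarrow> ('o \<Rightarrow> 'b) \<Rightarrow> ('o \<Rightarrow> 'c) \<Rightarrow> bool" where
  "markov3 P A B C \<longleftrightarrow>
    (\<forall>a b c. pmf (map_pmf (\<lambda>s. (A s, B s, C s)) P) (a, b, c) * pmf (map_pmf B P) b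
             = pmf (map_pmf (\<lambda>s. (A s, B s)) P) (a, b) * pmf (map_pmf (\<lambda>s. (B s, C s)) P) (b, c))"

definition markov4 :: "'o pmf \<Rightarrow> ('o \<Rightarrow> 'a) \<Rightarrow> ('o \<Rightarrow> 'b) \<Rightarrow> ('o \<Rightarrow> 'c) \<Rightarrow> ('o \<Rightarrow> 'd) \<Rightarrow> bool" where
  "markov4 P A B C D \<longleftrightarrow>
     markov3 P A B (\<lambda>s. (C s, D s)) \<and> markov3 P (\<lambda>s. (A s, B s)) C D"

definition msgs :: "nat \<Rightarrow> real \<Rightarrow> nat" where
  "msgs n R = nat \<lfloor>2 powr (real n * R)\<rfloor>"

definition is_code ::
  "nat \<Rightarrow> real \<Rightarrow> real \<Rightarrow> real \<Rightarrow>
   ('x list \<Rightarrow> nat) \<Rightarrow> ('x list \<Rightarrow> nat) \<Rightarrow> ('y list \<Rightarrow> nat \<Rightarrow> nat) \<Rightarrow>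
   (nat \<Rightarrow> nat \<Rightarrow> 'f1 list) \<Rightarrow> (nat \<Rightarrow> nat \<Rightarrow> 'f2 list) \<Rightarrow> bool" where
  "is_code n R0 RX RY \<phi>0 \<phi>X \<phi>Y \<psi>1 \<psi>2 \<longleftrightarrow>
     (\<forall>xs. length xs = n \<longrightarrow> \<phi>0 xs \<in> {1..msgs n R0} \<and> \<phi>X xs \<in> {1..msgs n RX}) \<and>
     (\<forall>ys m. length ys = n \<and> m \<in> {1..msgs n R0} \<longrightarrow> \<phi>Y ys m \<in> {1..msgs n RY}) \<and>
     (\<forall>mx my. mx \<in> {1..msgs n RX} \<and> my \<in> {1..msgs n RY} \<longrightarrow>
        length (\<psi>1 mx my) = n \<and> length (\<psi>2 mx my) = n)"

definition avg_dist ::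
  "nat \<Rightarrow> ('x \<times> 'y) pmf \<Rightarrow> ('x \<Rightarrow> 'y \<Rightarrow> 'f) \<Rightarrow> ('f \<Rightarrow> 'f \<Rightarrow> real) \<Rightarrow>
   ('x list \<Rightarrow> nat) \<Rightarrow> ('x list \<Rightarrow> nat) \<Rightarrow> ('y list \<Rightarrow> nat \<Rightarrow> nat) \<Rightarrow>
   (nat \<Rightarrow> nat \<Rightarrow> 'f list) \<Rightarrow> real" where
  "avg_dist n p f d \<phi>0 \<phi>X \<phi>Y \<psi> =
     (1 / real n) * (\<Sum>j<n. measure_pmf.expectation (replicate_pmf n p)
        (\<lambda>xys. let xs = map fst xys; ys = map snd xys in
           d (f (xs ! j) (ys ! j)) (\<psi> (\<phi>X xs) (\<phi>Y ys (\<phi>0 xs)) ! j)))"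

definition achievable ::
  "('x \<times> 'y) pmf \<Rightarrow> ('x \<Rightarrow> 'y \<Rightarrow> 'f1) \<Rightarrow> ('x \<Rightarrow> 'y \<Rightarrow> 'f2) \<Rightarrow>
   ('f1 \<Rightarrow> 'f1 \<Rightarrow> real) \<Rightarrow> ('f2 \<Rightarrow> 'f2 \<Rightarrow> real) \<Rightarrow> real \<Rightarrow> real \<Rightarrow>
   real \<Rightarrow> real \<Rightarrow> real \<Rightarrow> bool" where
  "achievable p f1 f2 d1 d2 D1 D2 R0 RX RY \<longleftrightarrow>
     (\<forall>\<epsilon>>0. \<exists>N. \<forall>n\<ge>N. \<exists>\<phi>0 \<phi>X \<phi>Y \<psi>1 \<psi>2.
        is_code n R0 RX RY \<phi>0 \<phi>X \<phi>Y \<psi>1 \<psi>2 \<and>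
        avg_dist n p f1 d1 \<phi>0 \<phi>X \<phi>Y \<psi>1 \<le> D1 + \<epsilon> \<and>
        avg_dist n p f2 d2 \<phi>0 \<phi>X \<phi>Y \<psi>2 \<le> D2 + \<epsilon>)"

text \<open>Q is a joint distribution of (X,Y,T,U,V,W) with T,U,V,W valued in nat
  (finite alphabets = finite support).\<close>
type_synonym ('x, 'y) joint = "('x \<times> 'y \<times> nat \<times> nat \<times> nat \<times> nat) pmf"

definition inner_cond ::
  "('x \<times> 'y) pmf \<Rightarrow> ('x \<Rightarrow> 'y \<Rightarrow> 'f1) \<Rightarrow> ('x \<Rightarrow> 'y \<Rightarrow> 'f2) \<Rightarrow>
   ('f1 \<Rightarrow> 'f1 \<Rightarrow> real) \<Rightarrow> ('f2 \<Rightarrow> 'f2 \<Rightarrow> real) \<Rightarrow> real \<Rightarrow> real \<Rightarrow>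
   real \<Rightarrow> real \<Rightarrow> real \<Rightarrow> ('x, 'y) joint \<Rightarrow>
   (nat \<Rightarrow> nat \<Rightarrow> nat \<Rightarrow> 'f1) \<Rightarrow> (nat \<Rightarrow> nat \<Rightarrow> nat \<Rightarrow> 'f2) \<Rightarrow> bool" where
  "inner_cond p f1 f2 d1 d2 D1 D2 R0 RX RY Q g1 g2 \<longleftrightarrow>
    (let X = (\<lambda>(x,y,t,u,v,w). x); Y = (\<lambda>(x,y,t,u,v,w). y);
         T = (\<lambda>(x,y,t,u,v,w). t); U = (\<lambda>(x,y,t,u,v,w). u);
         V = (\<lambda>(x,y,t,u,v,w). v); W = (\<lambda>(x,y,t,u,v,w). w)
     in finite (set_pmf Q) \<and>
        map_pmf (\<lambda>s. (X s, Y s)) Q = p \<and>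
        markov4 Q T U X Y \<and>
        markov4 Q V (\<lambda>s. (X s, T s)) (\<lambda>s. (U s, Y s)) W \<and>
        measure_pmf.expectation Q (\<lambda>s. d1 (f1 (X s) (Y s)) (g1 (V s) (T s) (W s))) \<le> D1 \<and>
        measure_pmf.expectation Q (\<lambda>s. d2 (f2 (X s) (Y s)) (g2 (V s) (T s) (W s))) \<le> D2 \<and>
        R0 > cmi Q X U Y \<and>
        RX > cmi Q V X (\<lambda>s. (T s, W s)) \<and>
        RY > cmi Q (\<lambda>s. (U s, Y s)) W (\<lambda>s. (V s, T s)) \<and>
        RX + RY > mi Q (\<lambda>s. (X s, Y s)) (\<lambda>s. (V s, T s, W s))
                  + cmi Q U W (\<lambda>s. (V s, X s, T s, Y s)))"

definition alph :: "('x, 'y) joint \<Rightarrow> (('x \<times> 'y \<times> nat \<times> nat \<times> nat \<times> nat) \<Rightarrow> nat) \<Rightarrow> nat" where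
  "alph Q A = card (A ` set_pmf Q)"

end

theory Submission
  imports Defs
begin

text \<open>
  Achievability rests on the exponential race: given independent exponential variables $Z_s$, let every
  party who holds a distribution $P$ select the $s$ minimising $Z_s / P(s)$. The selection has law $P$, and
  two parties holding $P$ and $R$ disagree, given that the first selects $s$, with probability at most
  $P(s) / (P(s) + R(s))$. If $s$ is raced jointly with a uniform message $m$ of $M$ values, a party that learns
  $m$ recovers $s$ up to an error of order $P(s) / (M R(s))$; this performs covering and binning at once, and
  since the selected sequences have exactly the prescribed conditional laws no Markov lemma is needed.
  Racing $T$, $U$, $V$, $W$ in turn, with $T$ conveyed to the decoder by either transmitter and one of
  $V$, $W$ decoded before the other, gives the two corner points of the rate region; the remaining points
  follow by time sharing.

  For the cardinalities, all quantities in question are linear in a reweighting of $T$ (or of $(T, V)$) that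
  preserves the law of $X$ (or of $(X, T)$), so a vertex argument bounds the support by the number of equality
  constraints plus the number of tight inequalities. One distortion serves as the objective, and the three rate
  constraints on $R_X$, $R_Y$, $R_X + R_Y$ cannot all be tight because the sum rate dominates the sum of the
  other two; this saves the two units needed for the bound on $T$. The values of $V$ may be relabelled
  separately for each value of $T$, and $U$ may be enlarged by an independent uniform index, which makes the
  bound on $W$ harmless.
\<close>

section \<open>Exponential races and matching codes\<close>

text \<open>\<open>achievable\<close> demands deterministic codes at every large block length,
  whereas the race yields random selections. The selections for all possible inputs are therefore
  stored as one random table, and a table is fixed only when the failure probability averaged over
  tables is known to be small. The weak law, applied to log-likelihood ratios and to distortions, is
  the only asymptotic input at the corner points.

  T is raced with two messages because it has two receivers. Conveying it to transmitter Y costs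
  I(X;T|Y) on the R0 link, and U then adds I(X;U|Y,T); the chain T - U - X - Y makes the sum
  I(X;U|Y). Having learned T, transmitter Y can also pay the I(T;X) bits that the decoder needs,
  which permits the corner where transmitter X sends V alone.

  In the cardinality part the logarithms inside a conditional mutual information depend on the law
  itself. A reweighting is admissible only if it leaves these densities fixed, and this dictates
  which marginal has to be preserved.\<close>

definition race_measure :: "'s set \<Rightarrow> ('s \<Rightarrow> real) measure" where
  "race_measure S = PiM S (\<lambda>_. density lborel (exponential_density 1))"

lemma emeasure_exponential_gt:
  assumes "0 \<le> a"
  shows "emeasure (density lborel (exponential_density 1)) {a<..} = ennreal (exp (- a))"
proof -
  interpret prob_space "density lborel (exponential_density 1)"
    by (rule prob_space_exponential_density) simp
  have "distributed (density lborel (exponential_density 1)) lborel (\<lambda>x. x) (exponential_density 1)"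
    by (auto simp: distributed_def distr_id2 cong: distr_cong)
  from exponential_distributedD_gt[OF this assms] show ?thesis
    by (simp add: emeasure_eq_measure greaterThan_def)
qed

lemma prob_space_race: "prob_space (race_measure S)"
  unfolding race_measure_def by (intro prob_space_PiM prob_space_exponential_density) simp

lemma race_event_measurable [measurable]:
  assumes "finite S" "s \<in> S"
  shows "{z \<in> space (race_measure S). \<forall>r\<in>S - {s}. c r * z s < z r} \<in> sets (race_measure S)"
proof -
  have *: "(\<lambda>z. z r) \<in> borel_measurable (race_measure S)" if "r \<in> S" for r
    using measurable_component_singleton[OF that, of "\<lambda>_. density lborel (exponential_density 1)"]
    by (simp add: race_measure_def cong: measurable_cong_sets)
  have "Measurable.pred (race_measure S) (\<lambda>z. c r * z s < z r)" if "r \<in> S - {s}" for r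
  proof -
    have [measurable]: "(\<lambda>z. z r) \<in> borel_measurable (race_measure S)"
      "(\<lambda>z. z s) \<in> borel_measurable (race_measure S)" using * that assms by auto
    show ?thesis by measurable
  qed
  then show ?thesis using assms(1)
    by (intro predE pred_intros_finite(3)) auto
qed

text \<open>Condition on z s = y: the other coordinates are independent and exceed their thresholds
  with probabilities whose product is exp (- C y), where C is the sum of the c r. Integrating
  against exp (- y) leaves 1 / (1 + C).\<close>

lemma emeasure_race:
  assumes S: "finite S" "s \<in> S" and c: "\<And>r. r \<in> S - {s} \<Longrightarrow> 0 \<le> c r"
  shows "emeasure (race_measure S) {z \<in> space (race_measure S). \<forall>r\<in>S - {s}. c r * z s < z r}
         = ennreal (1 / (1 + (\<Sum>r\<in>S - {s}. c r)))"
proof -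
  let ?E = "density lborel (exponential_density 1)"
  define I where "I = S - {s}"
  define C where "C = (\<Sum>r\<in>I. c r)"
  have SI: "S = insert s I" "finite I" "s \<notin> I" using S by (auto simp: I_def)
  have C0: "0 \<le> C" unfolding C_def I_def by (rule sum_nonneg) (use c in auto)
  interpret E: prob_space ?E by (rule prob_space_exponential_density) simp
  interpret product_sigma_finite "\<lambda>_. ?E"
    by (simp add: product_sigma_finite_def E.sigma_finite_measure_axioms)
  define A where "A = {z \<in> space (race_measure S). \<forall>r\<in>I. c r * z s < z r}"
  have A[measurable]: "A \<in> sets (PiM (insert s I) (\<lambda>_. ?E))"
    using race_event_measurable[OF S, of c] unfolding SI(1)[symmetric]
    by (simp add: A_def race_measure_def I_def)
  have "emeasure (race_measure S) A = (\<integral>\<^sup>+z. indicator A z \<partial>PiM (insert s I) (\<lambda>_. ?E))"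
    using A by (simp add: race_measure_def SI(1)[symmetric])
  also have "\<dots> = (\<integral>\<^sup>+y. (\<integral>\<^sup>+x. indicator A (x(s := y)) \<partial>PiM I (\<lambda>_. ?E)) \<partial>?E)"
    by (rule product_nn_integral_insert_rev) (use SI in auto)
  also have "\<dots> = (\<integral>\<^sup>+y. ennreal (exponential_density 1 y) *
                  (\<integral>\<^sup>+x. indicator A (x(s := y)) \<partial>PiM I (\<lambda>_. ?E)) \<partial>lborel)"
  proof (subst nn_integral_density)
    have "(\<lambda>(y, x). indicator A (x(s := y)) :: ennreal) \<in> borel_measurable (?E \<Otimes>\<^sub>M PiM I (\<lambda>_. ?E))"
      unfolding split_beta' by measurable
    interpret P: prob_space "PiM I (\<lambda>_. ?E)" by (intro prob_space_PiM E.prob_space_axioms)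
    from P.borel_measurable_nn_integral[OF \<open>_ \<in> borel_measurable (?E \<Otimes>\<^sub>M _)\<close>]
    show "(\<lambda>y. \<integral>\<^sup>+x. indicator A (x(s := y)) \<partial>PiM I (\<lambda>_. ?E)) \<in> borel_measurable lborel"
      by simp
  qed auto
  \<comment> \<open>Up to the factor 1 / (1 + C) the integrand is the exponential density of rate 1
    + C, so its integral is a total mass.\<close>
  also have "\<dots> = (\<integral>\<^sup>+y. ennreal (1 / (1 + C)) * ennreal (exponential_density (1 + C) y) \<partial>lborel)"
  proof (rule nn_integral_cong)
    fix y :: real
    show "ennreal (exponential_density 1 y) * (\<integral>\<^sup>+x. indicator A (x(s := y)) \<partial>PiM I (\<lambda>_. ?E))
        = ennreal (1 / (1 + C)) * ennreal (exponential_density (1 + C) y)"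
    proof (cases "y < 0")
      case False
      then have y: "0 \<le> y" by simp
      have "(\<integral>\<^sup>+x. indicator A (x(s := y)) \<partial>PiM I (\<lambda>_. ?E))
          = (\<integral>\<^sup>+x. indicator (PiE I (\<lambda>r. {c r * y<..})) x \<partial>PiM I (\<lambda>_. ?E))"
        using SI by (intro nn_integral_cong)
          (auto simp: A_def race_measure_def space_PiM indicator_def PiE_def extensional_def Pi_iff split: if_splits)
      also have "\<dots> = emeasure (PiM I (\<lambda>_. ?E)) (PiE I (\<lambda>r. {c r * y<..}))"
        using SI by (intro nn_integral_indicator sets_PiM_I_finite) auto
      also have "\<dots> = (\<Prod>r\<in>I. emeasure ?E {c r * y<..})"
        using SI by (intro emeasure_PiM) auto
      also have "\<dots> = (\<Prod>r\<in>I. ennreal (exp (- (c r * y))))"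
        using c y by (intro prod.cong refl emeasure_exponential_gt) (auto simp: I_def)
      also have "\<dots> = ennreal (exp (- C * y))"
        using SI by (subst prod_ennreal)
          (auto simp: exp_sum[symmetric] C_def sum_negf sum_distrib_right)
      finally have "ennreal (exponential_density 1 y) * (\<integral>\<^sup>+x. indicator A (x(s := y)) \<partial>PiM I (\<lambda>_. ?E))
         = ennreal (exp (- y)) * ennreal (exp (- C * y))"
        using y by (simp add: exponential_density_def)
      also have "\<dots> = ennreal (exp (- y) * exp (- C * y))" by (simp add: ennreal_mult)
      also have "exp (- y) * exp (- C * y) = 1 / (1 + C) * exponential_density (1 + C) y"
        using y C0 by (simp add: exponential_density_def exp_add[symmetric] distrib_left mult.commute)
      also have "ennreal \<dots> = ennreal (1 / (1 + C)) * ennreal (exponential_density (1 + C) y)"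
        using C0 by (intro ennreal_mult) (auto simp: exponential_density_nonneg)
      finally show ?thesis .
    qed (simp add: exponential_density_def)
  qed
  also have "\<dots> = ennreal (1 / (1 + C)) * emeasure (density lborel (exponential_density (1 + C))) UNIV"
    by (subst nn_integral_cmult) (auto simp: emeasure_density)
  also have "emeasure (density lborel (exponential_density (1 + C))) UNIV = 1"
    using prob_space.emeasure_space_1[OF prob_space_exponential_density[of "1 + C"]] C0 by simp
  finally show ?thesis by (simp add: A_def I_def C_def)
qed

text \<open>All laws \<open>D k\<close> race over one family of exponential variables. If s has mass
  a under \<open>D k\<close> and b under \<open>D l\<close>, both select it with probability at
  least a b / (a + b), and a - a b / (a + b) = a (a / (a + b)). Finiteness of the index sets lets
  the continuous race be stored as a \<open>pmf\<close> on tables of winners.\<close>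

lemma exponential_race_coupling:
  fixes D :: "'k \<Rightarrow> 's pmf"
  assumes fin: "finite S" "finite K" and D: "\<And>k. k \<in> K \<Longrightarrow> set_pmf (D k) \<subseteq> S"
  shows "\<exists>G :: ('k \<Rightarrow> 's) pmf. (\<forall>k\<in>K. map_pmf (\<lambda>g. g k) G = D k) \<and>
    (\<forall>k\<in>K. \<forall>l\<in>K. \<forall>s. measure G {g. g k = s \<and> g l \<noteq> s}
       \<le> pmf (D k) s * (pmf (D k) s / (pmf (D k) s + pmf (D l) s)))"
proof -
  define M where "M = race_measure S"
  interpret M: prob_space M unfolding M_def by (rule prob_space_race)
  \<comment> \<open>This is z s / D k s < z r / D k r for all other r, cross-multiplied so that r
    may have mass zero; strictness makes the winner unique.\<close>
  define win where "win k z s \<longleftrightarrow> s \<in> S \<and> pmf (D k) s > 0 \<and>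
      (\<forall>r\<in>S - {s}. pmf (D k) r / pmf (D k) s * z s < z r)" for k z s
  have win_unique: "r = s" if "win k z s" "win k z r" for k z r s
  proof (rule ccontr)
    assume "r \<noteq> s"
    then have "pmf (D k) r / pmf (D k) s * z s < z r" "pmf (D k) s / pmf (D k) r * z r < z s"
      using that by (auto simp: win_def)
    moreover have "pmf (D k) r > 0" "pmf (D k) s > 0" using that by (auto simp: win_def)
    ultimately show False by (simp add: field_simps)
  qed
  have sum1: "(\<Sum>r\<in>S. pmf (D k) r) = 1" if "k \<in> K" for k
    using D[OF that] fin by (intro sum_pmf_eq_1)
  have Win_meas: "{z \<in> space M. win k z s} \<in> sets M" for k s
  proof (cases "s \<in> S \<and> pmf (D k) s > 0")
    case True
    then have "{z \<in> space M. win k z s} =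
        {z \<in> space M. \<forall>r\<in>S - {s}. pmf (D k) r / pmf (D k) s * z s < z r}"
      by (auto simp: win_def)
    then show ?thesis using race_event_measurable[OF fin(1), of s "\<lambda>r. pmf (D k) r / pmf (D k) s"] True
      by (simp add: M_def)
  next
    case False
    then have "{z \<in> space M. win k z s} = {}" by (auto simp: win_def)
    then show ?thesis by (simp only: sets.empty_sets)
  qed
  have Win_prob: "measure M {z \<in> space M. win k z s} = pmf (D k) s" if k: "k \<in> K" for k s
  proof (cases "s \<in> S \<and> pmf (D k) s > 0")
    case True
    then have "{z \<in> space M. win k z s} =
        {z \<in> space M. \<forall>r\<in>S - {s}. pmf (D k) r / pmf (D k) s * z s < z r}"
      by (auto simp: win_def)
    then have "emeasure M {z \<in> space M. win k z s}
        = ennreal (1 / (1 + (\<Sum>r\<in>S - {s}. pmf (D k) r / pmf (D k) s)))"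
      using emeasure_race[of S s "\<lambda>r. pmf (D k) r / pmf (D k) s"] True fin by (simp add: M_def)
    also have "1 + (\<Sum>r\<in>S - {s}. pmf (D k) r / pmf (D k) s) = (\<Sum>r\<in>S. pmf (D k) r / pmf (D k) s)"
      using True fin by (simp add: sum.remove[of S s])
    also have "\<dots> = 1 / pmf (D k) s" using sum1[OF k] by (simp add: sum_divide_distrib[symmetric])
    finally show ?thesis by (simp add: measure_def)
  next
    case False
    then have "{z \<in> space M. win k z s} = {}" by (auto simp: win_def)
    moreover have "pmf (D k) s = 0" using False D[OF k] by (auto simp: pmf_eq_0_set_pmf)
    ultimately show ?thesis by (simp only: measure_empty)
  qed
  \<comment> \<open>For z s >= 0 both win conditions follow from a single race whose ratios
    \<open>c r\<close> are the maxima of the two given ones. A maximum is at most the sum, and c s =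
    1 is counted once, so 1 plus the other ratios is at most 1 / a + 1 / b.\<close>
  have Win2_prob: "measure M {z \<in> space M. win k z s \<and> win l z s}
        \<ge> pmf (D k) s * pmf (D l) s / (pmf (D k) s + pmf (D l) s)"
    if kl: "k \<in> K" "l \<in> K" for k l s
  proof (cases "pmf (D k) s > 0 \<and> pmf (D l) s > 0")
    case True
    define a b where "a = pmf (D k) s" and "b = pmf (D l) s"
    define c where "c r = max (pmf (D k) r / a) (pmf (D l) r / b)" for r
    have ab: "a > 0" "b > 0" using True by (auto simp: a_def b_def)
    have sS: "s \<in> S" using True D[OF kl(1)] by (auto simp: pmf_positive_iff)
    have c0: "c r \<ge> 0" for r by (simp add: c_def a_def b_def le_max_iff_disj)
    have "z \<in> space M \<and> win k z s \<and> win l z s"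
      if z: "z \<in> space M" "\<forall>r\<in>S - {s}. c r * z s < z r" "0 \<le> z s" for z
    proof -
      have "pmf (D k) r / a * z s < z r \<and> pmf (D l) r / b * z s < z r" if r: "r \<in> S - {s}" for r
        using z(2)[rule_format, OF r] mult_right_mono[of "pmf (D k) r / a" "c r" "z s"]
          mult_right_mono[of "pmf (D l) r / b" "c r" "z s"] z(3) by (auto simp: c_def)
      then show ?thesis using z True sS by (auto simp: win_def a_def b_def)
    qed
    have AE0: "AE z in M. 0 \<le> z s"
    proof -
      have "AE x in density lborel (exponential_density 1). 0 \<le> x"
        by (subst AE_density) (auto simp: exponential_density_def)
      then show ?thesis unfolding M_def race_measure_def using sS fin
        by (intro AE_PiM_component) (auto intro: prob_space_exponential_density)
    qed
    have "c r \<le> pmf (D k) r / a + pmf (D l) r / b" for r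
      using ab by (auto simp: c_def)
    then have "(\<Sum>r\<in>S. c r) \<le> (\<Sum>r\<in>S. pmf (D k) r / a + pmf (D l) r / b)" by (intro sum_mono)
    also have "\<dots> = 1 / a + 1 / b"
      using sum1 kl by (simp add: sum.distrib sum_divide_distrib[symmetric])
    finally have "(\<Sum>r\<in>S. c r) \<le> 1 / a + 1 / b" .
    moreover have cs: "(\<Sum>r\<in>S. c r) = 1 + (\<Sum>r\<in>S - {s}. c r)"
      using sS fin ab by (subst sum.remove[of S s]) (auto simp: c_def a_def b_def)
    moreover have "(\<Sum>r\<in>S - {s}. c r) \<ge> 0" using c0 by (intro sum_nonneg)
    ultimately have "a * b / (a + b) \<le> 1 / (1 + (\<Sum>r\<in>S - {s}. c r))"
    proof -
      have "1 / (1 / a + 1 / b) \<le> 1 / (1 + (\<Sum>r\<in>S - {s}. c r))"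
        using \<open>_ \<le> 1 / a + 1 / b\<close> cs \<open>(\<Sum>r\<in>S - {s}. c r) \<ge> 0\<close> by (intro divide_left_mono) auto
      moreover have "1 / (1 / a + 1 / b) = a * b / (a + b)" using ab by (simp add: field_simps)
      ultimately show ?thesis by simp
    qed
    also have "\<dots> = measure M {z \<in> space M. \<forall>r\<in>S - {s}. c r * z s < z r}"
      using emeasure_race[of S s c] sS fin c0 \<open>(\<Sum>r\<in>S - {s}. c r) \<ge> 0\<close> by (simp add: M_def measure_def)
    also have "\<dots> \<le> measure M {z \<in> space M. win k z s \<and> win l z s}"
    proof (rule M.finite_measure_mono_AE)
      show "AE z in M. z \<in> {z \<in> space M. \<forall>r\<in>S - {s}. c r * z s < z r} \<longrightarrow>
          z \<in> {z \<in> space M. win k z s \<and> win l z s}"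
        using AE0 by eventually_elim (use \<open>\<And>z. z \<in> space M \<Longrightarrow> _ \<Longrightarrow> _ \<Longrightarrow> _\<close> in auto)
      show "{z \<in> space M. win k z s \<and> win l z s} \<in> sets M"
        using Win_meas[of k s] Win_meas[of l s] by (auto intro: sets.sets_Collect_conj)
    qed
    finally show ?thesis by (simp add: a_def b_def)
  qed (auto simp: not_less intro: order_trans[OF _ measure_nonneg])
  show ?thesis
  proof (cases "K = {}")
    case False
    then obtain k0 where "k0 \<in> K" by auto
    then obtain s0 where s0: "s0 \<in> S" using D set_pmf_not_empty[of "D k0"] by blast
    \<comment> \<open>Outcomes without a winner, a null set for k in K, get the default
      \<open>s0\<close>, so that a selection exists for every z.\<close>
    define sel where "sel k z = (if \<exists>s. win k z s then THE s. win k z s else s0)" for k z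
    have sel_win: "sel k z = s" if "win k z s" for k z s
      unfolding sel_def using that win_unique by (metis (mono_tags, lifting) the_equality)
    have sel_iff: "sel k z = s \<longleftrightarrow> win k z s \<or> (s = s0 \<and> (\<forall>r\<in>S. \<not> win k z r))" for k z s
    proof (cases "\<exists>s. win k z s")
      case True
      then obtain t where t: "win k z t" by auto
      then have "t \<in> S" by (simp add: win_def)
      then show ?thesis using sel_win[OF t] t win_unique[OF t] by blast
    next
      case False
      then have "sel k z = s0" by (simp add: sel_def)
      then show ?thesis using False by blast
    qed
    have sel_meas: "{z \<in> space M. sel k z = s} \<in> sets M" for k s
      unfolding sel_iff using Win_meas fin
      by (intro sets.sets_Collect_disj sets.sets_Collect_conj sets.sets_Collect_finite_All'
          sets.sets_Collect_neg sets.sets_Collect_const) (use s0 in auto)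
    \<comment> \<open>Restriction to K puts all tables in a finite set of extensional functions; the
      law of \<open>h\<close> is then discrete and \<open>Abs_pmf\<close> applies.\<close>
    define h where "h z = restrict (\<lambda>k. sel k z) K" for z
    define F where "F = PiE K (\<lambda>_. S)"
    have finF: "finite F" unfolding F_def using fin by (intro finite_PiE) auto
    have hF: "h z \<in> F" for z
      using s0 by (auto simp: h_def F_def sel_iff) (metis sel_iff win_def)
    have h_meas: "h \<in> measurable M (count_space UNIV)"
    proof -
      have "h \<in> measurable M (count_space F)"
      proof (subst measurable_count_space_eq2[OF finF], intro conjI ballI)
        fix f assume f: "f \<in> F"
        have "h -` {f} \<inter> space M = {z \<in> space M. \<forall>k\<in>K. sel k z = f k}"
          using f by (auto simp: h_def F_def fun_eq_iff PiE_def extensional_def restrict_def)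
        then show "h -` {f} \<inter> space M \<in> sets M"
          using sel_meas fin False by (auto intro!: sets.sets_Collect_finite_All')
      qed (use hF in auto)
      then show ?thesis by (rule measurable_compose) simp
    qed
    define N where "N = distr M (count_space UNIV) h"
    interpret N: prob_space N unfolding N_def by (rule M.prob_space_distr[OF h_meas])
    have "AE x in N. measure N {x} \<noteq> 0"
    proof (subst N.AE_support_countable)
      show "sets N = UNIV" by (simp add: N_def)
      have "AE x in N. x \<in> F" unfolding N_def using hF h_meas by (subst AE_distr_iff) auto
      then show "\<exists>S. countable S \<and> (AE x in N. x \<in> S)" using finF countable_finite by blast
    qed
    moreover have "sets N = UNIV" by (simp add: N_def)
    ultimately have G: "measure_pmf (Abs_pmf N) = N"
      by (intro Abs_pmf_inverse) (simp add: N.prob_space_axioms)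
    define G where "G = Abs_pmf N"
    have prob_G: "measure G A = measure M {z \<in> space M. h z \<in> A}" for A
    proof -
      have "measure G A = measure N A" by (simp add: G_def G)
      also have "\<dots> = measure M (h -` A \<inter> space M)"
        unfolding N_def using h_meas by (intro measure_distr) auto
      also have "h -` A \<inter> space M = {z \<in> space M. h z \<in> A}" by auto
      finally show ?thesis .
    qed
    have ge: "pmf (map_pmf (\<lambda>g. g k) G) s \<ge> pmf (D k) s" if k: "k \<in> K" for k s
    proof -
      have "pmf (D k) s = measure M {z \<in> space M. win k z s}" using Win_prob[OF k] by simp
      also have "\<dots> \<le> measure M {z \<in> space M. h z \<in> (\<lambda>g. g k) -` {s}}"
        using k sel_win sel_meas[of k s] by (intro M.finite_measure_mono) (auto simp: h_def)
      finally show ?thesis by (simp add: pmf_map prob_G)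
    qed
    \<comment> \<open>The default value can only add mass, so only the lower bound is proved
      directly; two pmfs of which one dominates the other pointwise coincide.\<close>
    have law: "map_pmf (\<lambda>g. g k) G = D k" if k: "k \<in> K" for k
      using pmf_neq_exists_less[of "D k" "map_pmf (\<lambda>g. g k) G"] ge[OF k] pmf_neq_exists_less[of "map_pmf (\<lambda>g. g k) G" "D k"]
      by (metis not_less)
    show ?thesis
    proof (intro exI[of _ G] conjI ballI allI)
      fix k l s assume kl: "k \<in> K" "l \<in> K"
      have "measure G {g. g k = s \<and> g l \<noteq> s} = measure G ({g. g k = s} - {g. g k = s \<and> g l = s})"
        by (rule arg_cong[where f = "measure G"]) auto
      also have "\<dots> = measure G {g. g k = s} - measure G {g. g k = s \<and> g l = s}"
        by (subst measure_pmf.finite_measure_Diff) auto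
      also have "measure G {g. g k = s} = pmf (D k) s"
        using law[OF kl(1), symmetric] by (simp add: pmf_map vimage_def)
      also have "measure G {g. g k = s \<and> g l = s} \<ge> measure M {z \<in> space M. win k z s \<and> win l z s}"
        unfolding prob_G using kl sel_win sel_meas[of k s] sel_meas[of l s]
        by (intro M.finite_measure_mono) (auto simp: h_def intro: sets.sets_Collect_conj)
      with Win2_prob[OF kl, of s]
      have "pmf (D k) s - measure G {g. g k = s \<and> g l = s}
          \<le> pmf (D k) s - pmf (D k) s * pmf (D l) s / (pmf (D k) s + pmf (D l) s)" by linarith
      also have "\<dots> = pmf (D k) s * (pmf (D k) s / (pmf (D k) s + pmf (D l) s))"
      proof (cases "pmf (D k) s = 0")
        case False
        then have "pmf (D k) s + pmf (D l) s > 0" by (simp add: add_pos_nonneg)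
        then show ?thesis by (simp add: field_simps)
      qed simp
      finally show "measure G {g. g k = s \<and> g l \<noteq> s} \<le>
          pmf (D k) s * (pmf (D k) s / (pmf (D k) s + pmf (D l) s))" .
    qed (use law in auto)
  qed auto
qed

text \<open>The race error for the masses K(s) / M (encoder: s with a uniform message) and R(s)
  (receiver: s with the message already known), with the factor M cleared.\<close>

definition mismatch :: "nat \<Rightarrow> 's pmf \<Rightarrow> 's pmf \<Rightarrow> 's \<Rightarrow> real" where
  "mismatch M K R s = pmf K s / (pmf K s + real M * pmf R s)"

lemma mismatch_nonneg: "0 \<le> mismatch M K R s"
  by (simp add: mismatch_def)

lemma mismatch_le_1: "mismatch M K R s \<le> 1"
proof (cases "pmf K s + real M * pmf R s = 0")
  case False
  then have "pmf K s + real M * pmf R s > 0" by (simp add: order_less_le)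
  then show ?thesis by (simp add: mismatch_def)
qed (simp add: mismatch_def)

text \<open>The encoder for a races for a triple (s, m1, m2) with both messages uniform and
  independent of s. The receiver that has learned m1 races with \<open>R1 b\<close> on s, the point
  mass at m1 and a uniform m2, and symmetrically for m2. One race serves all parties; the two
  messages are for the two receivers of T.\<close>

lemma matching_code:
  fixes K :: "'a \<Rightarrow> 's pmf" and R1 :: "'b \<Rightarrow> 's pmf" and R2 :: "'c \<Rightarrow> 's pmf"
  assumes fin: "finite A" "finite B" "finite C" "finite S"
    and K: "\<And>a. a \<in> A \<Longrightarrow> set_pmf (K a) \<subseteq> S" and R1: "\<And>b. b \<in> B \<Longrightarrow> set_pmf (R1 b) \<subseteq> S"
    and R2: "\<And>c. c \<in> C \<Longrightarrow> set_pmf (R2 c) \<subseteq> S" and M: "M1 \<ge> 1" "M2 \<ge> 1"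
  shows "\<exists>G :: (('a \<Rightarrow> 's \<times> nat \<times> nat) \<times> ('b \<Rightarrow> nat \<Rightarrow> 's \<times> nat \<times> nat) \<times>
      ('c \<Rightarrow> nat \<Rightarrow> 's \<times> nat \<times> nat)) pmf.
    (\<forall>a\<in>A. map_pmf (\<lambda>(e, d1, d2). fst (e a)) G = K a) \<and>
    (\<forall>(e, d1, d2)\<in>set_pmf G. \<forall>a\<in>A. snd (e a) \<in> {..<M1} \<times> {..<M2}) \<and>
    (\<forall>a\<in>A. \<forall>b\<in>B. measure G {(e, d1, d2). d1 b (fst (snd (e a))) \<noteq> e a}
       \<le> measure_pmf.expectation (K a) (mismatch M1 (K a) (R1 b))) \<and>
    (\<forall>a\<in>A. \<forall>c\<in>C. measure G {(e, d1, d2). d2 c (snd (snd (e a))) \<noteq> e a}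
       \<le> measure_pmf.expectation (K a) (mismatch M2 (K a) (R2 c)))"
proof -
  define U1 U2 where "U1 = pmf_of_set {..<M1}" and "U2 = pmf_of_set {..<M2}"
  have ne: "{..<M1} \<noteq> {}" "{..<M2} \<noteq> {}" using M by (auto simp: lessThan_empty_iff)
  have U: "pmf U1 i = (if i < M1 then 1 / M1 else 0)" "pmf U2 i = (if i < M2 then 1 / M2 else 0)" for i
    using ne by (auto simp: U1_def U2_def)
  have setU: "set_pmf U1 = {..<M1}" "set_pmf U2 = {..<M2}" using ne by (auto simp: U1_def U2_def)
  \<comment> \<open>One index for each party and each message it may have learned: encoders on the
    left, then pairs of side information and message for either receiver.\<close>
  define D :: "'a + ('b \<times> nat) + ('c \<times> nat) \<Rightarrow> ('s \<times> nat \<times> nat) pmf" where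
    "D = case_sum (\<lambda>a. pair_pmf (K a) (pair_pmf U1 U2))
        (case_sum (\<lambda>(b, i). pair_pmf (R1 b) (pair_pmf (return_pmf i) U2))
                  (\<lambda>(c, j). pair_pmf (R2 c) (pair_pmf U1 (return_pmf j))))"
  define I where "I = Inl ` A \<union> (Inr \<circ> Inl) ` (B \<times> {..<M1}) \<union> (Inr \<circ> Inr) ` (C \<times> {..<M2})"
  define T where "T = S \<times> {..<M1} \<times> {..<M2}"
  have finI: "finite I" and finT: "finite T" using fin by (auto simp: I_def T_def)
  have DT: "set_pmf (D k) \<subseteq> T" if "k \<in> I" for k
    using that by (auto simp: I_def D_def T_def setU dest: K[THEN subsetD] R1[THEN subsetD] R2[THEN subsetD])
  obtain H :: "('a + ('b \<times> nat) + ('c \<times> nat) \<Rightarrow> 's \<times> nat \<times> nat) pmf"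
    where H1: "\<And>k. k \<in> I \<Longrightarrow> map_pmf (\<lambda>g. g k) H = D k"
      and H2: "\<And>k l s. k \<in> I \<Longrightarrow> l \<in> I \<Longrightarrow>
      measure H {g. g k = s \<and> g l \<noteq> s} \<le> pmf (D k) s * (pmf (D k) s / (pmf (D k) s + pmf (D l) s))"
    using exponential_race_coupling[of T I D] finT finI DT by blast
  have suppH: "g (Inl a) \<in> T" if "g \<in> set_pmf H" "a \<in> A" for g a
  proof -
    have "g (Inl a) \<in> set_pmf (map_pmf (\<lambda>g. g (Inl a)) H)" using that by auto
    also have "map_pmf (\<lambda>g. g (Inl a)) H = D (Inl a)" using that by (intro H1) (auto simp: I_def)
    finally show ?thesis using K[OF that(2)] by (auto simp: D_def T_def setU)
  qed
  \<comment> \<open>The receiver's index depends on the message drawn, so the error is split over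
    the selected triple (s, m); for each of them the index \<open>l m\<close> is fixed and the
    coupling bound applies. The common weight 1 / (M1 M2) cancels from the ratio, and summing over m
    removes the remaining one.\<close>
  have bound: "measure H {g. g (l (snd (g (Inl a)))) \<noteq> g (Inl a)} \<le> measure_pmf.expectation (K a) (mismatch M (K a) R)"
    if a: "a \<in> A" and l: "\<And>m. m \<in> {..<M1} \<times> {..<M2} \<Longrightarrow> l m \<in> I"
      "\<And>s m. m \<in> {..<M1} \<times> {..<M2} \<Longrightarrow> pmf (D (l m)) (s, m) = real M * pmf R s / (M1 * M2)" for l a and M :: nat and R
  proof -
    define Q where "Q = (\<lambda>(s :: 's, m). {g. g (Inl a) = (s, m) \<and> g (l m) \<noteq> (s, m)})"
    have "measure H {g. g (l (snd (g (Inl a)))) \<noteq> g (Inl a)}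
        = measure H ({g. g (l (snd (g (Inl a)))) \<noteq> g (Inl a)} \<inter> set_pmf H)" by (simp add: measure_Int_set_pmf)
    also have "\<dots> \<le> measure H (\<Union>x\<in>T. Q x)"
    proof (rule measure_pmf.finite_measure_mono)
      show "{g. g (l (snd (g (Inl a)))) \<noteq> g (Inl a)} \<inter> set_pmf H \<subseteq> (\<Union>x\<in>T. Q x)"
      proof
        fix g assume g: "g \<in> {g. g (l (snd (g (Inl a)))) \<noteq> g (Inl a)} \<inter> set_pmf H"
        then have "g (Inl a) \<in> T" using suppH a by simp
        moreover have "g \<in> Q (g (Inl a))" using g by (cases "g (Inl a)") (simp add: Q_def)
        ultimately show "g \<in> (\<Union>x\<in>T. Q x)" by blast
      qed
    qed simp
    also have "\<dots> \<le> (\<Sum>x\<in>T. measure H (Q x))"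
      using finT by (intro measure_pmf.finite_measure_subadditive_finite) auto
    also have "\<dots> \<le> (\<Sum>x\<in>T. pmf (K a) (fst x) * mismatch M (K a) R (fst x) / (M1 * M2))"
    proof (rule sum_mono)
      fix x assume x: "x \<in> T"
      obtain s m where sm: "x = (s, m)" by (cases x)
      have m: "m \<in> {..<M1} \<times> {..<M2}" using x sm by (auto simp: T_def)
      have DI: "pmf (D (Inl a)) (s, m) = pmf (K a) s / (M1 * M2)"
        using m by (cases m) (auto simp: D_def pmf_pair U)
      have "measure H (Q x) \<le> pmf (D (Inl a)) (s, m) *
         (pmf (D (Inl a)) (s, m) / (pmf (D (Inl a)) (s, m) + pmf (D (l m)) (s, m)))"
        using H2[of "Inl a" "l m" "(s, m)"] a l(1)[OF m] by (simp add: Q_def sm I_def)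
      also have "pmf (D (Inl a)) (s, m) / (pmf (D (Inl a)) (s, m) + pmf (D (l m)) (s, m)) = mismatch M (K a) R s"
        unfolding DI l(2)[OF m] mismatch_def add_divide_distrib[symmetric] using M by simp
      finally show "measure H (Q x) \<le> pmf (K a) (fst x) * mismatch M (K a) R (fst x) / (M1 * M2)"
        by (simp add: DI sm)
    qed
    also have "\<dots> = (\<Sum>s\<in>S. \<Sum>m\<in>{..<M1} \<times> {..<M2}. pmf (K a) s * mismatch M (K a) R s / (M1 * M2))"
      unfolding T_def by (subst sum.cartesian_product) (auto simp: split_beta)
    also have "\<dots> = (\<Sum>s\<in>S. pmf (K a) s * mismatch M (K a) R s)"
      using M by simp
    also have "\<dots> = measure_pmf.expectation (K a) (mismatch M (K a) R)"
      using K[OF a] fin by (subst integral_measure_pmf_real[of S]) (auto simp: mult.commute)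
    finally show ?thesis .
  qed
  define dec where "dec g = ((\<lambda>a. g (Inl a)), (\<lambda>b i. g (Inr (Inl (b, i)))), (\<lambda>c j. g (Inr (Inr (c, j)))))"
    for g :: "'a + ('b \<times> nat) + ('c \<times> nat) \<Rightarrow> 's \<times> nat \<times> nat"
  show ?thesis
  proof (intro exI[of _ "map_pmf dec H"] conjI ballI)
    fix a assume a: "a \<in> A"
    have "map_pmf (\<lambda>(e, d1, d2). fst (e a)) (map_pmf dec H) = map_pmf fst (map_pmf (\<lambda>g. g (Inl a)) H)"
      by (simp add: map_pmf_comp dec_def)
    also have "\<dots> = map_pmf fst (D (Inl a))" using a by (subst H1) (auto simp: I_def)
    also have "\<dots> = K a" by (simp add: D_def map_fst_pair_pmf)
    finally show "map_pmf (\<lambda>(e, d1, d2). fst (e a)) (map_pmf dec H) = K a" .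
  next
    fix x assume "x \<in> set_pmf (map_pmf dec H)"
    then show "case x of (e, d1, d2) \<Rightarrow> \<forall>a\<in>A. snd (e a) \<in> {..<M1} \<times> {..<M2}"
      using suppH by (auto simp: dec_def T_def mem_Times_iff)
  next
    fix a b assume ab: "a \<in> A" "b \<in> B"
    have "measure H {g. g (Inr (Inl (b, fst (snd (g (Inl a)))))) \<noteq> g (Inl a)}
       \<le> measure_pmf.expectation (K a) (mismatch M1 (K a) (R1 b))"
      by (rule bound[of a "\<lambda>m. Inr (Inl (b, fst m))"]) (use ab M in \<open>auto simp: I_def D_def pmf_pair U\<close>)
    then show "measure (map_pmf dec H) {(e, d1, d2). d1 b (fst (snd (e a))) \<noteq> e a}
       \<le> measure_pmf.expectation (K a) (mismatch M1 (K a) (R1 b))"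
      by (simp add: dec_def vimage_def)
  next
    fix a c assume ac: "a \<in> A" "c \<in> C"
    have "measure H {g. g (Inr (Inr (c, snd (snd (g (Inl a)))))) \<noteq> g (Inl a)}
       \<le> measure_pmf.expectation (K a) (mismatch M2 (K a) (R2 c))"
      by (rule bound[of a "\<lambda>m. Inr (Inr (c, snd m))"]) (use ac M in \<open>auto simp: I_def D_def pmf_pair U\<close>)
    then show "measure (map_pmf dec H) {(e, d1, d2). d2 c (snd (snd (e a))) \<noteq> e a}
       \<le> measure_pmf.expectation (K a) (mismatch M2 (K a) (R2 c))"
      by (simp add: dec_def vimage_def)
  qed
qed

section \<open>One-shot coding\<close>

lemma nn_integral_mono_pmf:
  "(\<And>x. x \<in> set_pmf P \<Longrightarrow> f x \<le> g x) \<Longrightarrow> (\<integral>\<^sup>+x. f x \<partial>measure_pmf P) \<le> (\<integral>\<^sup>+x. g x \<partial>measure_pmf P)"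
  by (rule nn_integral_mono_AE) (simp add: AE_measure_pmf_iff)

lemma nn_integral_cong_pmf:
  "(\<And>x. x \<in> set_pmf P \<Longrightarrow> f x = g x) \<Longrightarrow> (\<integral>\<^sup>+x. f x \<partial>measure_pmf P) = (\<integral>\<^sup>+x. g x \<partial>measure_pmf P)"
  by (rule nn_integral_cong_AE) (simp add: AE_measure_pmf_iff)

lemma nn_integral_swap_pmf:
  "(\<integral>\<^sup>+x. \<integral>\<^sup>+y. f x y \<partial>measure_pmf B \<partial>measure_pmf A) = (\<integral>\<^sup>+y. \<integral>\<^sup>+x. f x y \<partial>measure_pmf A \<partial>measure_pmf B)"
proof -
  have "(\<integral>\<^sup>+x. \<integral>\<^sup>+y. f x y \<partial>measure_pmf B \<partial>measure_pmf A) = (\<integral>\<^sup>+z. case_prod f z \<partial>measure_pmf (pair_pmf A B))"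
    by (simp add: nn_integral_pair_pmf')
  also have "\<dots> = (\<integral>\<^sup>+y. \<integral>\<^sup>+x. f x y \<partial>measure_pmf A \<partial>measure_pmf B)"
    by (subst pair_commute_pmf) (simp add: nn_integral_pair_pmf')
  finally show ?thesis .
qed

lemma emeasure_eq_nn_integral_pmf:
  "(\<And>x. f x = indicator A x) \<Longrightarrow> emeasure (measure_pmf P) A = (\<integral>\<^sup>+x. f x \<partial>measure_pmf P)"
  by simp

lemma nn_integral_law_pmf:
  "map_pmf h G = K \<Longrightarrow> (\<integral>\<^sup>+g. F (h g) \<partial>measure_pmf G) = (\<integral>\<^sup>+s. F s \<partial>measure_pmf K)"
  by auto

lemma ennreal_expectation_mismatch:
  "ennreal (measure_pmf.expectation P (mismatch M K R)) = (\<integral>\<^sup>+s. ennreal (mismatch M K R s) \<partial>measure_pmf P)"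
  by (subst nn_integral_eq_integral)
    (auto intro!: measure_pmf.integrable_const_bound[where B = 1] simp: mismatch_nonneg mismatch_le_1)

text \<open>The second message is given a single value. Dropping the message components from the
  receiver's output can only shrink the error event.\<close>

lemma matching_code_single:
  fixes K :: "'a \<Rightarrow> 's pmf" and R :: "'b \<Rightarrow> 's pmf"
  assumes fin: "finite A" "finite B" "finite S"
    and K: "\<And>a. a \<in> A \<Longrightarrow> set_pmf (K a) \<subseteq> S" and R: "\<And>b. b \<in> B \<Longrightarrow> set_pmf (R b) \<subseteq> S" and M: "M \<ge> 1"
  shows "\<exists>G :: (('a \<Rightarrow> 's \<times> nat) \<times> ('b \<Rightarrow> nat \<Rightarrow> 's)) pmf.
    (\<forall>a\<in>A. map_pmf (\<lambda>(e, d). fst (e a)) G = K a) \<and>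
    (\<forall>(e, d)\<in>set_pmf G. \<forall>a\<in>A. snd (e a) < M) \<and>
    (\<forall>a\<in>A. \<forall>b\<in>B. emeasure G {(e, d). d b (snd (e a)) \<noteq> fst (e a)}
       \<le> (\<integral>\<^sup>+s. ennreal (mismatch M (K a) (R b) s) \<partial>K a))"
proof -
  from matching_code[of A B B S K R R M 1] assms
  obtain G :: "(('a \<Rightarrow> 's \<times> nat \<times> nat) \<times> ('b \<Rightarrow> nat \<Rightarrow> 's \<times> nat \<times> nat) \<times> ('b \<Rightarrow> nat \<Rightarrow> 's \<times> nat \<times> nat)) pmf"
    where 1: "\<forall>a\<in>A. map_pmf (\<lambda>(e, d1, d2). fst (e a)) G = K a"
    and 2: "\<forall>(e, d1, d2)\<in>set_pmf G. \<forall>a\<in>A. snd (e a) \<in> {..<M} \<times> {..<1}"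
    and 3: "\<forall>a\<in>A. \<forall>b\<in>B. measure G {(e, d1, d2). d1 b (fst (snd (e a))) \<noteq> e a}
       \<le> measure_pmf.expectation (K a) (mismatch M (K a) (R b))" by auto
  define h :: "('a \<Rightarrow> 's \<times> nat \<times> nat) \<times> ('b \<Rightarrow> nat \<Rightarrow> 's \<times> nat \<times> nat) \<times> ('b \<Rightarrow> nat \<Rightarrow> 's \<times> nat \<times> nat) \<Rightarrow> _"
    where "h = (\<lambda>(e, d1, d2). (\<lambda>a. (fst (e a), fst (snd (e a))), \<lambda>b i. fst (d1 b i)))"
  show ?thesis
  proof (intro exI[of _ "map_pmf h G"] conjI ballI)
    fix a assume "a \<in> A"
    then show "map_pmf (\<lambda>(e, d). fst (e a)) (map_pmf h G) = K a"
      using 1 by (simp add: map_pmf_comp h_def split_def)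
  next
    fix x assume "x \<in> set_pmf (map_pmf h G)"
    then show "case x of (e, d) \<Rightarrow> \<forall>a\<in>A. snd (e a) < M" using 2 by (auto simp: h_def mem_Times_iff)
  next
    fix a b assume ab: "a \<in> A" "b \<in> B"
    have "emeasure (map_pmf h G) {(e, d). d b (snd (e a)) \<noteq> fst (e a)}
       \<le> emeasure G {(e, d1, d2). d1 b (fst (snd (e a))) \<noteq> e a}"
      unfolding emeasure_map_pmf by (intro emeasure_mono) (auto simp: h_def)
    also have "\<dots> \<le> ennreal (measure_pmf.expectation (K a) (mismatch M (K a) (R b)))"
      using 3 ab by (auto simp: measure_pmf.emeasure_eq_measure intro!: ennreal_leI)
    finally show "emeasure (map_pmf h G) {(e, d). d b (snd (e a)) \<noteq> fst (e a)}
       \<le> (\<integral>\<^sup>+s. ennreal (mismatch M (K a) (R b) s) \<partial>K a)" by (simp add: ennreal_expectation_mismatch)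
  qed
qed

text \<open>The order of generation reflects who knows what: transmitter X produces T, then U and V
  separately from (X, T), and transmitter Y produces W from (U, Y).\<close>

locale coding_kernels =
  fixes p :: "('x \<times> 'y) pmf" and KT :: "'x \<Rightarrow> 't pmf" and KU :: "'x \<times> 't \<Rightarrow> 'u pmf"
    and KV :: "'x \<times> 't \<Rightarrow> 'v pmf" and KW :: "'u \<times> 'y \<Rightarrow> 'w pmf"
begin

definition joint :: "('x \<times> 'y \<times> 't \<times> 'u \<times> 'v \<times> 'w) pmf" where
  "joint = do {(x, y) \<leftarrow> p; t \<leftarrow> KT x; u \<leftarrow> KU (x, t); v \<leftarrow> KV (x, t); w \<leftarrow> KW (u, y);
               return_pmf (x, y, t, u, v, w)}"

lemma nn_integral_joint:
  "(\<integral>\<^sup>+s. F s \<partial>joint) = (\<integral>\<^sup>+xy. \<integral>\<^sup>+t. \<integral>\<^sup>+u. \<integral>\<^sup>+v. \<integral>\<^sup>+w. F (fst xy, snd xy, t, u, v, w)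
      \<partial>KW (u, snd xy) \<partial>KV (fst xy, t) \<partial>KU (fst xy, t) \<partial>KT (fst xy) \<partial>p)"
  by (simp add: joint_def split_def)

end

text \<open>Each R-kernel is the law with which a receiver races: \<open>RTY\<close> and
  \<open>RU\<close> for transmitter Y, \<open>RT\<close>, \<open>RV\<close> and \<open>RW\<close>
  for the decoder. The maps \<open>cV\<close> and \<open>cW\<close> filter the side information of
  \<open>RV\<close> and \<open>RW\<close>; they are endomaps so that a filter that hides everything
  has the same type as the identity.\<close>

locale coding_scheme = coding_kernels p KT KU KV KW
  for p :: "('x \<times> 'y) pmf" and KT :: "'x \<Rightarrow> 't pmf" and KU :: "'x \<times> 't \<Rightarrow> 'u pmf"
    and KV :: "'x \<times> 't \<Rightarrow> 'v pmf" and KW :: "'u \<times> 'y \<Rightarrow> 'w pmf" +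
  fixes RTY :: "'y \<Rightarrow> 't pmf" and RT :: "'t pmf" and RU :: "'y \<times> 't \<Rightarrow> 'u pmf"
    and RV :: "'t \<times> 'w \<Rightarrow> 'v pmf" and RW :: "'t \<times> 'v \<Rightarrow> 'w pmf"
    and cV :: "'w \<Rightarrow> 'w" and cW :: "'v \<Rightarrow> 'v"
    and SX :: "'x set" and SY :: "'y set" and ST :: "'t set" and SU :: "'u set" and SV :: "'v set" and SW :: "'w set"
  assumes fin: "finite SX" "finite SY" "finite ST" "finite SU" "finite SV" "finite SW"
    and p: "set_pmf p \<subseteq> SX \<times> SY"
    and KT: "\<And>x. x \<in> SX \<Longrightarrow> set_pmf (KT x) \<subseteq> ST"
    and KU: "\<And>x t. x \<in> SX \<Longrightarrow> t \<in> ST \<Longrightarrow> set_pmf (KU (x, t)) \<subseteq> SU"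
    and KV: "\<And>x t. x \<in> SX \<Longrightarrow> t \<in> ST \<Longrightarrow> set_pmf (KV (x, t)) \<subseteq> SV"
    and KW: "\<And>u y. u \<in> SU \<Longrightarrow> y \<in> SY \<Longrightarrow> set_pmf (KW (u, y)) \<subseteq> SW"
    and RTY: "\<And>y. y \<in> SY \<Longrightarrow> set_pmf (RTY y) \<subseteq> ST" and RT: "set_pmf RT \<subseteq> ST"
    and RU: "\<And>y t. y \<in> SY \<Longrightarrow> t \<in> ST \<Longrightarrow> set_pmf (RU (y, t)) \<subseteq> SU"
    and RV: "\<And>t w. t \<in> ST \<Longrightarrow> w \<in> SW \<Longrightarrow> set_pmf (RV (t, w)) \<subseteq> SV"
    and cV: "\<And>w. w \<in> SW \<Longrightarrow> cV w \<in> SW" and cW: "\<And>v. v \<in> SV \<Longrightarrow> cW v \<in> SV"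
    and RW: "\<And>t v. t \<in> ST \<Longrightarrow> v \<in> SV \<Longrightarrow> set_pmf (RW (t, v)) \<subseteq> SW"
begin

definition failure_bound :: "nat \<Rightarrow> nat \<Rightarrow> nat \<Rightarrow> nat \<Rightarrow> nat \<Rightarrow> 'x \<times> 'y \<times> 't \<times> 'u \<times> 'v \<times> 'w \<Rightarrow> real" where
  "failure_bound M0a M0b MT MV MW = (\<lambda>(x, y, t, u, v, w).
     mismatch M0a (KT x) (RTY y) t + mismatch MT (KT x) RT t + mismatch M0b (KU (x, t)) (RU (y, t)) u
     + mismatch MV (KV (x, t)) (RV (t, cV w)) v + mismatch MW (KW (u, y)) (RW (t, cW v)) w)"

text \<open>The quantities t, u, v, w below are the ones selected when every transmitter knows all previous
  choices; off the listed failure events every party reproduces them. Taking one of cV, cW constant lets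
  the decoder recover V before W or W before V.\<close>

lemma one_shot:
  assumes M: "M0a \<ge> 1" "M0b \<ge> 1" "MT \<ge> 1" "MV \<ge> 1" "MW \<ge> 1"
    and small: "emeasure joint B + (\<integral>\<^sup>+s. ennreal (failure_bound M0a M0b MT MV MW s) \<partial>joint) < ennreal \<delta>"
  shows "\<exists>eT dTY dT eU dU eV dV eW dW.
     (\<forall>x\<in>SX. fst (eT x) \<in> ST \<and> snd (eT x) \<in> {..<M0a} \<times> {..<MT}) \<and>
     (\<forall>x\<in>SX. \<forall>t\<in>ST. fst (eU (x, t)) \<in> SU \<and> snd (eU (x, t)) < M0b) \<and>
     (\<forall>x\<in>SX. \<forall>t\<in>ST. fst (eV (x, t)) \<in> SV \<and> snd (eV (x, t)) < MV) \<and>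
     (\<forall>u\<in>SU. \<forall>y\<in>SY. fst (eW (u, y)) \<in> SW \<and> snd (eW (u, y)) < MW) \<and>
     emeasure p {(x, y). let t = fst (eT x); u = fst (eU (x, t)); v = fst (eV (x, t)); w = fst (eW (u, y)) in
        (x, y, t, u, v, w) \<in> B \<or> dTY y (fst (snd (eT x))) \<noteq> eT x \<or> dT (snd (snd (eT x))) \<noteq> eT x \<or>
        dU (y, t) (snd (eU (x, t))) \<noteq> u \<or> dV (t, cV w) (snd (eV (x, t))) \<noteq> v \<or> dW (t, cW v) (snd (eW (u, y))) \<noteq> w} \<le> ennreal \<delta>"
proof -
  have "\<exists>G :: (('x \<Rightarrow> 't \<times> nat \<times> nat) \<times> ('y \<Rightarrow> nat \<Rightarrow> 't \<times> nat \<times> nat) \<times> (unit \<Rightarrow> nat \<Rightarrow> 't \<times> nat \<times> nat)) pmf.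
    (\<forall>a\<in>SX. map_pmf (\<lambda>(e, d1, d2). fst (e a)) G = KT a) \<and>
    (\<forall>(e, d1, d2)\<in>set_pmf G. \<forall>a\<in>SX. snd (e a) \<in> {..<M0a} \<times> {..<MT}) \<and>
    (\<forall>a\<in>SX. \<forall>b\<in>SY. measure G {(e, d1, d2). d1 b (fst (snd (e a))) \<noteq> e a}
       \<le> measure_pmf.expectation (KT a) (mismatch M0a (KT a) (RTY b))) \<and>
    (\<forall>a\<in>SX. \<forall>c\<in>{()}. measure G {(e, d1, d2). d2 c (snd (snd (e a))) \<noteq> e a}
       \<le> measure_pmf.expectation (KT a) (mismatch MT (KT a) RT))"
    by (rule matching_code[where S = ST]) (use fin KT RTY RT M in auto)
  then obtain GT :: "(('x \<Rightarrow> 't \<times> nat \<times> nat) \<times> ('y \<Rightarrow> nat \<Rightarrow> 't \<times> nat \<times> nat) \<times> (unit \<Rightarrow> nat \<Rightarrow> 't \<times> nat \<times> nat)) pmf"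
    where GT: "\<forall>a\<in>SX. map_pmf (\<lambda>g. fst (fst g a)) GT = KT a"
      "\<forall>g\<in>set_pmf GT. \<forall>a\<in>SX. snd (fst g a) \<in> {..<M0a} \<times> {..<MT}"
      "\<forall>a\<in>SX. \<forall>b\<in>SY. measure GT {g. fst (snd g) b (fst (snd (fst g a))) \<noteq> fst g a}
         \<le> measure_pmf.expectation (KT a) (mismatch M0a (KT a) (RTY b))"
      "\<forall>a\<in>SX. \<forall>c\<in>{()}. measure GT {g. snd (snd g) c (snd (snd (fst g a))) \<noteq> fst g a}
         \<le> measure_pmf.expectation (KT a) (mismatch MT (KT a) RT)"
    unfolding split_def by blast
  have GT3: "emeasure GT {g. fst (snd g) b (fst (snd (fst g a))) \<noteq> fst g a}
       \<le> (\<integral>\<^sup>+s. ennreal (mismatch M0a (KT a) (RTY b) s) \<partial>KT a)" if "a \<in> SX" "b \<in> SY" for a b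
    unfolding ennreal_expectation_mismatch[symmetric] measure_pmf.emeasure_eq_measure
    using GT(3) that by (intro ennreal_leI) blast
  have GT4: "emeasure GT {g. snd (snd g) () (snd (snd (fst g a))) \<noteq> fst g a}
       \<le> (\<integral>\<^sup>+s. ennreal (mismatch MT (KT a) RT s) \<partial>KT a)" if "a \<in> SX" for a
    unfolding ennreal_expectation_mismatch[symmetric] measure_pmf.emeasure_eq_measure
    using GT(4) that by (intro ennreal_leI) blast
  obtain GU :: "(('x \<times> 't \<Rightarrow> 'u \<times> nat) \<times> ('y \<times> 't \<Rightarrow> nat \<Rightarrow> 'u)) pmf"
    where GU: "\<forall>a\<in>SX \<times> ST. map_pmf (\<lambda>g. fst (fst g a)) GU = KU a"
      "\<forall>g\<in>set_pmf GU. \<forall>a\<in>SX \<times> ST. snd (fst g a) < M0b"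
      "\<forall>a\<in>SX \<times> ST. \<forall>b\<in>SY \<times> ST. emeasure GU {g. snd g b (snd (fst g a)) \<noteq> fst (fst g a)}
         \<le> (\<integral>\<^sup>+s. ennreal (mismatch M0b (KU a) (RU b) s) \<partial>KU a)"
    using matching_code_single[of "SX \<times> ST" "SY \<times> ST" SU KU RU M0b] fin KU RU M
    unfolding split_def by blast
  obtain GV :: "(('x \<times> 't \<Rightarrow> 'v \<times> nat) \<times> ('t \<times> 'w \<Rightarrow> nat \<Rightarrow> 'v)) pmf"
    where GV: "\<forall>a\<in>SX \<times> ST. map_pmf (\<lambda>g. fst (fst g a)) GV = KV a"
      "\<forall>g\<in>set_pmf GV. \<forall>a\<in>SX \<times> ST. snd (fst g a) < MV"
      "\<forall>a\<in>SX \<times> ST. \<forall>b\<in>ST \<times> SW. emeasure GV {g. snd g b (snd (fst g a)) \<noteq> fst (fst g a)}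
         \<le> (\<integral>\<^sup>+s. ennreal (mismatch MV (KV a) (RV b) s) \<partial>KV a)"
    using matching_code_single[of "SX \<times> ST" "ST \<times> SW" SV KV RV MV] fin KV RV M
    unfolding split_def by blast
  obtain GW :: "(('u \<times> 'y \<Rightarrow> 'w \<times> nat) \<times> ('t \<times> 'v \<Rightarrow> nat \<Rightarrow> 'w)) pmf"
    where GW: "\<forall>a\<in>SU \<times> SY. map_pmf (\<lambda>g. fst (fst g a)) GW = KW a"
      "\<forall>g\<in>set_pmf GW. \<forall>a\<in>SU \<times> SY. snd (fst g a) < MW"
      "\<forall>a\<in>SU \<times> SY. \<forall>b\<in>ST \<times> SV. emeasure GW {g. snd g b (snd (fst g a)) \<noteq> fst (fst g a)}
         \<le> (\<integral>\<^sup>+s. ennreal (mismatch MW (KW a) (RW b) s) \<partial>KW a)"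
    using matching_code_single[of "SU \<times> SY" "ST \<times> SV" SW KW RW MW] fin KW RW M
    unfolding split_def by blast
  \<comment> \<open>The four codes are independent, so the code of a later variable is still fresh
    when an earlier selection is fed into it.\<close>
  define G where "G = pair_pmf GT (pair_pmf GU (pair_pmf GV GW))"
  define t where "t x gT = fst (fst gT x)"
    for x and gT :: "('x \<Rightarrow> 't \<times> nat \<times> nat) \<times> ('y \<Rightarrow> nat \<Rightarrow> 't \<times> nat \<times> nat) \<times> (unit \<Rightarrow> nat \<Rightarrow> 't \<times> nat \<times> nat)"
  define u where "u x t gU = fst (fst gU (x, t))" for x t and gU :: "('x \<times> 't \<Rightarrow> 'u \<times> nat) \<times> ('y \<times> 't \<Rightarrow> nat \<Rightarrow> 'u)"
  define v where "v x t gV = fst (fst gV (x, t))" for x t and gV :: "('x \<times> 't \<Rightarrow> 'v \<times> nat) \<times> ('t \<times> 'w \<Rightarrow> nat \<Rightarrow> 'v)"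
  define w where "w u y gW = fst (fst gW (u, y))" for u y and gW :: "('u \<times> 'y \<Rightarrow> 'w \<times> nat) \<times> ('t \<times> 'v \<Rightarrow> nat \<Rightarrow> 'w)"
  define E1 where "E1 x y gT \<longleftrightarrow> fst (snd gT) y (fst (snd (fst gT x))) \<noteq> fst gT x"
    for x y and gT :: "('x \<Rightarrow> 't \<times> nat \<times> nat) \<times> ('y \<Rightarrow> nat \<Rightarrow> 't \<times> nat \<times> nat) \<times> (unit \<Rightarrow> nat \<Rightarrow> 't \<times> nat \<times> nat)"
  define E2 where "E2 x gT \<longleftrightarrow> snd (snd gT) () (snd (snd (fst gT x))) \<noteq> fst gT x"
    for x and gT :: "('x \<Rightarrow> 't \<times> nat \<times> nat) \<times> ('y \<Rightarrow> nat \<Rightarrow> 't \<times> nat \<times> nat) \<times> (unit \<Rightarrow> nat \<Rightarrow> 't \<times> nat \<times> nat)"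
  define E3 where "E3 x y t gU \<longleftrightarrow> snd gU (y, t) (snd (fst gU (x, t))) \<noteq> u x t gU" for x y t gU
  define E4 where "E4 x t w gV \<longleftrightarrow> snd gV (t, cV w) (snd (fst gV (x, t))) \<noteq> v x t gV" for x t w gV
  define E5 where "E5 y t u v gW \<longleftrightarrow> snd gW (t, cW v) (snd (fst gW (u, y))) \<noteq> w u y gW" for y t u v gW
  define ev where "ev = (\<lambda>(gT, gU, gV, gW) (x, y).
      (x, y, t x gT, u x (t x gT) gU, v x (t x gT) gV, w (u x (t x gT) gU) y gW) \<in> B \<or> E1 x y gT \<or> E2 x gT \<or>
      E3 x y (t x gT) gU \<or> E4 x (t x gT) (w (u x (t x gT) gU) y gW) gV \<or>
      E5 y (t x gT) (u x (t x gT) gU) (v x (t x gT) gV) gW)"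
  define bound where "bound x y = (\<integral>\<^sup>+t. \<integral>\<^sup>+u. \<integral>\<^sup>+v. \<integral>\<^sup>+w. indicator B (x, y, t, u, v, w) +
      ennreal (failure_bound M0a M0b MT MV MW (x, y, t, u, v, w)) \<partial>KW (u, y) \<partial>KV (x, t) \<partial>KU (x, t) \<partial>KT x)" for x y
  have bound: "emeasure G {g. ev g (x, y)} \<le> bound x y" if xy: "(x, y) \<in> set_pmf p" for x y
  proof -
    have x: "x \<in> SX" and y: "y \<in> SY" using xy p by auto
    have lT: "(\<integral>\<^sup>+g. F (t x g) \<partial>GT) = (\<integral>\<^sup>+t. F t \<partial>KT x)" for F :: "'t \<Rightarrow> ennreal"
      unfolding t_def by (rule nn_integral_law_pmf) (use GT(1) x in blast)
    have lU: "(\<integral>\<^sup>+g. F (u x t g) \<partial>GU) = (\<integral>\<^sup>+u. F u \<partial>KU (x, t))" if "t \<in> ST" for F :: "'u \<Rightarrow> ennreal" and t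
      unfolding u_def by (rule nn_integral_law_pmf) (use GU(1) x that in blast)
    have lV: "(\<integral>\<^sup>+g. F (v x t g) \<partial>GV) = (\<integral>\<^sup>+v. F v \<partial>KV (x, t))" if "t \<in> ST" for F :: "'v \<Rightarrow> ennreal" and t
      unfolding v_def by (rule nn_integral_law_pmf) (use GV(1) x that in blast)
    have lW: "(\<integral>\<^sup>+g. F (w u y g) \<partial>GW) = (\<integral>\<^sup>+w. F w \<partial>KW (u, y))" if "u \<in> SU" for F :: "'w \<Rightarrow> ennreal" and u
      unfolding w_def by (rule nn_integral_law_pmf) (use GW(1) y that in blast)
    have sT: "t \<in> ST" if "t \<in> set_pmf (KT x)" for t using KT[OF x] that by blast
    have sU: "u \<in> SU" if "u \<in> set_pmf (KU (x, t))" "t \<in> ST" for t u using KU[OF x that(2)] that by blast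
    have sV: "v \<in> SV" if "v \<in> set_pmf (KV (x, t))" "t \<in> ST" for t v using KV[OF x that(2)] that by blast
    have sW: "w \<in> SW" if "w \<in> set_pmf (KW (u, y))" "u \<in> SU" for u w using KW[OF that(2) y] that by blast
    \<comment> \<open>Each code has the right law at every fixed argument, hence by independence
      also at an argument selected by another code; this is how the selected tuple acquires the law
      \<open>joint\<close>.\<close>
    have lTU: "(\<integral>\<^sup>+gT. \<integral>\<^sup>+gU. F (t x gT) (u x (t x gT) gU) \<partial>GU \<partial>GT) = (\<integral>\<^sup>+t. \<integral>\<^sup>+u. F t u \<partial>KU (x, t) \<partial>KT x)"
      for F :: "'t \<Rightarrow> 'u \<Rightarrow> ennreal"
    proof -
      have "(\<integral>\<^sup>+gT. \<integral>\<^sup>+gU. F (t x gT) (u x (t x gT) gU) \<partial>GU \<partial>GT) = (\<integral>\<^sup>+t. \<integral>\<^sup>+gU. F t (u x t gU) \<partial>GU \<partial>KT x)"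
        by (rule lT[where F = "\<lambda>t. \<integral>\<^sup>+gU. F t (u x t gU) \<partial>GU"])
      also have "\<dots> = (\<integral>\<^sup>+t. \<integral>\<^sup>+u. F t u \<partial>KU (x, t) \<partial>KT x)"
        by (intro nn_integral_cong_pmf lU sT)
      finally show ?thesis .
    qed
    define J where "J F = (\<integral>\<^sup>+t. \<integral>\<^sup>+u. \<integral>\<^sup>+v. \<integral>\<^sup>+w. F t u v w \<partial>KW (u, y) \<partial>KV (x, t) \<partial>KU (x, t) \<partial>KT x)"
      for F :: "'t \<Rightarrow> 'u \<Rightarrow> 'v \<Rightarrow> 'w \<Rightarrow> ennreal"
    have J_add: "J F + J H = J (\<lambda>t u v w. F t u v w + H t u v w)" for F H
      by (simp add: J_def nn_integral_add)
    have J_const: "J (\<lambda>t u v w. f t) = (\<integral>\<^sup>+t. f t \<partial>KT x)"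
      "J (\<lambda>t u v w. h t u) = (\<integral>\<^sup>+t. \<integral>\<^sup>+u. h t u \<partial>KU (x, t) \<partial>KT x)" for f h
      by (simp_all add: J_def)
    have split: "emeasure G {(gT, gU, gV, gW). P gT gU gV gW} =
        (\<integral>\<^sup>+gT. \<integral>\<^sup>+gU. \<integral>\<^sup>+gV. emeasure GW {gW. P gT gU gV gW} \<partial>GV \<partial>GU \<partial>GT)" for P
    proof -
      have "emeasure G {(gT, gU, gV, gW). P gT gU gV gW} = (\<integral>\<^sup>+g. indicator {(gT, gU, gV, gW). P gT gU gV gW} g \<partial>G)"
        by simp
      also have "\<dots> = (\<integral>\<^sup>+gT. \<integral>\<^sup>+gU. \<integral>\<^sup>+gV. \<integral>\<^sup>+gW. indicator {gW. P gT gU gV gW} gW \<partial>GW \<partial>GV \<partial>GU \<partial>GT)"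
        unfolding G_def nn_integral_pair_pmf' by (intro nn_integral_cong) (auto simp: indicator_def)
      finally show ?thesis by simp
    qed
    have 0: "emeasure G {(gT, gU, gV, gW). (x, y, t x gT, u x (t x gT) gU, v x (t x gT) gV, w (u x (t x gT) gU) y gW) \<in> B}
       \<le> (\<integral>\<^sup>+t. \<integral>\<^sup>+u. \<integral>\<^sup>+v. \<integral>\<^sup>+w. indicator B (x, y, t, u, v, w) \<partial>KW (u, y) \<partial>KV (x, t) \<partial>KU (x, t) \<partial>KT x)"
      unfolding split
    proof (subst lTU[where F = "\<lambda>t u. \<integral>\<^sup>+gV. emeasure GW {gW. (x, y, t, u, v x t gV, w u y gW) \<in> B} \<partial>GV"],
        intro nn_integral_mono_pmf)
      fix t u assume tu: "t \<in> set_pmf (KT x)" "u \<in> set_pmf (KU (x, t))"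
      have "(\<integral>\<^sup>+gV. emeasure GW {gW. (x, y, t, u, v x t gV, w u y gW) \<in> B} \<partial>GV)
          = (\<integral>\<^sup>+v. emeasure GW {gW. (x, y, t, u, v, w u y gW) \<in> B} \<partial>KV (x, t))"
        by (rule lV[where F = "\<lambda>v. emeasure GW {gW. (x, y, t, u, v, w u y gW) \<in> B}"]) (use sT tu in auto)
      also have "\<dots> = (\<integral>\<^sup>+v. \<integral>\<^sup>+gW. indicator B (x, y, t, u, v, w u y gW) \<partial>GW \<partial>KV (x, t))"
        by (intro nn_integral_cong emeasure_eq_nn_integral_pmf) (simp add: indicator_def)
      also have "\<dots> = (\<integral>\<^sup>+v. \<integral>\<^sup>+w. indicator B (x, y, t, u, v, w) \<partial>KW (u, y) \<partial>KV (x, t))"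
        by (intro nn_integral_cong_pmf lW[where F = "\<lambda>w. indicator B (x, y, t, u, _, w)"]) (use sT sU tu in auto)
      finally show "(\<integral>\<^sup>+gV. emeasure GW {gW. (x, y, t, u, v x t gV, w u y gW) \<in> B} \<partial>GV) \<le>
        (\<integral>\<^sup>+v. \<integral>\<^sup>+w. indicator B (x, y, t, u, v, w) \<partial>KW (u, y) \<partial>KV (x, t))" by simp
    qed
    have 1: "emeasure G {(gT, gU, gV, gW). E1 x y gT} \<le> (\<integral>\<^sup>+t. ennreal (mismatch M0a (KT x) (RTY y) t) \<partial>KT x)"
    proof -
      have "emeasure G {(gT, gU, gV, gW). E1 x y gT} = (\<integral>\<^sup>+gT. indicator {gT. E1 x y gT} gT \<partial>GT)"
        unfolding split by (intro nn_integral_cong) (simp add: indicator_def)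
      then show ?thesis using GT3[OF x y] by (simp add: E1_def)
    qed
    have 2: "emeasure G {(gT, gU, gV, gW). E2 x gT} \<le> (\<integral>\<^sup>+t. ennreal (mismatch MT (KT x) RT t) \<partial>KT x)"
    proof -
      have "emeasure G {(gT, gU, gV, gW). E2 x gT} = (\<integral>\<^sup>+gT. indicator {gT. E2 x gT} gT \<partial>GT)"
        unfolding split by (intro nn_integral_cong) (simp add: indicator_def)
      then show ?thesis using GT4[OF x] by (simp add: E2_def)
    qed
    have 3: "emeasure G {(gT, gU, gV, gW). E3 x y (t x gT) gU}
        \<le> (\<integral>\<^sup>+t. \<integral>\<^sup>+u. ennreal (mismatch M0b (KU (x, t)) (RU (y, t)) u) \<partial>KU (x, t) \<partial>KT x)"
    proof -
      have "emeasure G {(gT, gU, gV, gW). E3 x y (t x gT) gU} = (\<integral>\<^sup>+gT. emeasure GU {gU. E3 x y (t x gT) gU} \<partial>GT)"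
        unfolding split by (intro nn_integral_cong emeasure_eq_nn_integral_pmf[symmetric]) (simp add: indicator_def)
      also have "\<dots> = (\<integral>\<^sup>+t. emeasure GU {gU. E3 x y t gU} \<partial>KT x)"
        by (rule lT[where F = "\<lambda>t. emeasure GU {gU. E3 x y t gU}"])
      also have "\<dots> \<le> (\<integral>\<^sup>+t. \<integral>\<^sup>+u. ennreal (mismatch M0b (KU (x, t)) (RU (y, t)) u) \<partial>KU (x, t) \<partial>KT x)"
        using GU(3) x y sT by (intro nn_integral_mono_pmf) (simp add: E3_def u_def)
      finally show ?thesis .
    qed
    \<comment> \<open>Here w is side information in the race for V. The two independent codes are
      exchanged so that w is fixed while the code of V is averaged, and exchanged back to match
      \<open>joint\<close>.\<close>
    have 4: "emeasure G {(gT, gU, gV, gW). E4 x (t x gT) (w (u x (t x gT) gU) y gW) gV}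
        \<le> (\<integral>\<^sup>+t. \<integral>\<^sup>+u. \<integral>\<^sup>+v. \<integral>\<^sup>+w. ennreal (mismatch MV (KV (x, t)) (RV (t, cV w)) v) \<partial>KW (u, y) \<partial>KV (x, t) \<partial>KU (x, t) \<partial>KT x)"
      unfolding split
    proof (subst lTU[where F = "\<lambda>t u. \<integral>\<^sup>+gV. emeasure GW {gW. E4 x t (w u y gW) gV} \<partial>GV"],
        intro nn_integral_mono_pmf)
      fix t u assume tu: "t \<in> set_pmf (KT x)" "u \<in> set_pmf (KU (x, t))"
      have "(\<integral>\<^sup>+gV. emeasure GW {gW. E4 x t (w u y gW) gV} \<partial>GV)
          = (\<integral>\<^sup>+gV. \<integral>\<^sup>+gW. indicator {(gW, gV). E4 x t (w u y gW) gV} (gW, gV) \<partial>GW \<partial>GV)"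
        by (intro nn_integral_cong emeasure_eq_nn_integral_pmf) (simp add: indicator_def)
      also have "\<dots> = (\<integral>\<^sup>+gW. \<integral>\<^sup>+gV. indicator {(gW, gV). E4 x t (w u y gW) gV} (gW, gV) \<partial>GV \<partial>GW)"
        by (rule nn_integral_swap_pmf)
      also have "\<dots> = (\<integral>\<^sup>+gW. emeasure GV {gV. E4 x t (w u y gW) gV} \<partial>GW)"
        by (intro nn_integral_cong emeasure_eq_nn_integral_pmf[symmetric]) (simp add: indicator_def)
      also have "\<dots> = (\<integral>\<^sup>+w. emeasure GV {gV. E4 x t w gV} \<partial>KW (u, y))"
        by (rule lW[where F = "\<lambda>w. emeasure GV {gV. E4 x t w gV}"]) (use sU sT tu in auto)
      also have "\<dots> \<le> (\<integral>\<^sup>+w. \<integral>\<^sup>+v. ennreal (mismatch MV (KV (x, t)) (RV (t, cV w)) v) \<partial>KV (x, t) \<partial>KW (u, y))"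
        using GV(3) x sT sW sU cV tu by (intro nn_integral_mono_pmf) (simp add: E4_def v_def)
      also have "\<dots> = (\<integral>\<^sup>+v. \<integral>\<^sup>+w. ennreal (mismatch MV (KV (x, t)) (RV (t, cV w)) v) \<partial>KW (u, y) \<partial>KV (x, t))"
        by (rule nn_integral_swap_pmf)
      finally show "(\<integral>\<^sup>+gV. emeasure GW {gW. E4 x t (w u y gW) gV} \<partial>GV)
         \<le> (\<integral>\<^sup>+v. \<integral>\<^sup>+w. ennreal (mismatch MV (KV (x, t)) (RV (t, cV w)) v) \<partial>KW (u, y) \<partial>KV (x, t))" .
    qed
    have 5: "emeasure G {(gT, gU, gV, gW). E5 y (t x gT) (u x (t x gT) gU) (v x (t x gT) gV) gW}
        \<le> (\<integral>\<^sup>+t. \<integral>\<^sup>+u. \<integral>\<^sup>+v. \<integral>\<^sup>+w. ennreal (mismatch MW (KW (u, y)) (RW (t, cW v)) w) \<partial>KW (u, y) \<partial>KV (x, t) \<partial>KU (x, t) \<partial>KT x)"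
      unfolding split
    proof (subst lTU[where F = "\<lambda>t u. \<integral>\<^sup>+gV. emeasure GW {gW. E5 y t u (v x t gV) gW} \<partial>GV"],
        intro nn_integral_mono_pmf)
      fix t u assume tu: "t \<in> set_pmf (KT x)" "u \<in> set_pmf (KU (x, t))"
      have "(\<integral>\<^sup>+gV. emeasure GW {gW. E5 y t u (v x t gV) gW} \<partial>GV) = (\<integral>\<^sup>+v. emeasure GW {gW. E5 y t u v gW} \<partial>KV (x, t))"
        by (rule lV[where F = "\<lambda>v. emeasure GW {gW. E5 y t u v gW}"]) (use sT tu in auto)
      also have "\<dots> \<le> (\<integral>\<^sup>+v. \<integral>\<^sup>+w. ennreal (mismatch MW (KW (u, y)) (RW (t, cW v)) w) \<partial>KW (u, y) \<partial>KV (x, t))"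
        using GW(3) y sT sV sU cW tu by (intro nn_integral_mono_pmf) (simp add: E5_def w_def)
      finally show "(\<integral>\<^sup>+gV. emeasure GW {gW. E5 y t u (v x t gV) gW} \<partial>GV)
         \<le> (\<integral>\<^sup>+v. \<integral>\<^sup>+w. ennreal (mismatch MW (KW (u, y)) (RW (t, cW v)) w) \<partial>KW (u, y) \<partial>KV (x, t))" .
    qed
    have sub: "emeasure G (A1 \<union> A2) \<le> a1 + a2" if "emeasure G A1 \<le> a1" "emeasure G A2 \<le> a2" for A1 A2 a1 a2
      by (rule order_trans[OF emeasure_subadditive add_mono[OF that]]) simp_all
    have union: "{g. ev g (x, y)} = {(gT, gU, gV, gW). (x, y, t x gT, u x (t x gT) gU, v x (t x gT) gV, w (u x (t x gT) gU) y gW) \<in> B} \<union>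
      ({(gT, gU, gV, gW). E1 x y gT} \<union> ({(gT, gU, gV, gW). E2 x gT} \<union> ({(gT, gU, gV, gW). E3 x y (t x gT) gU} \<union>
      ({(gT, gU, gV, gW). E4 x (t x gT) (w (u x (t x gT) gU) y gW) gV} \<union>
       {(gT, gU, gV, gW). E5 y (t x gT) (u x (t x gT) gU) (v x (t x gT) gV) gW}))))"
      by (auto simp: ev_def)
    have "emeasure G {g. ev g (x, y)} \<le> J (\<lambda>t u v w. indicator B (x, y, t, u, v, w)) +
      (J (\<lambda>t u v w. ennreal (mismatch M0a (KT x) (RTY y) t)) + (J (\<lambda>t u v w. ennreal (mismatch MT (KT x) RT t)) +
      (J (\<lambda>t u v w. ennreal (mismatch M0b (KU (x, t)) (RU (y, t)) u)) +
      (J (\<lambda>t u v w. ennreal (mismatch MV (KV (x, t)) (RV (t, cV w)) v)) +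
       J (\<lambda>t u v w. ennreal (mismatch MW (KW (u, y)) (RW (t, cW v)) w))))))"
      unfolding union J_const
      by (rule sub, unfold J_def, rule 0, rule sub, rule 1, rule sub, rule 2, rule sub, rule 3, rule sub, rule 4, rule 5)
    also have "\<dots> = J (\<lambda>t u v w. indicator B (x, y, t, u, v, w) +
        ennreal (failure_bound M0a M0b MT MV MW (x, y, t, u, v, w)))"
      unfolding J_add
    proof (rule arg_cong[where f = J], intro ext)
      fix t u v w
      show "indicator B (x, y, t, u, v, w) + (ennreal (mismatch M0a (KT x) (RTY y) t) + (ennreal (mismatch MT (KT x) RT t) +
          (ennreal (mismatch M0b (KU (x, t)) (RU (y, t)) u) + (ennreal (mismatch MV (KV (x, t)) (RV (t, cV w)) v) +
           ennreal (mismatch MW (KW (u, y)) (RW (t, cW v)) w)))))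
        = indicator B (x, y, t, u, v, w) + ennreal (failure_bound M0a M0b MT MV MW (x, y, t, u, v, w))"
        unfolding failure_bound_def prod.case
        by (simp only: ennreal_plus mismatch_nonneg add_nonneg_nonneg add.assoc)
    qed
    also have "\<dots> = bound x y" by (simp only: J_def bound_def)
    finally show ?thesis .
  qed
  have "(\<integral>\<^sup>+g. emeasure p {xy. ev g xy} \<partial>G) = (\<integral>\<^sup>+g. \<integral>\<^sup>+xy. indicator {(g, xy). ev g xy} (g, xy) \<partial>p \<partial>G)"
    by (intro nn_integral_cong emeasure_eq_nn_integral_pmf) (simp add: indicator_def)
  also have "\<dots> = (\<integral>\<^sup>+xy. \<integral>\<^sup>+g. indicator {(g, xy). ev g xy} (g, xy) \<partial>G \<partial>p)"
    by (rule nn_integral_swap_pmf)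
  also have "\<dots> = (\<integral>\<^sup>+xy. emeasure G {g. ev g xy} \<partial>p)"
    by (intro nn_integral_cong emeasure_eq_nn_integral_pmf[symmetric]) (simp add: indicator_def)
  also have "\<dots> \<le> (\<integral>\<^sup>+xy. bound (fst xy) (snd xy) \<partial>p)"
    using bound by (intro nn_integral_mono_pmf) auto
  also have "\<dots> = (\<integral>\<^sup>+s. indicator B s + ennreal (failure_bound M0a M0b MT MV MW s) \<partial>joint)"
    unfolding nn_integral_joint bound_def ..
  also have "\<dots> = emeasure joint B + (\<integral>\<^sup>+s. ennreal (failure_bound M0a M0b MT MV MW s) \<partial>joint)"
    by (subst nn_integral_add) auto
  also have "\<dots> < ennreal \<delta>" by (rule small)
  finally have less: "(\<integral>\<^sup>+g. emeasure p {xy. ev g xy} \<partial>G) < ennreal \<delta>" .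
  \<comment> \<open>Derandomisation: a mean below \<open>\<delta>\<close> forces a realisation of
    the codes whose failure probability is at most \<open>\<delta>\<close>.\<close>
  have "\<exists>g\<in>set_pmf G. emeasure p {xy. ev g xy} \<le> ennreal \<delta>"
  proof (rule ccontr)
    assume "\<not> ?thesis"
    then have "(\<integral>\<^sup>+g. ennreal \<delta> \<partial>G) \<le> (\<integral>\<^sup>+g. emeasure p {xy. ev g xy} \<partial>G)"
      by (intro nn_integral_mono_pmf) (auto simp: not_le)
    with less show False by simp
  qed
  then obtain gT gU gV gW where g: "gT \<in> set_pmf GT" "gU \<in> set_pmf GU" "gV \<in> set_pmf GV" "gW \<in> set_pmf GW"
    and ev: "emeasure p {xy. ev (gT, gU, gV, gW) xy} \<le> ennreal \<delta>"
    by (auto simp: G_def)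
  have r: "fst (fst g a) \<in> S" if "g \<in> set_pmf G" "map_pmf (\<lambda>g. fst (fst g a)) G = K a" "set_pmf (K a) \<subseteq> S"
    for g a S K and G :: "(('a \<Rightarrow> 'b \<times> 'c) \<times> 'd) pmf"
    using that(1,3) unfolding that(2)[symmetric] by auto
  have ev_eq: "{xy. ev (gT, gU, gV, gW) xy} = {(x, y). let t = fst (fst gT x); u = fst (fst gU (x, t)); v = fst (fst gV (x, t)); w = fst (fst gW (u, y)) in
        (x, y, t, u, v, w) \<in> B \<or> fst (snd gT) y (fst (snd (fst gT x))) \<noteq> fst gT x \<or> snd (snd gT) () (snd (snd (fst gT x))) \<noteq> fst gT x \<or>
        snd gU (y, t) (snd (fst gU (x, t))) \<noteq> u \<or> snd gV (t, cV w) (snd (fst gV (x, t))) \<noteq> v \<or> snd gW (t, cW v) (snd (fst gW (u, y))) \<noteq> w}"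
    by (auto simp: ev_def Let_def E1_def E2_def E3_def E4_def E5_def t_def u_def v_def w_def)
  show ?thesis
  proof (intro exI[of _ "fst gT"] exI[of _ "fst (snd gT)"] exI[of _ "snd (snd gT) ()"] exI[of _ "fst gU"] exI[of _ "snd gU"]
        exI[of _ "fst gV"] exI[of _ "snd gV"] exI[of _ "fst gW"] exI[of _ "snd gW"] conjI ballI)
    show "fst (fst gT x) \<in> ST" "snd (fst gT x) \<in> {..<M0a} \<times> {..<MT}" if "x \<in> SX" for x
      using r[of gT GT x KT ST] GT(1,2) KT g(1) that by blast+
    show "fst (fst gU (x, t)) \<in> SU" "snd (fst gU (x, t)) < M0b" if "x \<in> SX" "t \<in> ST" for x t
      using r[of gU GU "(x, t)" KU SU] GU(1,2) KU g(2) that by blast+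
    show "fst (fst gV (x, t)) \<in> SV" "snd (fst gV (x, t)) < MV" if "x \<in> SX" "t \<in> ST" for x t
      using r[of gV GV "(x, t)" KV SV] GV(1,2) KV g(3) that by blast+
    show "fst (fst gW (u, y)) \<in> SW" "snd (fst gW (u, y)) < MW" if "u \<in> SU" "y \<in> SY" for u y
      using r[of gW GW "(u, y)" KW SW] GW(1,2) KW g(4) that by blast+
  qed (use ev in \<open>simp only: ev_eq\<close>)
qed

end

section \<open>Block coding\<close>

fun list_kernel :: "('a \<Rightarrow> 's pmf) \<Rightarrow> 'a list \<Rightarrow> 's list pmf" where
  "list_kernel K [] = return_pmf []"
| "list_kernel K (a # as) = do {s \<leftarrow> K a; ss \<leftarrow> list_kernel K as; return_pmf (s # ss)}"

lemma set_list_kernel: "set_pmf (list_kernel K as) = {ss. list_all2 (\<lambda>a s. s \<in> set_pmf (K a)) as ss}"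
proof (induction as)
  case (Cons a as)
  have "set_pmf (list_kernel K (a # as)) = {s # ss |s ss. s \<in> set_pmf (K a) \<and> ss \<in> set_pmf (list_kernel K as)}"
    by auto
  then show ?case unfolding Cons.IH by (auto simp: list_all2_Cons1)
qed simp

lemma pmf_bind_Cons:
  "pmf (do {s \<leftarrow> P; ss \<leftarrow> R; return_pmf (s # ss)}) (s # ss) = pmf P s * pmf R ss"
proof -
  have "do {s \<leftarrow> P; ss \<leftarrow> R; return_pmf (s # ss)} = map_pmf (\<lambda>(s, ss). s # ss) (pair_pmf P R)"
    by (simp add: pair_pmf_def map_bind_pmf)
  also have "pmf \<dots> ((\<lambda>(s, ss). s # ss) (s, ss)) = pmf (pair_pmf P R) (s, ss)"
    by (rule pmf_map_inj') (auto simp: inj_def)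
  finally show ?thesis by (simp add: pmf_pair)
qed

lemma pmf_list_kernel_map: "pmf (list_kernel K (map A l)) (map S l) = (\<Prod>z\<leftarrow>l. pmf (K (A z)) (S z))"
  by (induction l) (simp_all add: pmf_bind_Cons del: pmf_bind)

section \<open>Moments of i.i.d. sums and the weak law\<close>

lemma finite_set_replicate_pmf: "finite (set_pmf Q) \<Longrightarrow> finite (set_pmf (replicate_pmf n Q))"
  by (induction n) auto

lemma expectation_bind_finite:
  fixes h :: "'b \<Rightarrow> real"
  assumes "finite (set_pmf P)" "\<And>x. x \<in> set_pmf P \<Longrightarrow> finite (set_pmf (f x))"
  shows "measure_pmf.expectation (bind_pmf P f) h = measure_pmf.expectation P (\<lambda>x. measure_pmf.expectation (f x) h)"
proof -
  have "measure_pmf.expectation (bind_pmf P f) h = (\<Sum>a\<in>set_pmf P. pmf P a *\<^sub>R measure_pmf.expectation (f a) h)"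
    by (rule pmf_expectation_bind) (use assms in auto)
  also have "\<dots> = measure_pmf.expectation P (\<lambda>x. measure_pmf.expectation (f x) h)"
    by (rule integral_measure_pmf[symmetric]) (use assms in auto)
  finally show ?thesis .
qed

lemma expectation_replicate_Suc:
  fixes h :: "'a list \<Rightarrow> real"
  assumes "finite (set_pmf Q)"
  shows "measure_pmf.expectation (replicate_pmf (Suc n) Q) h =
    measure_pmf.expectation Q (\<lambda>a. measure_pmf.expectation (replicate_pmf n Q) (\<lambda>l. h (a # l)))"
  using assms by (simp add: expectation_bind_finite finite_set_replicate_pmf)

context
  fixes Q :: "'a pmf" and f :: "'a \<Rightarrow> real"
  assumes fin: "finite (set_pmf Q)"
begin

private lemma integrable_Q: "integrable (measure_pmf Q) (h :: 'a \<Rightarrow> real)"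
  using fin by (rule integrable_measure_pmf_finite)

private lemma integrable_rep: "integrable (measure_pmf (replicate_pmf n Q)) (h :: 'a list \<Rightarrow> real)"
  using fin by (intro integrable_measure_pmf_finite finite_set_replicate_pmf)

lemma expectation_sum_replicate:
  "measure_pmf.expectation (replicate_pmf n Q) (\<lambda>l. sum_list (map f l)) = real n * measure_pmf.expectation Q f"
  by (induction n) (simp_all add: expectation_replicate_Suc[OF fin] integrable_Q integrable_rep algebra_simps
     del: replicate_pmf.simps(2))

lemma second_moment_replicate:
  assumes "measure_pmf.expectation Q f = 0"
  shows "measure_pmf.expectation (replicate_pmf n Q) (\<lambda>l. (sum_list (map f l))\<^sup>2) = real n * measure_pmf.expectation Q (\<lambda>a. (f a)\<^sup>2)"
proof (induction n)
  case (Suc n)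
  have "measure_pmf.expectation (replicate_pmf n Q) (\<lambda>l. (sum_list (map f (a # l)))\<^sup>2)
     = (f a)\<^sup>2 + real n * measure_pmf.expectation Q (\<lambda>a. (f a)\<^sup>2)" for a
    using Suc expectation_sum_replicate[of n] assms
    by (simp add: power2_sum integrable_rep algebra_simps)
  then show ?case
    by (simp add: expectation_replicate_Suc[OF fin] integrable_Q algebra_simps del: replicate_pmf.simps(2) list.map sum_list.Cons)
qed simp

end

text \<open>Chebyshev's inequality for the centred sum, whose second moment grows linearly in n.
  Only upper deviations are stated: log-likelihood ratios and distortions both have to be bounded
  from above.\<close>

lemma weak_law_replicate:
  fixes Q :: "'a pmf" and f :: "'a \<Rightarrow> real"
  assumes fin: "finite (set_pmf Q)" and \<delta>: "\<delta> > 0"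
  shows "(\<lambda>n. measure (replicate_pmf n Q) {l. sum_list (map f l) \<ge> real n * (measure_pmf.expectation Q f + \<delta>)}) \<longlonglongrightarrow> 0"
proof -
  define \<mu> where "\<mu> = measure_pmf.expectation Q f"
  define c where "c a = f a - \<mu>" for a
  define \<sigma> where "\<sigma> = measure_pmf.expectation Q (\<lambda>a. (c a)\<^sup>2)"
  have int: "integrable (measure_pmf Q) h" for h :: "'a \<Rightarrow> real"
    using fin by (rule integrable_measure_pmf_finite)
  have int': "integrable (measure_pmf (replicate_pmf n Q)) h" for n and h :: "'a list \<Rightarrow> real"
    using fin by (intro integrable_measure_pmf_finite finite_set_replicate_pmf)
  have c0: "measure_pmf.expectation Q c = 0"
    by (simp add: c_def[abs_def] \<mu>_def int)
  have sum_c: "sum_list (map c l) = sum_list (map f l) - real (length l) * \<mu>" for l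
    by (induction l) (simp_all add: c_def algebra_simps)
  have bound: "measure (replicate_pmf n Q) {l. sum_list (map f l) \<ge> real n * (\<mu> + \<delta>)} \<le> \<sigma> / \<delta>\<^sup>2 / real n" if n: "n > 0" for n
  proof -
    have E0: "measure_pmf.expectation (replicate_pmf n Q) (\<lambda>l. sum_list (map c l)) = 0"
      using expectation_sum_replicate[OF fin] c0 by simp
    have "measure (replicate_pmf n Q) {l. sum_list (map f l) \<ge> real n * (\<mu> + \<delta>)}
      = measure (replicate_pmf n Q) ({l. sum_list (map f l) \<ge> real n * (\<mu> + \<delta>)} \<inter> set_pmf (replicate_pmf n Q))"
      by (simp add: measure_Int_set_pmf)
    also have "\<dots> \<le> measure (replicate_pmf n Q) {l. \<bar>sum_list (map c l)\<bar> \<ge> real n * \<delta>}"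
      by (intro measure_pmf.finite_measure_mono) (auto simp: sum_c set_replicate_pmf algebra_simps)
    also have "\<dots> \<le> measure_pmf.expectation (replicate_pmf n Q) (\<lambda>l. (sum_list (map c l))\<^sup>2) / (real n * \<delta>)\<^sup>2"
      using measure_pmf.Chebyshev_inequality[of "\<lambda>l. sum_list (map c l)" "replicate_pmf n Q" "real n * \<delta>"] E0 n \<delta> int'
      by simp
    also have "\<dots> = \<sigma> / \<delta>\<^sup>2 / real n"
      using second_moment_replicate[OF fin c0, of n] n by (simp add: \<sigma>_def power_mult_distrib power2_eq_square)
    finally show ?thesis .
  qed
  have "(\<lambda>n. \<sigma> / \<delta>\<^sup>2 / real n) \<longlonglongrightarrow> 0" by (rule lim_const_over_n)
  then show ?thesis
    by (rule tendsto_sandwich[OF _ _ tendsto_const, rotated 2])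
      (use bound in \<open>auto intro!: eventually_sequentiallyI[of 1] simp: \<mu>_def\<close>)
qed

text \<open>Letters are independent, so the draws of source letters and kernel letters may be
  interleaved. The arbitrary continuation \<open>F\<close> permits repeated use, each time attaching
  one more coordinate to the i.i.d. list.\<close>

lemma bind_replicate_list_kernel:
  "bind_pmf (replicate_pmf n q) (\<lambda>l. bind_pmf (list_kernel K (map h l)) (F l)) =
   bind_pmf (replicate_pmf n (do {a \<leftarrow> q; s \<leftarrow> K (h a); return_pmf (a, s)})) (\<lambda>l. F (map fst l) (map snd l))"
proof (induction n arbitrary: F)
  case 0
  then show ?case by (simp add: bind_return_pmf)
next
  case (Suc n)
  have "bind_pmf (replicate_pmf (Suc n) q) (\<lambda>l. bind_pmf (list_kernel K (map h l)) (F l)) =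
    do {a \<leftarrow> q; l \<leftarrow> replicate_pmf n q; s \<leftarrow> K (h a); ss \<leftarrow> list_kernel K (map h l); F (a # l) (s # ss)}"
    by (simp add: bind_assoc_pmf bind_return_pmf)
  also have "\<dots> = do {a \<leftarrow> q; s \<leftarrow> K (h a); l \<leftarrow> replicate_pmf n q; ss \<leftarrow> list_kernel K (map h l); F (a # l) (s # ss)}"
    by (rule bind_pmf_cong[OF refl], rule bind_commute_pmf)
  also have "\<dots> = do {a \<leftarrow> q; s \<leftarrow> K (h a); l \<leftarrow> replicate_pmf n (do {a \<leftarrow> q; s \<leftarrow> K (h a); return_pmf (a, s)});
       F (a # map fst l) (s # map snd l)}"
    by (rule bind_pmf_cong[OF refl])+ (rule Suc.IH)
  also have "\<dots> = bind_pmf (replicate_pmf (Suc n) (do {a \<leftarrow> q; s \<leftarrow> K (h a); return_pmf (a, s)})) (\<lambda>l. F (map fst l) (map snd l))"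
    by (simp add: bind_assoc_pmf bind_return_pmf)
  finally show ?case .
qed

text \<open>For real z >= 1 the floor exceeds z - 1 and is at least 1, hence is at least z / 2; the
  lost factor 2 is harmless against exponential decay.\<close>

lemma msgs_ge:
  assumes "\<rho> \<ge> 0"
  shows "msgs n \<rho> \<ge> 1" "real (msgs n \<rho>) \<ge> 2 powr (real n * \<rho>) / 2"
proof -
  have 1: "2 powr (real n * \<rho>) \<ge> (1 :: real)" using assms by (simp add: ge_one_powr_ge_zero)
  then have "\<lfloor>2 powr (real n * \<rho>)\<rfloor> \<ge> 1" by (simp add: le_floor_iff)
  then show "msgs n \<rho> \<ge> 1" unfolding msgs_def by linarith
  have "real (msgs n \<rho>) = real_of_int \<lfloor>2 powr (real n * \<rho>)\<rfloor>"
    using \<open>\<lfloor>_\<rfloor> \<ge> 1\<close> by (simp add: msgs_def)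
  also have "\<dots> \<ge> 2 powr (real n * \<rho>) - 1" by linarith
  moreover have "real_of_int \<lfloor>2 powr (real n * \<rho>)\<rfloor> \<ge> 1" using \<open>\<lfloor>_\<rfloor> \<ge> 1\<close> by linarith
  ultimately show "real (msgs n \<rho>) \<ge> 2 powr (real n * \<rho>) / 2" by linarith
qed

text \<open>A product of floors is an integer below the product, hence below the floor of any larger
  number. Packing two messages into one therefore costs no rate, even at finite block
  length.\<close>

lemma msgs_mult_le: "msgs n r * msgs m s \<le> msgs k t" if "real n * r + real m * s \<le> real k * t"
proof -
  have "real_of_int \<lfloor>2 powr (real n * r)\<rfloor> * real_of_int \<lfloor>2 powr (real m * s)\<rfloor> \<le> 2 powr (real n * r) * 2 powr (real m * s)"
    by (intro mult_mono) (auto simp: zero_le_floor)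
  also have "\<dots> \<le> 2 powr (real k * t)" using that by (simp add: powr_add[symmetric])
  finally have "\<lfloor>2 powr (real n * r)\<rfloor> * \<lfloor>2 powr (real m * s)\<rfloor> \<le> \<lfloor>2 powr (real k * t)\<rfloor>"
    by (simp add: le_floor_iff)
  then show ?thesis by (simp add: msgs_def nat_mult_distrib[symmetric] nat_mono)
qed

text \<open>Let r be the mean log-likelihood ratio and \<open>\<delta>\<close> half of the gap
  between \<open>\<rho>\<close> and r. By the weak law the ratio of the block probabilities is below
  2 powr (n (r + \<delta>)) except with vanishing probability. Outside that exception the mismatch
  is at most this ratio over the number of messages, that is 2 * 2 powr (- n \<delta>).\<close>

lemma mismatch_block_tendsto:
  fixes Q :: "'o pmf"
  assumes fin: "finite (set_pmf Q)"
    and pos: "\<And>z. z \<in> set_pmf Q \<Longrightarrow> pmf (K (A z)) (S z) > 0" "\<And>z. z \<in> set_pmf Q \<Longrightarrow> pmf (R (B z)) (S z) > 0"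
    and rate: "\<rho> > measure_pmf.expectation Q (\<lambda>z. log 2 (pmf (K (A z)) (S z) / pmf (R (B z)) (S z)))" and \<rho>: "\<rho> \<ge> 0"
  shows "(\<lambda>n. measure_pmf.expectation (replicate_pmf n Q)
     (\<lambda>l. mismatch (msgs n \<rho>) (list_kernel K (map A l)) (list_kernel R (map B l)) (map S l))) \<longlonglongrightarrow> 0"
proof -
  define f where "f z = log 2 (pmf (K (A z)) (S z) / pmf (R (B z)) (S z))" for z
  define r where "r = measure_pmf.expectation Q f"
  define \<delta> where "\<delta> = (\<rho> - r) / 2"
  have \<delta>: "\<delta> > 0" using rate by (simp add: \<delta>_def r_def f_def[abs_def])
  define Bad where "Bad n = {l. sum_list (map f l) \<ge> real n * (r + \<delta>)}" for n
  let ?m = "\<lambda>n l. mismatch (msgs n \<rho>) (list_kernel K (map A l)) (list_kernel R (map B l)) (map S l)"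
  have prods: "(\<Prod>z\<leftarrow>l. pmf (K (A z)) (S z)) = 2 powr (sum_list (map f l)) * (\<Prod>z\<leftarrow>l. pmf (R (B z)) (S z)) \<and>
      (\<Prod>z\<leftarrow>l. pmf (R (B z)) (S z)) > 0" if "set l \<subseteq> set_pmf Q" for l
    using that
  proof (induction l)
    case (Cons z l)
    have "pmf (K (A z)) (S z) = 2 powr f z * pmf (R (B z)) (S z)"
      using pos[of z] Cons.prems by (simp add: f_def)
    then show ?case using Cons pos[of z] by (simp add: powr_add)
  qed simp
  have point: "?m n l \<le> indicator (Bad n) l + 2 * 2 powr (- real n * \<delta>)" if l: "l \<in> set_pmf (replicate_pmf n Q)" for n l
  proof (cases "l \<in> Bad n")
    case True
    then show ?thesis using mismatch_le_1[of "msgs n \<rho>" "list_kernel K (map A l)" "list_kernel R (map B l)" "map S l"]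
      by (simp add: add_increasing2)
  next
    case False
    define k where "k = (\<Prod>z\<leftarrow>l. pmf (K (A z)) (S z))"
    define q where "q = (\<Prod>z\<leftarrow>l. pmf (R (B z)) (S z))"
    define M where "M = real (msgs n \<rho>)"
    have "set l \<subseteq> set_pmf Q" using l by (auto simp: set_replicate_pmf)
    from prods[OF this] have kq: "k = 2 powr (sum_list (map f l)) * q" "q > 0" by (auto simp: k_def q_def)
    have M: "M \<ge> 2 powr (real n * \<rho>) / 2" "M > 0" using msgs_ge[OF \<rho>, of n] by (auto simp: M_def)
    have k0: "k > 0" using kq by simp
    have "?m n l = k / (k + M * q)" by (simp add: mismatch_def pmf_list_kernel_map k_def q_def M_def)
    also have "\<dots> \<le> k / (M * q)" using k0 kq M by (intro divide_left_mono) (auto intro!: mult_pos_pos add_pos_pos)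
    also have "\<dots> = 2 powr (sum_list (map f l)) / M" using kq by simp
    also have "\<dots> \<le> 2 powr (real n * (r + \<delta>)) / (2 powr (real n * \<rho>) / 2)"
      using False M by (intro frac_le) (auto simp: Bad_def)
    also have "\<dots> = 2 * 2 powr (- real n * \<delta>)"
    proof -
      have "real n * (r + \<delta>) - real n * \<rho> = - real n * \<delta>" by (simp add: \<delta>_def field_simps)
      then have "2 powr (real n * (r + \<delta>)) / 2 powr (real n * \<rho>) = 2 powr (- real n * \<delta>)"
        by (simp add: powr_diff[symmetric])
      moreover have "x / (y / 2) = 2 * (x / y)" for x y :: real by simp
      ultimately show ?thesis by (simp only:)
    qed
    finally show ?thesis using False by simp
  qed
  have int: "integrable (measure_pmf (replicate_pmf n Q)) h" for n and h :: "'o list \<Rightarrow> real"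
    using fin by (intro integrable_measure_pmf_finite finite_set_replicate_pmf)
  have le: "measure_pmf.expectation (replicate_pmf n Q) (?m n) \<le> measure (replicate_pmf n Q) (Bad n) + 2 * 2 powr (- real n * \<delta>)" for n
  proof -
    have "measure_pmf.expectation (replicate_pmf n Q) (?m n) \<le>
       measure_pmf.expectation (replicate_pmf n Q) (\<lambda>l. indicator (Bad n) l + 2 * 2 powr (- real n * \<delta>))"
      using point by (intro integral_mono_AE int) (auto simp: AE_measure_pmf_iff)
    then show ?thesis by (simp add: int)
  qed
  have "(\<lambda>n. measure (replicate_pmf n Q) (Bad n)) \<longlonglongrightarrow> 0"
    using weak_law_replicate[OF fin \<delta>, of f] by (simp add: Bad_def r_def)
  moreover have "(\<lambda>n. 2 * 2 powr (- real n * \<delta>)) \<longlonglongrightarrow> 0"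
  proof -
    have "(\<lambda>n. 2 * (2 powr (- \<delta>)) ^ n) \<longlonglongrightarrow> 2 * 0"
      using \<delta> by (intro tendsto_mult tendsto_const LIMSEQ_realpow_zero) (auto simp: powr_less_one)
    moreover have "(2 powr (- \<delta>)) ^ n = 2 powr (- real n * \<delta>)" for n
      by (simp add: powr_realpow[symmetric] powr_powr mult.commute)
    ultimately show ?thesis by simp
  qed
  ultimately have "(\<lambda>n. measure (replicate_pmf n Q) (Bad n) + 2 * 2 powr (- real n * \<delta>)) \<longlonglongrightarrow> 0 + 0"
    by (rule tendsto_add)
  then have lim: "(\<lambda>n. measure (replicate_pmf n Q) (Bad n) + 2 * 2 powr (- real n * \<delta>)) \<longlonglongrightarrow> 0" by simp
  show ?thesis
  proof (rule tendsto_sandwich[OF _ _ tendsto_const lim])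
    show "\<forall>\<^sub>F n in sequentially. 0 \<le> measure_pmf.expectation (replicate_pmf n Q) (?m n)"
      by (intro always_eventually allI Bochner_Integration.integral_nonneg mismatch_nonneg)
  qed (intro always_eventually allI le)
qed

section \<open>Lifting the single-letter scheme to blocks\<close>

abbreviation oX :: "'x \<times> 'y \<times> 't \<times> 'u \<times> 'v \<times> 'w \<Rightarrow> 'x" where "oX \<equiv> \<lambda>(x, y, t, u, v, w). x"
abbreviation oY :: "'x \<times> 'y \<times> 't \<times> 'u \<times> 'v \<times> 'w \<Rightarrow> 'y" where "oY \<equiv> \<lambda>(x, y, t, u, v, w). y"
abbreviation oT :: "'x \<times> 'y \<times> 't \<times> 'u \<times> 'v \<times> 'w \<Rightarrow> 't" where "oT \<equiv> \<lambda>(x, y, t, u, v, w). t"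
abbreviation oU :: "'x \<times> 'y \<times> 't \<times> 'u \<times> 'v \<times> 'w \<Rightarrow> 'u" where "oU \<equiv> \<lambda>(x, y, t, u, v, w). u"
abbreviation oV :: "'x \<times> 'y \<times> 't \<times> 'u \<times> 'v \<times> 'w \<Rightarrow> 'v" where "oV \<equiv> \<lambda>(x, y, t, u, v, w). v"
abbreviation oW :: "'x \<times> 'y \<times> 't \<times> 'u \<times> 'v \<times> 'w \<Rightarrow> 'w" where "oW \<equiv> \<lambda>(x, y, t, u, v, w). w"

definition unzip6 :: "('x \<times> 'y \<times> 't \<times> 'u \<times> 'v \<times> 'w) list \<Rightarrow>
    'x list \<times> 'y list \<times> 't list \<times> 'u list \<times> 'v list \<times> 'w list" where
  "unzip6 l = (map oX l, map oY l, map oT l, map oU l, map oV l, map oW l)"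

text \<open>Takes a pair of lists where \<open>list_kernel\<close> would want a list of pairs, so
  that block kernels have the argument shape of \<open>coding_scheme\<close> and the one-shot
  analysis applies to blocks verbatim.\<close>

definition zip_kernel :: "('a \<times> 'b \<Rightarrow> 's pmf) \<Rightarrow> 'a list \<times> 'b list \<Rightarrow> 's list pmf" where
  "zip_kernel K = (\<lambda>(as, bs). list_kernel K (zip as bs))"

lemma zip_map_same: "zip (map f l) (map g l) = map (\<lambda>x. (f x, g x)) l"
  by (induction l) auto

lemma zip_kernel_map: "zip_kernel K (map f l, map g l) = list_kernel K (map (\<lambda>x. (f x, g x)) l)"
  by (simp add: zip_kernel_def zip_map_same)

lemma replicate_map_pmf: "replicate_pmf n (map_pmf h q) = map_pmf (map h) (replicate_pmf n q)"
  by (induction n) (simp_all add: map_bind_pmf bind_map_pmf)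

definition block_source :: "nat \<Rightarrow> ('x \<times> 'y) pmf \<Rightarrow> ('x list \<times> 'y list) pmf" where
  "block_source n p = map_pmf (\<lambda>l. (map fst l, map snd l)) (replicate_pmf n p)"

text \<open>Starting from the i.i.d. source, each kernel attaches one coordinate to the i.i.d. list;
  the nested pairs are flattened at the end. Events about the selected sequences thus become events
  about i.i.d. tuples, where the weak law applies.\<close>

lemma (in coding_kernels) block_joint:
  "coding_kernels.joint (block_source n p) (list_kernel KT) (zip_kernel KU) (zip_kernel KV) (zip_kernel KW)
     = map_pmf unzip6 (replicate_pmf n joint)"
proof -
  define q1 where "q1 = do {a \<leftarrow> p; s \<leftarrow> KT (fst a); return_pmf (a, s)}"
  define q2 where "q2 = do {a \<leftarrow> q1; s \<leftarrow> KU (fst (fst a), snd a); return_pmf (a, s)}"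
  define q3 where "q3 = do {a \<leftarrow> q2; s \<leftarrow> KV (fst (fst (fst a)), snd (fst a)); return_pmf (a, s)}"
  define q4 where "q4 = do {a \<leftarrow> q3; s \<leftarrow> KW (snd (fst a), snd (fst (fst (fst a)))); return_pmf (a, s)}"
  have "coding_kernels.joint (block_source n p) (list_kernel KT) (zip_kernel KU) (zip_kernel KV) (zip_kernel KW)
      = do {l \<leftarrow> replicate_pmf n p; ts \<leftarrow> list_kernel KT (map fst l);
            us \<leftarrow> zip_kernel KU (map fst l, ts); vs \<leftarrow> zip_kernel KV (map fst l, ts); ws \<leftarrow> zip_kernel KW (us, map snd l);
            return_pmf (map fst l, map snd l, ts, us, vs, ws)}"
    by (simp add: coding_kernels.joint_def block_source_def bind_map_pmf)
  also have "\<dots> = do {l \<leftarrow> replicate_pmf n q1; us \<leftarrow> list_kernel KU (map (\<lambda>a. (fst (fst a), snd a)) l);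
      vs \<leftarrow> zip_kernel KV (map (\<lambda>a. fst (fst a)) l, map snd l); ws \<leftarrow> zip_kernel KW (us, map (\<lambda>a. snd (fst a)) l);
      return_pmf (map (\<lambda>a. fst (fst a)) l, map (\<lambda>a. snd (fst a)) l, map snd l, us, vs, ws)}"
    by (subst bind_replicate_list_kernel) (simp add: q1_def zip_kernel_map comp_def)
  also have "\<dots> = do {l \<leftarrow> replicate_pmf n q2; vs \<leftarrow> list_kernel KV (map (\<lambda>a. (fst (fst (fst a)), snd (fst a))) l);
      ws \<leftarrow> zip_kernel KW (map snd l, map (\<lambda>a. snd (fst (fst a))) l);
      return_pmf (map (\<lambda>a. fst (fst (fst a))) l, map (\<lambda>a. snd (fst (fst a))) l, map (\<lambda>a. snd (fst a)) l, map snd l, vs, ws)}"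
    by (subst bind_replicate_list_kernel) (simp add: q2_def zip_kernel_map comp_def)
  also have "\<dots> = do {l \<leftarrow> replicate_pmf n q3; ws \<leftarrow> list_kernel KW (map (\<lambda>a. (snd (fst a), snd (fst (fst (fst a))))) l);
      return_pmf (map (\<lambda>a. fst (fst (fst (fst a)))) l, map (\<lambda>a. snd (fst (fst (fst a)))) l, map (\<lambda>a. snd (fst (fst a))) l,
        map (\<lambda>a. snd (fst a)) l, map snd l, ws)}"
    by (subst bind_replicate_list_kernel) (simp add: q3_def zip_kernel_map comp_def)
  also have "\<dots> = do {l \<leftarrow> replicate_pmf n q4;
      return_pmf (map (\<lambda>a. fst (fst (fst (fst (fst a))))) l, map (\<lambda>a. snd (fst (fst (fst (fst a))))) l,
        map (\<lambda>a. snd (fst (fst (fst a)))) l, map (\<lambda>a. snd (fst (fst a))) l, map (\<lambda>a. snd (fst a)) l, map snd l)}"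
    by (subst bind_replicate_list_kernel) (simp add: q4_def comp_def)
  also have "\<dots> = map_pmf unzip6 (replicate_pmf n (map_pmf (\<lambda>(((((x, y), t), u), v), w). (x, y, t, u, v, w)) q4))"
    unfolding replicate_map_pmf map_pmf_comp by (simp add: unzip6_def comp_def split_def map_pmf_def)
  also have "map_pmf (\<lambda>(((((x, y), t), u), v), w). (x, y, t, u, v, w)) q4 = joint"
    by (simp add: q4_def q3_def q2_def q1_def joint_def map_bind_pmf bind_assoc_pmf bind_return_pmf split_def)
  finally show ?thesis .
qed

definition lists_of :: "nat \<Rightarrow> 'a set \<Rightarrow> 'a list set" where
  "lists_of n S = {l. set l \<subseteq> S \<and> length l = n}"

lemma finite_lists_of: "finite S \<Longrightarrow> finite (lists_of n S)"
  unfolding lists_of_def by (rule finite_lists_length_eq)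

lemma set_list_kernel_subset:
  assumes "length as = n" "\<And>a. a \<in> set as \<Longrightarrow> set_pmf (K a) \<subseteq> S"
  shows "set_pmf (list_kernel K as) \<subseteq> lists_of n S"
  using assms by (fastforce simp: set_list_kernel lists_of_def list_all2_conv_all_nth in_set_conv_nth)

lemma set_zip_kernel_subset:
  assumes "as \<in> lists_of n A" "bs \<in> lists_of n B" "\<And>a b. a \<in> A \<Longrightarrow> b \<in> B \<Longrightarrow> set_pmf (K (a, b)) \<subseteq> S"
  shows "set_pmf (zip_kernel K (as, bs)) \<subseteq> lists_of n S"
  unfolding zip_kernel_def prod.case
proof (rule set_list_kernel_subset)
  show "length (zip as bs) = n" using assms by (simp add: lists_of_def)
  fix a assume a: "a \<in> set (zip as bs)"
  obtain x y where xy: "a = (x, y)" by (cases a)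
  have "x \<in> A" "y \<in> B"
    using assms(1,2) set_zip_leftD[of x y as bs] set_zip_rightD[of x y as bs] a xy by (auto simp: lists_of_def)
  then show "set_pmf (K a) \<subseteq> S" unfolding xy by (rule assms(3))
qed

context coding_scheme
begin

lemma finite_joint: "finite (set_pmf joint)"
proof -
  have "set_pmf joint \<subseteq> SX \<times> SY \<times> ST \<times> SU \<times> SV \<times> SW"
    using p KT KU KV KW by (fastforce simp: joint_def)
  then show ?thesis by (rule finite_subset) (use fin in auto)
qed

text \<open>The n-fold power of \<open>RT\<close> is written as a kernel on a list of units, so that
  the T-message to the decoder falls under the same vanishing-mismatch estimate as the other
  messages.\<close>

lemma block_scheme:
  "coding_scheme (block_source n p) (list_kernel KT) (zip_kernel KU) (zip_kernel KV) (zip_kernel KW)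
     (list_kernel RTY) (list_kernel (\<lambda>_. RT) (replicate n ())) (zip_kernel RU) (zip_kernel RV) (zip_kernel RW)
     (map cV) (map cW) (lists_of n SX) (lists_of n SY) (lists_of n ST) (lists_of n SU) (lists_of n SV) (lists_of n SW)"
proof
  show "set_pmf (block_source n p) \<subseteq> lists_of n SX \<times> lists_of n SY"
    using p by (fastforce simp: block_source_def set_replicate_pmf lists_of_def lists_eq_set)
  show "set_pmf (list_kernel KT x) \<subseteq> lists_of n ST" if "x \<in> lists_of n SX" for x
    using that KT by (intro set_list_kernel_subset) (auto simp: lists_of_def)
  show "set_pmf (list_kernel RTY x) \<subseteq> lists_of n ST" if "x \<in> lists_of n SY" for x
    using that RTY by (intro set_list_kernel_subset) (auto simp: lists_of_def)
  show "set_pmf (list_kernel (\<lambda>_. RT) (replicate n ())) \<subseteq> lists_of n ST"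
    using RT by (intro set_list_kernel_subset) auto
  show "map cV w \<in> lists_of n SW" if "w \<in> lists_of n SW" for w
    using that cV by (auto simp: lists_of_def)
  show "map cW w \<in> lists_of n SV" if "w \<in> lists_of n SV" for w
    using that cW by (auto simp: lists_of_def)
qed ((rule finite_lists_of, rule fin) | (rule set_zip_kernel_subset, assumption, assumption,
       (erule (1) KU | erule (1) KV | erule (1) KW | erule (1) RU | erule (1) RV | erule (1) RW)))+

text \<open>Each of the five rates exceeds the mean log-likelihood ratio of its race, so every term
  of \<open>failure_bound\<close> tends to 0 in mean; \<open>pos\<close> keeps the ratios finite on
  the support. The sets \<open>B n\<close> are left open for the excess-distortion events.\<close>

lemma block_code_exists:
  assumes pos: "\<And>x y t u v w. (x, y, t, u, v, w) \<in> set_pmf joint \<Longrightarrow>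
      pmf (RTY y) t > 0 \<and> pmf RT t > 0 \<and> pmf (RU (y, t)) u > 0 \<and> pmf (RV (t, cV w)) v > 0 \<and> pmf (RW (t, cW v)) w > 0"
    and r0a: "\<rho>0a > measure_pmf.expectation joint (\<lambda>s. log 2 (pmf (KT (oX s)) (oT s) / pmf (RTY (oY s)) (oT s)))"
    and rT: "\<rho>T > measure_pmf.expectation joint (\<lambda>s. log 2 (pmf (KT (oX s)) (oT s) / pmf RT (oT s)))"
    and r0b: "\<rho>0b > measure_pmf.expectation joint (\<lambda>s. log 2 (pmf (KU (oX s, oT s)) (oU s) / pmf (RU (oY s, oT s)) (oU s)))"
    and rV: "\<rho>V > measure_pmf.expectation joint (\<lambda>s. log 2 (pmf (KV (oX s, oT s)) (oV s) / pmf (RV (oT s, cV (oW s))) (oV s)))"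
    and rW: "\<rho>W > measure_pmf.expectation joint (\<lambda>s. log 2 (pmf (KW (oU s, oY s)) (oW s) / pmf (RW (oT s, cW (oV s))) (oW s)))"
    and nonneg: "\<rho>0a \<ge> 0" "\<rho>T \<ge> 0" "\<rho>0b \<ge> 0" "\<rho>V \<ge> 0" "\<rho>W \<ge> 0"
    and bad: "(\<lambda>n. measure (replicate_pmf n joint) {l. unzip6 l \<in> B n}) \<longlonglongrightarrow> 0" and \<delta>: "\<delta> > 0"
  shows "\<exists>N. \<forall>n\<ge>N. \<exists>eT dTY dT eU dU eV dV eW dW.
     (\<forall>x\<in>lists_of n SX. fst (eT x) \<in> lists_of n ST \<and> snd (eT x) \<in> {..<msgs n \<rho>0a} \<times> {..<msgs n \<rho>T}) \<and>
     (\<forall>x\<in>lists_of n SX. \<forall>t\<in>lists_of n ST. fst (eU (x, t)) \<in> lists_of n SU \<and> snd (eU (x, t)) < msgs n \<rho>0b) \<and>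
     (\<forall>x\<in>lists_of n SX. \<forall>t\<in>lists_of n ST. fst (eV (x, t)) \<in> lists_of n SV \<and> snd (eV (x, t)) < msgs n \<rho>V) \<and>
     (\<forall>u\<in>lists_of n SU. \<forall>y\<in>lists_of n SY. fst (eW (u, y)) \<in> lists_of n SW \<and> snd (eW (u, y)) < msgs n \<rho>W) \<and>
     emeasure (block_source n p) {(x, y). let t = fst (eT x); u = fst (eU (x, t)); v = fst (eV (x, t)); w = fst (eW (u, y)) in
        (x, y, t, u, v, w) \<in> B n \<or> dTY y (fst (snd (eT x))) \<noteq> eT x \<or> dT (snd (snd (eT x))) \<noteq> eT x \<or>
        dU (y, t) (snd (eU (x, t))) \<noteq> u \<or> dV (t, map cV w) (snd (eV (x, t))) \<noteq> v \<or>
        dW (t, map cW v) (snd (eW (u, y))) \<noteq> w} \<le> ennreal \<delta>"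
proof -
  define m1 where "m1 n l = mismatch (msgs n \<rho>0a) (list_kernel KT (map oX l)) (list_kernel RTY (map oY l)) (map oT l)"
    for n and l :: "('x \<times> 'y \<times> 't \<times> 'u \<times> 'v \<times> 'w) list"
  define m2 where "m2 n l = mismatch (msgs n \<rho>T) (list_kernel KT (map oX l)) (list_kernel (\<lambda>_. RT) (map (\<lambda>_. ()) l)) (map oT l)"
    for n and l :: "('x \<times> 'y \<times> 't \<times> 'u \<times> 'v \<times> 'w) list"
  define m3 where "m3 n l = mismatch (msgs n \<rho>0b) (list_kernel KU (map (\<lambda>s. (oX s, oT s)) l))
      (list_kernel RU (map (\<lambda>s. (oY s, oT s)) l)) (map oU l)"
    for n and l :: "('x \<times> 'y \<times> 't \<times> 'u \<times> 'v \<times> 'w) list"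
  define m4 where "m4 n l = mismatch (msgs n \<rho>V) (list_kernel KV (map (\<lambda>s. (oX s, oT s)) l))
      (list_kernel RV (map (\<lambda>s. (oT s, cV (oW s))) l)) (map oV l)"
    for n and l :: "('x \<times> 'y \<times> 't \<times> 'u \<times> 'v \<times> 'w) list"
  define m5 where "m5 n l = mismatch (msgs n \<rho>W) (list_kernel KW (map (\<lambda>s. (oU s, oY s)) l))
      (list_kernel RW (map (\<lambda>s. (oT s, cW (oV s))) l)) (map oW l)"
    for n and l :: "('x \<times> 'y \<times> 't \<times> 'u \<times> 'v \<times> 'w) list"
  have Kpos: "pmf (KT (oX s)) (oT s) > 0" "pmf (KU (oX s, oT s)) (oU s) > 0" "pmf (KV (oX s, oT s)) (oV s) > 0"
    "pmf (KW (oU s, oY s)) (oW s) > 0" if "s \<in> set_pmf joint" for s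
    using that by (auto simp: joint_def pmf_positive_iff)
  have Rpos: "pmf (RTY (oY s)) (oT s) > 0" "pmf RT (oT s) > 0" "pmf (RU (oY s, oT s)) (oU s) > 0"
    "pmf (RV (oT s, cV (oW s))) (oV s) > 0" "pmf (RW (oT s, cW (oV s))) (oW s) > 0" if "s \<in> set_pmf joint" for s
    using that pos[of "oX s" "oY s" "oT s" "oU s" "oV s" "oW s"] by (auto simp: split_def)
  have 1: "(\<lambda>n. measure_pmf.expectation (replicate_pmf n joint) (m1 n)) \<longlonglongrightarrow> 0"
    unfolding m1_def by (rule mismatch_block_tendsto) (use finite_joint Kpos Rpos r0a nonneg in auto)
  have 2: "(\<lambda>n. measure_pmf.expectation (replicate_pmf n joint) (m2 n)) \<longlonglongrightarrow> 0"
    unfolding m2_def by (rule mismatch_block_tendsto) (use finite_joint Kpos Rpos rT nonneg in auto)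
  have 3: "(\<lambda>n. measure_pmf.expectation (replicate_pmf n joint) (m3 n)) \<longlonglongrightarrow> 0"
    unfolding m3_def by (rule mismatch_block_tendsto) (use finite_joint Kpos Rpos r0b nonneg in auto)
  have 4: "(\<lambda>n. measure_pmf.expectation (replicate_pmf n joint) (m4 n)) \<longlonglongrightarrow> 0"
    unfolding m4_def by (rule mismatch_block_tendsto) (use finite_joint Kpos Rpos rV nonneg in auto)
  have 5: "(\<lambda>n. measure_pmf.expectation (replicate_pmf n joint) (m5 n)) \<longlonglongrightarrow> 0"
    unfolding m5_def by (rule mismatch_block_tendsto) (use finite_joint Kpos Rpos rW nonneg in auto)
  define tot where "tot n l = m1 n l + m2 n l + m3 n l + m4 n l + m5 n l" for n l
  have int: "integrable (measure_pmf (replicate_pmf n joint)) h" for n and h :: "_ \<Rightarrow> real"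
    using finite_joint by (intro integrable_measure_pmf_finite finite_set_replicate_pmf)
  have tot0: "tot n l \<ge> 0" for n l
    by (simp add: tot_def m1_def m2_def m3_def m4_def m5_def mismatch_nonneg)
  have "measure_pmf.expectation (replicate_pmf n joint) (tot n) = measure_pmf.expectation (replicate_pmf n joint) (m1 n)
     + measure_pmf.expectation (replicate_pmf n joint) (m2 n) + measure_pmf.expectation (replicate_pmf n joint) (m3 n)
     + measure_pmf.expectation (replicate_pmf n joint) (m4 n) + measure_pmf.expectation (replicate_pmf n joint) (m5 n)" for n
    by (simp add: tot_def[abs_def] int)
  with tendsto_add[OF bad tendsto_add[OF tendsto_add[OF tendsto_add[OF tendsto_add[OF 1 2] 3] 4] 5]]
  have "(\<lambda>n. measure (replicate_pmf n joint) {l. unzip6 l \<in> B n} + measure_pmf.expectation (replicate_pmf n joint) (tot n)) \<longlonglongrightarrow> 0"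
    by simp
  from order_tendstoD(2)[OF this \<delta>] obtain N where N: "\<And>n. n \<ge> N \<Longrightarrow>
     measure (replicate_pmf n joint) {l. unzip6 l \<in> B n} + measure_pmf.expectation (replicate_pmf n joint) (tot n) < \<delta>"
    by (auto simp: eventually_sequentially)
  show ?thesis
  proof (rule exI[of _ N], intro allI impI)
    fix n assume n: "n \<ge> N"
    interpret B: coding_scheme "block_source n p" "list_kernel KT" "zip_kernel KU" "zip_kernel KV" "zip_kernel KW"
     "list_kernel RTY" "list_kernel (\<lambda>_. RT) (replicate n ())" "zip_kernel RU" "zip_kernel RV" "zip_kernel RW"
     "map cV" "map cW" "lists_of n SX" "lists_of n SY" "lists_of n ST" "lists_of n SU" "lists_of n SV" "lists_of n SW"
      by (rule block_scheme)
    have fb: "B.failure_bound (msgs n \<rho>0a) (msgs n \<rho>0b) (msgs n \<rho>T) (msgs n \<rho>V) (msgs n \<rho>W) (unzip6 l) = tot n l"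
      if "l \<in> set_pmf (replicate_pmf n joint)" for l
    proof -
      have "map (\<lambda>_. ()) l = replicate n ()" using that by (auto simp: set_replicate_pmf map_replicate_const)
      then show ?thesis
        by (simp add: B.failure_bound_def unzip6_def tot_def m1_def m2_def m3_def m4_def m5_def zip_kernel_map map_map[unfolded comp_def]
            comp_def del: map_map)
    qed
    have "emeasure B.joint (B n) = ennreal (measure (replicate_pmf n joint) {l. unzip6 l \<in> B n})"
      by (simp add: block_joint vimage_def measure_pmf.emeasure_eq_measure)
    moreover have "(\<integral>\<^sup>+s. ennreal (B.failure_bound (msgs n \<rho>0a) (msgs n \<rho>0b) (msgs n \<rho>T) (msgs n \<rho>V) (msgs n \<rho>W) s) \<partial>B.joint)
       = ennreal (measure_pmf.expectation (replicate_pmf n joint) (tot n))"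
    proof -
      have "(\<integral>\<^sup>+s. ennreal (B.failure_bound (msgs n \<rho>0a) (msgs n \<rho>0b) (msgs n \<rho>T) (msgs n \<rho>V) (msgs n \<rho>W) s) \<partial>B.joint)
        = (\<integral>\<^sup>+l. ennreal (tot n l) \<partial>replicate_pmf n joint)"
        unfolding block_joint nn_integral_map_pmf by (intro nn_integral_cong_pmf arg_cong[where f = ennreal] fb)
      also have "\<dots> = ennreal (measure_pmf.expectation (replicate_pmf n joint) (tot n))"
        by (rule nn_integral_eq_integral) (use int tot0 in auto)
      finally show ?thesis .
    qed
    ultimately have small: "emeasure B.joint (B n) + (\<integral>\<^sup>+s. ennreal (B.failure_bound (msgs n \<rho>0a) (msgs n \<rho>0b) (msgs n \<rho>T) (msgs n \<rho>V) (msgs n \<rho>W) s) \<partial>B.joint) < ennreal \<delta>"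
      using N[OF n] \<delta> tot0 by (subst ennreal_plus[symmetric] | simp add: ennreal_plus[symmetric] ennreal_lessI del: ennreal_plus)+
    show "\<exists>eT dTY dT eU dU eV dV eW dW.
     (\<forall>x\<in>lists_of n SX. fst (eT x) \<in> lists_of n ST \<and> snd (eT x) \<in> {..<msgs n \<rho>0a} \<times> {..<msgs n \<rho>T}) \<and>
     (\<forall>x\<in>lists_of n SX. \<forall>t\<in>lists_of n ST. fst (eU (x, t)) \<in> lists_of n SU \<and> snd (eU (x, t)) < msgs n \<rho>0b) \<and>
     (\<forall>x\<in>lists_of n SX. \<forall>t\<in>lists_of n ST. fst (eV (x, t)) \<in> lists_of n SV \<and> snd (eV (x, t)) < msgs n \<rho>V) \<and>
     (\<forall>u\<in>lists_of n SU. \<forall>y\<in>lists_of n SY. fst (eW (u, y)) \<in> lists_of n SW \<and> snd (eW (u, y)) < msgs n \<rho>W) \<and>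
     emeasure (block_source n p) {(x, y). let t = fst (eT x); u = fst (eU (x, t)); v = fst (eV (x, t)); w = fst (eW (u, y)) in
        (x, y, t, u, v, w) \<in> B n \<or> dTY y (fst (snd (eT x))) \<noteq> eT x \<or> dT (snd (snd (eT x))) \<noteq> eT x \<or>
        dU (y, t) (snd (eU (x, t))) \<noteq> u \<or> dV (t, map cV w) (snd (eV (x, t))) \<noteq> v \<or>
        dW (t, map cW v) (snd (eW (u, y))) \<noteq> w} \<le> ennreal \<delta>"
      by (rule B.one_shot[OF _ _ _ _ _ small]) (use msgs_ge nonneg in auto)
  qed
qed

end

section \<open>Achievability of the corner points\<close>

lemma avg_dist_le:
  fixes p :: "('x::finite \<times> 'y::finite) pmf"
  assumes n: "n > 0"
    and le: "\<And>xs ys. length xs = n \<Longrightarrow> length ys = n \<Longrightarrow>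
       (\<Sum>j<n. d (f (xs ! j) (ys ! j)) (\<psi> (\<phi>X xs) (\<phi>Y ys (\<phi>0 xs)) ! j)) \<le> real n * (D + C * indicator F (xs, ys))"
  shows "avg_dist n p f d \<phi>0 \<phi>X \<phi>Y \<psi> \<le> D + C * measure (block_source n p) F"
proof -
  let ?P = "replicate_pmf n p"
  let ?g = "\<lambda>xys j. d (f (map fst xys ! j) (map snd xys ! j)) (\<psi> (\<phi>X (map fst xys)) (\<phi>Y (map snd xys) (\<phi>0 (map fst xys))) ! j)"
  have int: "integrable (measure_pmf ?P) h" for h :: "_ \<Rightarrow> real"
    by (intro integrable_measure_pmf_finite finite_set_replicate_pmf) simp
  have "avg_dist n p f d \<phi>0 \<phi>X \<phi>Y \<psi> = 1 / real n * measure_pmf.expectation ?P (\<lambda>xys. \<Sum>j<n. ?g xys j)"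
    unfolding avg_dist_def Let_def by (subst Bochner_Integration.integral_sum) (auto simp: int)
  also have "\<dots> \<le> 1 / real n * measure_pmf.expectation ?P (\<lambda>xys. real n * (D + C * indicator F (map fst xys, map snd xys)))"
  proof (rule mult_left_mono)
    show "measure_pmf.expectation ?P (\<lambda>xys. \<Sum>j<n. ?g xys j) \<le>
       measure_pmf.expectation ?P (\<lambda>xys. real n * (D + C * indicator F (map fst xys, map snd xys)))"
    proof (rule integral_mono_AE[OF int int], rule AE_pmfI)
      fix xys assume "xys \<in> set_pmf ?P"
      then show "(\<Sum>j<n. ?g xys j) \<le> real n * (D + C * indicator F (map fst xys, map snd xys))"
        using le[of "map fst xys" "map snd xys"] by (simp add: set_replicate_pmf)
    qed
  qed simp
  also have "\<dots> = D + C * measure_pmf.expectation ?P (\<lambda>xys. indicator F (map fst xys, map snd xys))"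
    using n by (simp add: int)
  also have "measure_pmf.expectation ?P (\<lambda>xys. indicator F (map fst xys, map snd xys)) = measure (block_source n p) F"
  proof -
    have "measure (block_source n p) F = measure_pmf.expectation (block_source n p) (indicator F)" by simp
    also have "\<dots> = measure_pmf.expectation ?P (\<lambda>xys. indicator F (map fst xys, map snd xys))"
      unfolding block_source_def integral_map_pmf ..
    finally show ?thesis by simp
  qed
  finally show ?thesis .
qed

lemma msgs_mono: "r \<le> s \<Longrightarrow> msgs n r \<le> msgs n s"
  by (simp add: msgs_def nat_mono floor_mono mult_left_mono)

text \<open>Two digits in base \<open>b\<close>, shifted by one because message sets start at
  1.\<close>

definition pack :: "nat \<Rightarrow> nat \<Rightarrow> nat \<Rightarrow> nat" where "pack b i j = 1 + i * b + j"

lemma pack_le: "i < a \<Longrightarrow> j < b \<Longrightarrow> a * b \<le> k \<Longrightarrow> pack b i j \<in> {1..k}"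
proof -
  assume *: "i < a" "j < b" "a * b \<le> k"
  have "1 + i * b + j \<le> (i + 1) * b" using * by (simp add: algebra_simps)
  also have "\<dots> \<le> a * b" using * by (intro mult_right_mono) auto
  finally show ?thesis using * by (simp add: pack_def)
qed

lemma unpack: "j < b \<Longrightarrow> (pack b i j - 1) div b = i" "j < b \<Longrightarrow> (pack b i j - 1) mod b = j"
  by (simp_all add: pack_def)

text \<open>\<open>is_code\<close> restricts the encoder of transmitter Y on every received message,
  also where recovering T or U has gone wrong and the resulting indices are arbitrary. Off the
  failure event \<open>clip\<close> acts as the identity.\<close>

definition clip :: "nat \<Rightarrow> nat \<Rightarrow> nat" where "clip k m = (if m \<in> {1..k} then m else 1)"

lemma clip_range: "k \<ge> 1 \<Longrightarrow> clip k m \<in> {1..k}" and clip_id: "m \<in> {1..k} \<Longrightarrow> clip k m = m"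
  by (auto simp: clip_def)

lemma block_distortion_tendsto:
  fixes Q :: "('x \<times> 'y \<times> 't \<times> 'u \<times> 'v \<times> 'w) pmf" and d :: "'f \<Rightarrow> 'f \<Rightarrow> real"
  assumes fin: "finite (set_pmf Q)" and \<epsilon>: "\<epsilon> > 0"
    and D: "measure_pmf.expectation Q (\<lambda>s. d (f (oX s) (oY s)) (g (oV s) (oT s) (oW s))) \<le> D"
  shows "(\<lambda>n. measure (replicate_pmf n Q) {l. unzip6 l \<in> {(xs, ys, ts, us, vs, ws).
     (\<Sum>j<n. d (f (xs ! j) (ys ! j)) (g (vs ! j) (ts ! j) (ws ! j))) \<ge> real n * (D + \<epsilon>)}}) \<longlonglongrightarrow> 0"
proof -
  define h where "h = (\<lambda>s :: 'x \<times> 'y \<times> 't \<times> 'u \<times> 'v \<times> 'w. d (f (oX s) (oY s)) (g (oV s) (oT s) (oW s)))"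
  have lim: "(\<lambda>n. measure (replicate_pmf n Q) {l. sum_list (map h l) \<ge> real n * (measure_pmf.expectation Q h + \<epsilon>)}) \<longlonglongrightarrow> 0"
    by (rule weak_law_replicate[OF fin \<epsilon>])
  show ?thesis
  proof (rule tendsto_sandwich[OF _ _ tendsto_const lim])
    show "\<forall>\<^sub>F n in sequentially. measure (replicate_pmf n Q) {l. unzip6 l \<in> {(xs, ys, ts, us, vs, ws).
        (\<Sum>j<n. d (f (xs ! j) (ys ! j)) (g (vs ! j) (ts ! j) (ws ! j))) \<ge> real n * (D + \<epsilon>)}}
      \<le> measure (replicate_pmf n Q) {l. sum_list (map h l) \<ge> real n * (measure_pmf.expectation Q h + \<epsilon>)}"
    proof (rule always_eventually, rule allI, rule measure_pmf.finite_measure_mono_AE, rule AE_pmfI, rule impI)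
      fix n l assume l: "l \<in> set_pmf (replicate_pmf n Q)" and "l \<in> {l. unzip6 l \<in> {(xs, ys, ts, us, vs, ws).
        (\<Sum>j<n. d (f (xs ! j) (ys ! j)) (g (vs ! j) (ts ! j) (ws ! j))) \<ge> real n * (D + \<epsilon>)}}"
      then have ge: "real n * (D + \<epsilon>) \<le> (\<Sum>j<n. d (f (map oX l ! j) (map oY l ! j)) (g (map oV l ! j) (map oT l ! j) (map oW l ! j)))"
        by (simp add: unzip6_def)
      have len: "length l = n" using l by (simp add: set_replicate_pmf)
      have "(\<Sum>j<n. d (f (map oX l ! j) (map oY l ! j)) (g (map oV l ! j) (map oT l ! j) (map oW l ! j))) = sum_list (map h l)"
        by (simp add: sum_list_sum_nth len atLeast0LessThan h_def)
      moreover have "real n * (measure_pmf.expectation Q h + \<epsilon>) \<le> real n * (D + \<epsilon>)"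
        using D by (intro mult_left_mono) (auto simp: h_def)
      ultimately show "l \<in> {l. sum_list (map h l) \<ge> real n * (measure_pmf.expectation Q h + \<epsilon>)}" using ge by simp
    qed simp
  qed simp
qed

text \<open>\<open>seq\<close> says that one of V and W is decoded without help from the other, and
  \<open>RXY\<close> that the T-message fits next to W on the link of transmitter Y or next to V on
  that of transmitter X. Excess distortion is added to the failure events, so off them both
  reconstructions are good.\<close>

lemma corner_achievable:
  fixes p :: "('x::finite \<times> 'y::finite) pmf"
    and f1 :: "'x \<Rightarrow> 'y \<Rightarrow> 'f1::finite" and f2 :: "'x \<Rightarrow> 'y \<Rightarrow> 'f2::finite"
    and d1 :: "'f1 \<Rightarrow> 'f1 \<Rightarrow> real" and d2 :: "'f2 \<Rightarrow> 'f2 \<Rightarrow> real"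
    and KT :: "'x \<Rightarrow> 't pmf" and KU :: "'x \<times> 't \<Rightarrow> 'u pmf" and KV :: "'x \<times> 't \<Rightarrow> 'v pmf" and KW :: "'u \<times> 'y \<Rightarrow> 'w pmf"
  assumes scheme: "coding_scheme p KT KU KV KW RTY RT RU RV RW cV cW UNIV UNIV ST SU SV SW"
    and J: "J = coding_kernels.joint p KT KU KV KW"
    and seq: "(\<forall>v v'. cW v = cW v') \<or> (\<forall>w w'. cV w = cV w')"
    and pos: "\<And>x y t u v w. (x, y, t, u, v, w) \<in> set_pmf J \<Longrightarrow>
      pmf (RTY y) t > 0 \<and> pmf RT t > 0 \<and> pmf (RU (y, t)) u > 0 \<and> pmf (RV (t, cV w)) v > 0 \<and> pmf (RW (t, cW v)) w > 0"
    and r0a: "\<rho>0a > measure_pmf.expectation J (\<lambda>s. log 2 (pmf (KT (oX s)) (oT s) / pmf (RTY (oY s)) (oT s)))"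
    and rT: "\<rho>T > measure_pmf.expectation J (\<lambda>s. log 2 (pmf (KT (oX s)) (oT s) / pmf RT (oT s)))"
    and r0b: "\<rho>0b > measure_pmf.expectation J (\<lambda>s. log 2 (pmf (KU (oX s, oT s)) (oU s) / pmf (RU (oY s, oT s)) (oU s)))"
    and rV: "\<rho>V > measure_pmf.expectation J (\<lambda>s. log 2 (pmf (KV (oX s, oT s)) (oV s) / pmf (RV (oT s, cV (oW s))) (oV s)))"
    and rW: "\<rho>W > measure_pmf.expectation J (\<lambda>s. log 2 (pmf (KW (oU s, oY s)) (oW s) / pmf (RW (oT s, cW (oV s))) (oW s)))"
    and nonneg: "\<rho>0a \<ge> 0" "\<rho>T \<ge> 0" "\<rho>0b \<ge> 0" "\<rho>V \<ge> 0" "\<rho>W \<ge> 0"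
    and R0: "\<rho>0a + \<rho>0b \<le> R0" and RXY: "(\<rho>V \<le> RX \<and> \<rho>T + \<rho>W \<le> RY) \<or> (\<rho>T + \<rho>V \<le> RX \<and> \<rho>W \<le> RY)"
    and D1: "measure_pmf.expectation J (\<lambda>s. d1 (f1 (oX s) (oY s)) (g1 (oV s) (oT s) (oW s))) \<le> D1"
    and D2: "measure_pmf.expectation J (\<lambda>s. d2 (f2 (oX s) (oY s)) (g2 (oV s) (oT s) (oW s))) \<le> D2"
    and D0: "D1 \<ge> 0" "D2 \<ge> 0"
  shows "achievable p f1 f2 d1 d2 D1 D2 R0 RX RY"
  unfolding achievable_def
proof (intro allI impI)
  fix \<epsilon> :: real assume \<epsilon>: "\<epsilon> > 0"
  interpret coding_scheme p KT KU KV KW RTY RT RU RV RW cV cW UNIV UNIV ST SU SV SW by (rule scheme)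
  obtain C where C: "C \<ge> 1" "\<And>a b. d1 a b \<le> C" "\<And>a b. d2 a b \<le> C"
  proof
    let ?S = "range (case_prod d1) \<union> range (case_prod d2) \<union> {1}"
    show "1 \<le> Max ?S" by (rule Max_ge) auto
    show "d1 a b \<le> Max ?S" "d2 a' b' \<le> Max ?S" for a b a' b' by (rule Max_ge; force)+
  qed
  \<comment> \<open>Half of \<open>\<epsilon>\<close> is spent on the excess distortion off the
    failure event, the other half on the failure event itself, where each letter costs at most
    C.\<close>
  define \<delta> where "\<delta> = \<epsilon> / (2 * C)"
  have \<delta>: "\<delta> > 0" using \<epsilon> C by (simp add: \<delta>_def)
  define B1 where "B1 n = {(xs, ys, ts, us :: 'u list, vs, ws).
      (\<Sum>j<n. d1 (f1 (xs ! j) (ys ! j)) (g1 (vs ! j) (ts ! j) (ws ! j))) \<ge> real n * (D1 + \<epsilon> / 2)}" for n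
  define B2 where "B2 n = {(xs, ys, ts, us :: 'u list, vs, ws).
      (\<Sum>j<n. d2 (f2 (xs ! j) (ys ! j)) (g2 (vs ! j) (ts ! j) (ws ! j))) \<ge> real n * (D2 + \<epsilon> / 2)}" for n
  have lim: "(\<lambda>n. measure (replicate_pmf n J) {l. unzip6 l \<in> B1 n} + measure (replicate_pmf n J) {l. unzip6 l \<in> B2 n}) \<longlonglongrightarrow> 0 + 0"
    unfolding B1_def B2_def using \<epsilon> D1 D2 finite_joint J
    by (intro tendsto_add block_distortion_tendsto) auto
  have bad: "(\<lambda>n. measure (replicate_pmf n joint) {l. unzip6 l \<in> B1 n \<union> B2 n}) \<longlonglongrightarrow> 0"
  proof (rule tendsto_sandwich[OF _ _ tendsto_const lim[unfolded add_0_right]])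
    show "\<forall>\<^sub>F n in sequentially. measure (replicate_pmf n joint) {l. unzip6 l \<in> B1 n \<union> B2 n}
      \<le> measure (replicate_pmf n J) {l. unzip6 l \<in> B1 n} + measure (replicate_pmf n J) {l. unzip6 l \<in> B2 n}"
    proof (intro always_eventually allI)
      fix n
      have "{l. unzip6 l \<in> B1 n \<union> B2 n} = {l. unzip6 l \<in> B1 n} \<union> {l. unzip6 l \<in> B2 n}" by auto
      then show "measure (replicate_pmf n joint) {l. unzip6 l \<in> B1 n \<union> B2 n}
      \<le> measure (replicate_pmf n J) {l. unzip6 l \<in> B1 n} + measure (replicate_pmf n J) {l. unzip6 l \<in> B2 n}"
        unfolding J by (simp only: measure_Un_le sets_measure_pmf UNIV_I)
    qed
  qed simp
  from block_code_exists[OF pos[unfolded J] r0a[unfolded J] rT[unfolded J] r0b[unfolded J] rV[unfolded J] rW[unfolded J] nonneg bad \<delta>]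
  obtain N where N: "\<forall>n\<ge>N. \<exists>eT dTY dT eU dU eV dV eW dW.
     (\<forall>x\<in>lists_of n UNIV. fst (eT x) \<in> lists_of n ST \<and> snd (eT x) \<in> {..<msgs n \<rho>0a} \<times> {..<msgs n \<rho>T}) \<and>
     (\<forall>x\<in>lists_of n UNIV. \<forall>t\<in>lists_of n ST. fst (eU (x, t)) \<in> lists_of n SU \<and> snd (eU (x, t)) < msgs n \<rho>0b) \<and>
     (\<forall>x\<in>lists_of n UNIV. \<forall>t\<in>lists_of n ST. fst (eV (x, t)) \<in> lists_of n SV \<and> snd (eV (x, t)) < msgs n \<rho>V) \<and>
     (\<forall>u\<in>lists_of n SU. \<forall>y\<in>lists_of n UNIV. fst (eW (u, y)) \<in> lists_of n SW \<and> snd (eW (u, y)) < msgs n \<rho>W) \<and>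
     emeasure (block_source n p) {(x, y). let t = fst (eT x); u = fst (eU (x, t)); v = fst (eV (x, t)); w = fst (eW (u, y)) in
        (x, y, t, u, v, w) \<in> B1 n \<union> B2 n \<or> dTY y (fst (snd (eT x))) \<noteq> eT x \<or> dT (snd (snd (eT x))) \<noteq> eT x \<or>
        dU (y, t) (snd (eU (x, t))) \<noteq> u \<or> dV (t, map cV w) (snd (eV (x, t))) \<noteq> v \<or>
        dW (t, map cW v) (snd (eW (u, y))) \<noteq> w} \<le> ennreal \<delta>" ..
  show "\<exists>N. \<forall>n\<ge>N. \<exists>\<phi>0 \<phi>X \<phi>Y \<psi>1 \<psi>2. is_code n R0 RX RY \<phi>0 \<phi>X \<phi>Y \<psi>1 \<psi>2 \<and>
        avg_dist n p f1 d1 \<phi>0 \<phi>X \<phi>Y \<psi>1 \<le> D1 + \<epsilon> \<and> avg_dist n p f2 d2 \<phi>0 \<phi>X \<phi>Y \<psi>2 \<le> D2 + \<epsilon>"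
  proof (rule exI[of _ "max N 1"], intro allI impI)
    fix n assume "max N 1 \<le> n"
    then have n: "n \<ge> N" "n > 0" by auto
    from N[rule_format, OF n(1)] obtain eT dTY dT eU dU eV dV eW dW where
       eT: "\<forall>x\<in>lists_of n UNIV. fst (eT x) \<in> lists_of n ST \<and> snd (eT x) \<in> {..<msgs n \<rho>0a} \<times> {..<msgs n \<rho>T}" and
       eU: "\<forall>x\<in>lists_of n UNIV. \<forall>t\<in>lists_of n ST. fst (eU (x, t)) \<in> lists_of n SU \<and> snd (eU (x, t)) < msgs n \<rho>0b" and
       eV: "\<forall>x\<in>lists_of n UNIV. \<forall>t\<in>lists_of n ST. fst (eV (x, t)) \<in> lists_of n SV \<and> snd (eV (x, t)) < msgs n \<rho>V" and
       eW: "\<forall>u\<in>lists_of n SU. \<forall>y\<in>lists_of n UNIV. fst (eW (u, y)) \<in> lists_of n SW \<and> snd (eW (u, y)) < msgs n \<rho>W" and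
       fail: "emeasure (block_source n p) {(x, y). let t = fst (eT x); u = fst (eU (x, t)); v = fst (eV (x, t)); w = fst (eW (u, y)) in
        (x, y, t, u, v, w) \<in> B1 n \<union> B2 n \<or> dTY y (fst (snd (eT x))) \<noteq> eT x \<or> dT (snd (snd (eT x))) \<noteq> eT x \<or>
        dU (y, t) (snd (eU (x, t))) \<noteq> u \<or> dV (t, map cV w) (snd (eV (x, t))) \<noteq> v \<or>
        dW (t, map cW v) (snd (eW (u, y))) \<noteq> w} \<le> ennreal \<delta>"
      by (elim exE conjE) (rule that)
    define F where "F = {(x, y). let t = fst (eT x); u = fst (eU (x, t)); v = fst (eV (x, t)); w = fst (eW (u, y)) in
        (x, y, t, u, v, w) \<in> B1 n \<union> B2 n \<or> dTY y (fst (snd (eT x))) \<noteq> eT x \<or> dT (snd (snd (eT x))) \<noteq> eT x \<or>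
        dU (y, t) (snd (eU (x, t))) \<noteq> u \<or> dV (t, map cV w) (snd (eV (x, t))) \<noteq> v \<or>
        dW (t, map cW v) (snd (eW (u, y))) \<noteq> w}"
    have F: "measure (block_source n p) F \<le> \<delta>"
      using fail \<delta> unfolding F_def[symmetric] by (simp add: measure_pmf.emeasure_eq_measure)
    have m1: "msgs n \<rho>0a \<ge> 1" "msgs n \<rho>T \<ge> 1" "msgs n \<rho>0b \<ge> 1" "msgs n \<rho>V \<ge> 1" "msgs n \<rho>W \<ge> 1"
      using msgs_ge nonneg by auto
    \<comment> \<open>One of the factors is 1: the whole T-message travels with the transmitter
      whose rate has room for it. Quotient and remainder modulo \<open>MTy\<close> then cover both
      cases with the same encoders.\<close>
    obtain MTx MTy where MT: "MTx * MTy = msgs n \<rho>T" "MTx * msgs n \<rho>V \<le> msgs n RX" "MTy * msgs n \<rho>W \<le> msgs n RY"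
    proof (cases "\<rho>V \<le> RX \<and> \<rho>T + \<rho>W \<le> RY")
      case True
      then show ?thesis using msgs_mono[of \<rho>V RX n] msgs_mult_le[of n \<rho>T n \<rho>W n RY] that[of 1 "msgs n \<rho>T"]
        by (simp add: distrib_left[symmetric] mult_left_mono)
    next
      case False
      then have "\<rho>T + \<rho>V \<le> RX" "\<rho>W \<le> RY" using RXY by auto
      then show ?thesis using msgs_mono[of \<rho>W RY n] msgs_mult_le[of n \<rho>T n \<rho>V n RX] that[of "msgs n \<rho>T" 1]
        by (simp add: distrib_left[symmetric] mult_left_mono)
    qed
    have M0: "msgs n \<rho>0a * msgs n \<rho>0b \<le> msgs n R0"
      using R0 by (intro msgs_mult_le) (simp add: distrib_left[symmetric] mult_left_mono)
    have MTxy: "MTx \<ge> 1" "MTy \<ge> 1" using MT(1) m1(2) by (cases MTx; cases MTy; simp)+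
    have big: "msgs n R0 \<ge> 1" "msgs n RX \<ge> 1" "msgs n RY \<ge> 1"
      using M0 MT m1 MTxy by (metis One_nat_def Suc_le_eq le_trans nat_0_less_mult_iff)+
    \<comment> \<open>A constant \<open>cW\<close> turns the side information for W into a string
      known in advance, so W is decoded first and V after it; a constant \<open>cV\<close> gives the
      reverse order.\<close>
    have "\<exists>D. \<forall>t mV mW v w. length v = n \<and> length w = n \<and> dV (t, map cV w) mV = v \<and> dW (t, map cW v) mW = w \<longrightarrow> D t mV mW = (v, w)"
      using seq
    proof
      assume c: "\<forall>v v'. cW v = cW v'"
      have "map cW v = replicate n (cW undefined)" if "length v = n" for v
        using that c by (metis map_replicate_const map_cong)
      then show ?thesis
        by (intro exI[of _ "\<lambda>t mV mW. let w = dW (t, replicate n (cW undefined)) mW in (dV (t, map cV w) mV, w)"])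
          (auto simp: Let_def)
    next
      assume c: "\<forall>w w'. cV w = cV w'"
      have "map cV w = replicate n (cV undefined)" if "length w = n" for w
        using that c by (metis map_replicate_const map_cong)
      then show ?thesis
        by (intro exI[of _ "\<lambda>t mV mW. let v = dV (t, replicate n (cV undefined)) mV in (v, dW (t, map cW v) mW)"])
          (auto simp: Let_def)
    qed
    then obtain D where D: "\<And>t mV mW v w. length v = n \<Longrightarrow> length w = n \<Longrightarrow> dV (t, map cV w) mV = v \<Longrightarrow>
        dW (t, map cW v) mW = w \<Longrightarrow> D t mV mW = (v, w)" by blast
    define \<phi>0 where "\<phi>0 xs = clip (msgs n R0) (pack (msgs n \<rho>0b) (fst (snd (eT xs))) (snd (eU (xs, fst (eT xs)))))" for xs
    define \<phi>X where "\<phi>X xs = clip (msgs n RX) (pack (msgs n \<rho>V) (snd (snd (eT xs)) div MTy) (snd (eV (xs, fst (eT xs)))))" for xs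
    define \<phi>Y where "\<phi>Y ys m = (let e = dTY ys ((m - 1) div msgs n \<rho>0b); u = dU (ys, fst e) ((m - 1) mod msgs n \<rho>0b) in
        clip (msgs n RY) (pack (msgs n \<rho>W) (snd (snd e) mod MTy) (snd (eW (u, ys)))))" for ys m
    define dec where "dec mx my = (let t = fst (dT ((mx - 1) div msgs n \<rho>V * MTy + (my - 1) div msgs n \<rho>W)) in
        (t, D t ((mx - 1) mod msgs n \<rho>V) ((my - 1) mod msgs n \<rho>W)))" for mx my
    define \<psi>1 where "\<psi>1 mx my = (case dec mx my of (t, v, w) \<Rightarrow> map (\<lambda>j. g1 (v ! j) (t ! j) (w ! j)) [0..<n])" for mx my
    define \<psi>2 where "\<psi>2 mx my = (case dec mx my of (t, v, w) \<Rightarrow> map (\<lambda>j. g2 (v ! j) (t ! j) (w ! j)) [0..<n])" for mx my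
    have code: "is_code n R0 RX RY \<phi>0 \<phi>X \<phi>Y \<psi>1 \<psi>2"
      unfolding is_code_def using big clip_range
      by (auto simp: \<phi>0_def \<phi>X_def \<phi>Y_def \<psi>1_def \<psi>2_def Let_def split: prod.splits)
    \<comment> \<open>Off F all parties reproduce the same selections, so all digits are in range,
      \<open>clip\<close> drops out and unpacking returns the transmitted indices.\<close>
    have dec: "dec (\<phi>X xs) (\<phi>Y ys (\<phi>0 xs)) = (fst (eT xs), fst (eV (xs, fst (eT xs))), fst (eW (fst (eU (xs, fst (eT xs))), ys))) \<and>
        (xs, ys, fst (eT xs), fst (eU (xs, fst (eT xs))), fst (eV (xs, fst (eT xs))), fst (eW (fst (eU (xs, fst (eT xs))), ys))) \<notin> B1 n \<union> B2 n"
      if len: "length xs = n" "length ys = n" and nF: "(xs, ys) \<notin> F" for xs ys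
    proof -
      define t where "t = fst (eT xs)"
      define u where "u = fst (eU (xs, t))"
      define v where "v = fst (eV (xs, t))"
      define w where "w = fst (eW (u, ys))"
      have x: "xs \<in> lists_of n UNIV" and y: "ys \<in> lists_of n UNIV" using len by (auto simp: lists_of_def)
      have ok: "(xs, ys, t, u, v, w) \<notin> B1 n \<union> B2 n" "dTY ys (fst (snd (eT xs))) = eT xs" "dT (snd (snd (eT xs))) = eT xs"
        "dU (ys, t) (snd (eU (xs, t))) = u" "dV (t, map cV w) (snd (eV (xs, t))) = v" "dW (t, map cW v) (snd (eW (u, ys))) = w"
        using nF by (simp_all add: F_def Let_def t_def u_def v_def w_def)
      have t: "t \<in> lists_of n ST" and mt: "fst (snd (eT xs)) < msgs n \<rho>0a" "snd (snd (eT xs)) < MTx * MTy"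
        using eT[rule_format, OF x] by (auto simp: t_def MT(1) mem_Times_iff)
      have u: "u \<in> lists_of n SU" "snd (eU (xs, t)) < msgs n \<rho>0b" using eU[rule_format, OF x t] by (auto simp: u_def)
      have v: "v \<in> lists_of n SV" "snd (eV (xs, t)) < msgs n \<rho>V" using eV[rule_format, OF x t] by (auto simp: v_def)
      have w: "w \<in> lists_of n SW" "snd (eW (u, ys)) < msgs n \<rho>W" using eW[rule_format, OF u(1) y] by (auto simp: w_def)
      have tx: "snd (snd (eT xs)) div MTy < MTx" using mt(2) by (simp add: less_mult_imp_div_less)
      have ty: "snd (snd (eT xs)) mod MTy < MTy" using MTxy by simp
      have p0: "\<phi>0 xs = pack (msgs n \<rho>0b) (fst (snd (eT xs))) (snd (eU (xs, t)))"
        unfolding \<phi>0_def t_def[symmetric] by (intro clip_id pack_le[OF mt(1) u(2) M0])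
      have pX: "\<phi>X xs = pack (msgs n \<rho>V) (snd (snd (eT xs)) div MTy) (snd (eV (xs, t)))"
        unfolding \<phi>X_def t_def[symmetric] by (intro clip_id pack_le[OF tx v(2) MT(2)])
      have pY: "\<phi>Y ys (\<phi>0 xs) = pack (msgs n \<rho>W) (snd (snd (eT xs)) mod MTy) (snd (eW (u, ys)))"
        unfolding \<phi>Y_def p0 unpack[OF u(2)] ok(2) Let_def t_def[symmetric] ok(4)
        by (intro clip_id pack_le[OF ty w(2) MT(3)])
      have "dec (\<phi>X xs) (\<phi>Y ys (\<phi>0 xs)) = (t, D t (snd (eV (xs, t))) (snd (eW (u, ys))))"
        unfolding dec_def pX pY unpack[OF v(2)] unpack[OF w(2)] div_mult_mod_eq ok(3) Let_def t_def[symmetric] ..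
      also have "D t (snd (eV (xs, t))) (snd (eW (u, ys))) = (v, w)"
        using v w ok by (intro D) (auto simp: lists_of_def)
      finally show ?thesis using ok(1) by (simp add: t_def u_def v_def w_def)
    qed
    have avg_bound: "avg_dist n p f d \<phi>0 \<phi>X \<phi>Y \<psi> \<le> E + \<epsilon>"
      if \<psi>: "\<And>mx my. \<psi> mx my = (case dec mx my of (t, v, w) \<Rightarrow> map (\<lambda>j. h (v ! j) (t ! j) (w ! j)) [0..<n])"
        and dC: "\<And>a b. d a b \<le> C" and E: "E \<ge> 0"
        and B: "\<And>xs ys ts us vs ws. (xs, ys, ts, us, vs, ws) \<notin> B1 n \<union> B2 n \<Longrightarrow>
          (\<Sum>j<n. d (f (xs ! j) (ys ! j)) (h (vs ! j) (ts ! j) (ws ! j))) \<le> real n * (E + \<epsilon> / 2)"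
      for f :: "'x \<Rightarrow> 'y \<Rightarrow> 'f" and d :: "'f \<Rightarrow> 'f \<Rightarrow> real" and h \<psi> E
    proof -
      have "avg_dist n p f d \<phi>0 \<phi>X \<phi>Y \<psi> \<le> (E + \<epsilon> / 2) + C * measure (block_source n p) F"
      proof (rule avg_dist_le[OF n(2)])
        fix xs :: "'x list" and ys :: "'y list" assume len: "length xs = n" "length ys = n"
        show "(\<Sum>j<n. d (f (xs ! j) (ys ! j)) (\<psi> (\<phi>X xs) (\<phi>Y ys (\<phi>0 xs)) ! j)) \<le> real n * (E + \<epsilon> / 2 + C * indicator F (xs, ys))"
        proof (cases "(xs, ys) \<in> F")
          case True
          have "(\<Sum>j<n. d (f (xs ! j) (ys ! j)) (\<psi> (\<phi>X xs) (\<phi>Y ys (\<phi>0 xs)) ! j)) \<le> (\<Sum>j<n. C)" by (intro sum_mono dC)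
          also have "\<dots> \<le> real n * (E + \<epsilon> / 2 + C)" using E \<epsilon> by (simp add: mult_left_mono)
          finally show ?thesis using True by simp
        next
          case False
          with B[OF conjunct2[OF dec[OF len False]]] show ?thesis
            using conjunct1[OF dec[OF len False]] by (simp add: \<psi>)
        qed
      qed
      also have "\<dots> \<le> (E + \<epsilon> / 2) + C * \<delta>" using F C by simp
      also have "\<dots> = E + \<epsilon>" using C by (simp add: \<delta>_def)
      finally show ?thesis .
    qed
    have "avg_dist n p f1 d1 \<phi>0 \<phi>X \<phi>Y \<psi>1 \<le> D1 + \<epsilon>"
      by (rule avg_bound[of \<psi>1 g1]) (use C D0 in \<open>auto simp: \<psi>1_def B1_def\<close>)
    moreover have "avg_dist n p f2 d2 \<phi>0 \<phi>X \<phi>Y \<psi>2 \<le> D2 + \<epsilon>"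
      by (rule avg_bound[of \<psi>2 g2]) (use C D0 in \<open>auto simp: \<psi>2_def B2_def\<close>)
    ultimately show "\<exists>\<phi>0 \<phi>X \<phi>Y \<psi>1 \<psi>2. is_code n R0 RX RY \<phi>0 \<phi>X \<phi>Y \<psi>1 \<psi>2 \<and>
        avg_dist n p f1 d1 \<phi>0 \<phi>X \<phi>Y \<psi>1 \<le> D1 + \<epsilon> \<and> avg_dist n p f2 d2 \<phi>0 \<phi>X \<phi>Y \<psi>2 \<le> D2 + \<epsilon>"
      using code by blast
  qed
qed

section \<open>Time sharing\<close>

lemma sum_lessThan_add: "(\<Sum>j<m + k :: nat. h j) = (\<Sum>j<m. h j) + (\<Sum>j<k. h (m + j) :: real)"
  by (induction k) auto

text \<open>The two parts of an i.i.d. block are independent, and the distortion of a letter depends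
  on its own part only, so the other part integrates out.\<close>

lemma avg_dist_concat:
  fixes p :: "('x::finite \<times> 'y::finite) pmf" and f :: "'x \<Rightarrow> 'y \<Rightarrow> 'f" and d :: "'f \<Rightarrow> 'f \<Rightarrow> real"
  assumes n: "n1 > 0" "n2 > 0"
    and dec: "\<And>as bs cs ds. length as = n1 \<Longrightarrow> length bs = n1 \<Longrightarrow> length cs = n2 \<Longrightarrow> length ds = n2 \<Longrightarrow>
      \<psi> (\<phi>X (as @ cs)) (\<phi>Y (bs @ ds) (\<phi>0 (as @ cs))) = \<psi>1 (\<phi>X1 as) (\<phi>Y1 bs (\<phi>01 as)) @ \<psi>2 (\<phi>X2 cs) (\<phi>Y2 ds (\<phi>02 cs))"
    and len: "\<And>as bs. length as = n1 \<Longrightarrow> length bs = n1 \<Longrightarrow> length (\<psi>1 (\<phi>X1 as) (\<phi>Y1 bs (\<phi>01 as))) = n1"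
  shows "avg_dist (n1 + n2) p f d \<phi>0 \<phi>X \<phi>Y \<psi> =
    (real n1 * avg_dist n1 p f d \<phi>01 \<phi>X1 \<phi>Y1 \<psi>1 + real n2 * avg_dist n2 p f d \<phi>02 \<phi>X2 \<phi>Y2 \<psi>2) / real (n1 + n2)"
proof -
  define g where "g xys j = d (f (map fst xys ! j) (map snd xys ! j)) (\<psi> (\<phi>X (map fst xys)) (\<phi>Y (map snd xys) (\<phi>0 (map fst xys))) ! j)"
    for xys :: "('x \<times> 'y) list" and j
  define g1 where "g1 xys j = d (f (map fst xys ! j) (map snd xys ! j)) (\<psi>1 (\<phi>X1 (map fst xys)) (\<phi>Y1 (map snd xys) (\<phi>01 (map fst xys))) ! j)"
    for xys :: "('x \<times> 'y) list" and j
  define g2 where "g2 xys j = d (f (map fst xys ! j) (map snd xys ! j)) (\<psi>2 (\<phi>X2 (map fst xys)) (\<phi>Y2 (map snd xys) (\<phi>02 (map fst xys))) ! j)"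
    for xys :: "('x \<times> 'y) list" and j
  have fin: "finite (set_pmf (replicate_pmf m p))" for m by (rule finite_set_replicate_pmf) simp
  have E: "measure_pmf.expectation (replicate_pmf (n1 + n2) p) h =
      measure_pmf.expectation (replicate_pmf n1 p) (\<lambda>a. measure_pmf.expectation (replicate_pmf n2 p) (\<lambda>b. h (a @ b)))"
    for h :: "('x \<times> 'y) list \<Rightarrow> real"
    unfolding replicate_pmf_distrib by (simp add: expectation_bind_finite fin)
  have cong: "measure_pmf.expectation P h = measure_pmf.expectation P k" if "\<And>x. x \<in> set_pmf P \<Longrightarrow> h x = k x"
    for P :: "'b pmf" and h k :: "'b \<Rightarrow> real"
    by (rule integral_cong_AE) (use that in \<open>auto simp: AE_measure_pmf_iff\<close>)
  have 1: "g (a @ b) j = g1 a j" if "j < n1" "a \<in> set_pmf (replicate_pmf n1 p)" "b \<in> set_pmf (replicate_pmf n2 p)" for a b j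
    using that len[of "map fst a" "map snd a"] by (simp add: g_def g1_def dec nth_append set_replicate_pmf)
  have 2: "g (a @ b) (n1 + j) = g2 b j" if "j < n2" "a \<in> set_pmf (replicate_pmf n1 p)" "b \<in> set_pmf (replicate_pmf n2 p)" for a b j
    using that len[of "map fst a" "map snd a"] by (simp add: g_def g2_def dec nth_append set_replicate_pmf)
  have "(\<Sum>j<n1 + n2. measure_pmf.expectation (replicate_pmf (n1 + n2) p) (\<lambda>xys. g xys j))
     = (\<Sum>j<n1. measure_pmf.expectation (replicate_pmf n1 p) (\<lambda>a. g1 a j)) + (\<Sum>j<n2. measure_pmf.expectation (replicate_pmf n2 p) (\<lambda>b. g2 b j))"
    unfolding sum_lessThan_add
  proof (rule arg_cong2[where f = "(+)"]; rule sum.cong[OF refl])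
    fix j assume "j \<in> {..<n1}"
    then have "measure_pmf.expectation (replicate_pmf (n1 + n2) p) (\<lambda>xys. g xys j) =
       measure_pmf.expectation (replicate_pmf n1 p) (\<lambda>a. measure_pmf.expectation (replicate_pmf n2 p) (\<lambda>b. g1 a j))"
      unfolding E by (intro cong 1) auto
    then show "measure_pmf.expectation (replicate_pmf (n1 + n2) p) (\<lambda>xys. g xys j) = measure_pmf.expectation (replicate_pmf n1 p) (\<lambda>a. g1 a j)"
      by simp
  next
    fix j assume "j \<in> {..<n2}"
    then have "measure_pmf.expectation (replicate_pmf (n1 + n2) p) (\<lambda>xys. g xys (n1 + j)) =
       measure_pmf.expectation (replicate_pmf n1 p) (\<lambda>a. measure_pmf.expectation (replicate_pmf n2 p) (\<lambda>b. g2 b j))"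
      unfolding E by (intro cong 2) auto
    then show "measure_pmf.expectation (replicate_pmf (n1 + n2) p) (\<lambda>xys. g xys (n1 + j)) = measure_pmf.expectation (replicate_pmf n2 p) (\<lambda>b. g2 b j)"
      by simp
  qed
  then show ?thesis using n
    unfolding avg_dist_def Let_def g_def[symmetric] g1_def[symmetric] g2_def[symmetric] by simp
qed

text \<open>Subtracting and adding 1 converts between message numbers and digits. Padding and
  truncating force length n for every pair of messages, including those that the component codes
  never produce, as \<open>is_code\<close> requires.\<close>

definition concat_decoder :: "nat \<Rightarrow> nat \<Rightarrow> nat \<Rightarrow> (nat \<Rightarrow> nat \<Rightarrow> 'b list) \<Rightarrow> (nat \<Rightarrow> nat \<Rightarrow> 'b list) \<Rightarrow> nat \<Rightarrow> nat \<Rightarrow> 'b list" where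
  "concat_decoder n MX MY g h mx my = take n ((g ((mx - 1) div MX + 1) ((my - 1) div MY + 1)
     @ h ((mx - 1) mod MX + 1) ((my - 1) mod MY + 1)) @ replicate n undefined)"

text \<open>The first floor (n \<alpha>) letters use one code and the rest the other. The strict
  inequalities in RX and RY absorb the rounding; R0 is common to both codes, and there the message
  counts multiply without any slack.\<close>

lemma achievable_time_share:
  fixes p :: "('x::finite \<times> 'y::finite) pmf"
    and f1 :: "'x \<Rightarrow> 'y \<Rightarrow> 'f1" and f2 :: "'x \<Rightarrow> 'y \<Rightarrow> 'f2"
  assumes a1: "achievable p f1 f2 d1 d2 D1 D2 R0 RX1 RY1" and a2: "achievable p f1 f2 d1 d2 D1 D2 R0 RX2 RY2"
    and \<alpha>: "0 < \<alpha>" "\<alpha> < 1" and RX: "\<alpha> * RX1 + (1 - \<alpha>) * RX2 < RX" and RY: "\<alpha> * RY1 + (1 - \<alpha>) * RY2 < RY"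
  shows "achievable p f1 f2 d1 d2 D1 D2 R0 RX RY"
  unfolding achievable_def
proof (intro allI impI)
  fix \<epsilon> :: real assume \<epsilon>: "\<epsilon> > 0"
  from a1 \<epsilon> obtain N1 where N1: "\<And>n. n \<ge> N1 \<Longrightarrow> \<exists>\<phi>0 \<phi>X \<phi>Y \<psi>1 \<psi>2. is_code n R0 RX1 RY1 \<phi>0 \<phi>X \<phi>Y \<psi>1 \<psi>2 \<and>
        avg_dist n p f1 d1 \<phi>0 \<phi>X \<phi>Y \<psi>1 \<le> D1 + \<epsilon> \<and> avg_dist n p f2 d2 \<phi>0 \<phi>X \<phi>Y \<psi>2 \<le> D2 + \<epsilon>"
    unfolding achievable_def by blast
  from a2 \<epsilon> obtain N2 where N2: "\<And>n. n \<ge> N2 \<Longrightarrow> \<exists>\<phi>0 \<phi>X \<phi>Y \<psi>1 \<psi>2. is_code n R0 RX2 RY2 \<phi>0 \<phi>X \<phi>Y \<psi>1 \<psi>2 \<and>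
        avg_dist n p f1 d1 \<phi>0 \<phi>X \<phi>Y \<psi>1 \<le> D1 + \<epsilon> \<and> avg_dist n p f2 d2 \<phi>0 \<phi>X \<phi>Y \<psi>2 \<le> D2 + \<epsilon>"
    unfolding achievable_def by blast
  define gX where "gX = RX - (\<alpha> * RX1 + (1 - \<alpha>) * RX2)"
  define gY where "gY = RY - (\<alpha> * RY1 + (1 - \<alpha>) * RY2)"
  have g: "gX > 0" "gY > 0" using RX RY by (auto simp: gX_def gY_def)
  \<comment> \<open>N1 + 2 leaves n1 >= N1 and n1 > 0 after rounding down. The last two bounds let
    the accumulated rate slack cover the at most one letter that rounding moves from one code to the
    other.\<close>
  obtain N :: nat where N: "real N * \<alpha> \<ge> N1 + 2" "real N * (1 - \<alpha>) \<ge> N2 + 1"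
      "real N * gX \<ge> \<bar>RX2 - RX1\<bar>" "real N * gY \<ge> \<bar>RY2 - RY1\<bar>"
  proof -
    have "\<exists>N. real N * c \<ge> b" if "c > 0" for b c
    proof -
      obtain N where "real N \<ge> b / c" using real_arch_simple by blast
      then show ?thesis using that by (auto simp: field_simps)
    qed
    then obtain A B C D where *: "real A * \<alpha> \<ge> N1 + 2" "real B * (1 - \<alpha>) \<ge> N2 + 1"
      "real C * gX \<ge> \<bar>RX2 - RX1\<bar>" "real D * gY \<ge> \<bar>RY2 - RY1\<bar>" using \<alpha> g by (metis diff_gt_0_iff_gt)
    have "real (A + B + C + D) * c \<ge> real k * c" if "c > 0" "k \<le> A + B + C + D" for c k
      using that by (intro mult_right_mono) auto
    from this[of \<alpha> A] this[of "1 - \<alpha>" B] this[of gX C] this[of gY D] show ?thesis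
      using that[of "A + B + C + D"] * \<alpha> g by fastforce
  qed
  show "\<exists>N. \<forall>n\<ge>N. \<exists>\<phi>0 \<phi>X \<phi>Y \<psi>1 \<psi>2. is_code n R0 RX RY \<phi>0 \<phi>X \<phi>Y \<psi>1 \<psi>2 \<and>
        avg_dist n p f1 d1 \<phi>0 \<phi>X \<phi>Y \<psi>1 \<le> D1 + \<epsilon> \<and> avg_dist n p f2 d2 \<phi>0 \<phi>X \<phi>Y \<psi>2 \<le> D2 + \<epsilon>"
  proof (rule exI[of _ N], intro allI impI)
    fix n assume "n \<ge> N"
    then have nN: "real n * c \<ge> real N * c" if "c \<ge> 0" for c using that by (intro mult_right_mono) auto
    have nb: "real n * \<alpha> \<ge> N1 + 2" "real n * (1 - \<alpha>) \<ge> N2 + 1"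
      "real n * gX \<ge> \<bar>RX2 - RX1\<bar>" "real n * gY \<ge> \<bar>RY2 - RY1\<bar>"
      using N nN[of \<alpha>] nN[of "1 - \<alpha>"] nN[of gX] nN[of gY] \<alpha> g by linarith+
    define n1 where "n1 = nat \<lfloor>real n * \<alpha>\<rfloor>"
    define n2 where "n2 = n - n1"
    define \<theta> where "\<theta> = real n * \<alpha> - real n1"
    have \<theta>: "0 \<le> \<theta>" "\<theta> \<le> 1" using \<alpha> by (auto simp: \<theta>_def n1_def) linarith
    have "real n1 \<le> real n" using \<theta> \<alpha> mult_left_le[of \<alpha> "real n"] by (simp add: \<theta>_def)
    then have n12: "n1 + n2 = n" and r2: "real n2 = real n - real n1" by (auto simp: n2_def)
    have n1: "n1 \<ge> N1" "n1 > 0" using nb(1) \<theta> by (auto simp: \<theta>_def)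
    have n2: "n2 \<ge> N2" "n2 > 0" using nb(2) \<theta> r2 by (auto simp: \<theta>_def algebra_simps)
    have rate: "real n1 * r1 + real n2 * r2 \<le> real n * r"
      if "real n * (r - (\<alpha> * r1 + (1 - \<alpha>) * r2)) \<ge> \<bar>r2 - r1\<bar>" for r1 r2 r
    proof -
      have "\<theta> * (r2 - r1) \<le> \<theta> * \<bar>r2 - r1\<bar>" using \<theta> by (intro mult_left_mono) auto
      also have "\<dots> \<le> 1 * \<bar>r2 - r1\<bar>" using \<theta> by (intro mult_right_mono) auto
      finally have "\<theta> * (r2 - r1) \<le> real n * (r - (\<alpha> * r1 + (1 - \<alpha>) * r2))" using that by simp
      moreover have "real n1 = real n * \<alpha> - \<theta>" "real n2 = real n * (1 - \<alpha>) + \<theta>"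
        by (simp_all add: \<theta>_def r2 algebra_simps)
      then have "real n1 * r1 + real n2 * r2 = real n * (\<alpha> * r1 + (1 - \<alpha>) * r2) + \<theta> * (r2 - r1)"
        by (simp only:) (simp add: algebra_simps)
      ultimately show ?thesis by (simp add: right_diff_distrib)
    qed
    define M0 MX MY where "M0 = msgs n2 R0" and "MX = msgs n2 RX2" and "MY = msgs n2 RY2"
    have m0: "msgs n1 R0 * M0 \<le> msgs n R0" unfolding M0_def by (rule msgs_mult_le) (simp add: n12[symmetric] distrib_right)
    have mX: "msgs n1 RX1 * MX \<le> msgs n RX" unfolding MX_def using nb(3) by (intro msgs_mult_le rate) (simp add: gX_def)
    have mY: "msgs n1 RY1 * MY \<le> msgs n RY" unfolding MY_def using nb(4) by (intro msgs_mult_le rate) (simp add: gY_def)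
    from N1[OF n1(1)] obtain \<phi>01 \<phi>X1 \<phi>Y1 \<psi>11 \<psi>21 where c1: "is_code n1 R0 RX1 RY1 \<phi>01 \<phi>X1 \<phi>Y1 \<psi>11 \<psi>21"
      "avg_dist n1 p f1 d1 \<phi>01 \<phi>X1 \<phi>Y1 \<psi>11 \<le> D1 + \<epsilon>" "avg_dist n1 p f2 d2 \<phi>01 \<phi>X1 \<phi>Y1 \<psi>21 \<le> D2 + \<epsilon>" by blast
    from N2[OF n2(1)] obtain \<phi>02 \<phi>X2 \<phi>Y2 \<psi>12 \<psi>22 where c2: "is_code n2 R0 RX2 RY2 \<phi>02 \<phi>X2 \<phi>Y2 \<psi>12 \<psi>22"
      "avg_dist n2 p f1 d1 \<phi>02 \<phi>X2 \<phi>Y2 \<psi>12 \<le> D1 + \<epsilon>" "avg_dist n2 p f2 d2 \<phi>02 \<phi>X2 \<phi>Y2 \<psi>22 \<le> D2 + \<epsilon>" by blast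
    define \<phi>0 where "\<phi>0 xs = clip (msgs n R0) (pack M0 (\<phi>01 (take n1 xs) - 1) (\<phi>02 (drop n1 xs) - 1))" for xs
    define \<phi>X where "\<phi>X xs = clip (msgs n RX) (pack MX (\<phi>X1 (take n1 xs) - 1) (\<phi>X2 (drop n1 xs) - 1))" for xs
    define \<phi>Y where "\<phi>Y ys m = clip (msgs n RY) (pack MY (\<phi>Y1 (take n1 ys) ((m - 1) div M0 + 1) - 1) (\<phi>Y2 (drop n1 ys) ((m - 1) mod M0 + 1) - 1))" for ys m
    have r1: "length as = n1 \<Longrightarrow> \<phi>01 as \<in> {1..msgs n1 R0}" "length as = n1 \<Longrightarrow> \<phi>X1 as \<in> {1..msgs n1 RX1}"
      "length bs = n1 \<Longrightarrow> m \<in> {1..msgs n1 R0} \<Longrightarrow> \<phi>Y1 bs m \<in> {1..msgs n1 RY1}" for as bs m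
      using c1(1) unfolding is_code_def by blast+
    have r2': "length as = n2 \<Longrightarrow> \<phi>02 as \<in> {1..M0}" "length as = n2 \<Longrightarrow> \<phi>X2 as \<in> {1..MX}"
      "length bs = n2 \<Longrightarrow> m \<in> {1..M0} \<Longrightarrow> \<phi>Y2 bs m \<in> {1..MY}" for as bs m
      using c2(1) unfolding is_code_def M0_def MX_def MY_def by blast+
    have enc: "\<phi>0 (as @ cs) = pack M0 (\<phi>01 as - 1) (\<phi>02 cs - 1) \<and> \<phi>X (as @ cs) = pack MX (\<phi>X1 as - 1) (\<phi>X2 cs - 1) \<and>
       \<phi>Y (bs @ ds) (\<phi>0 (as @ cs)) = pack MY (\<phi>Y1 bs (\<phi>01 as) - 1) (\<phi>Y2 ds (\<phi>02 cs) - 1)"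
      if l: "length as = n1" "length bs = n1" "length cs = n2" "length ds = n2" for as bs cs ds
    proof -
      note R = r1(1)[OF l(1)] r1(2)[OF l(1)] r1(3)[OF l(2) r1(1)[OF l(1)]] r2'(1)[OF l(3)] r2'(2)[OF l(3)] r2'(3)[OF l(4) r2'(1)[OF l(3)]]
      have lt: "k - 1 < M" if "k \<in> {1..M}" for k M :: nat using that by auto
      have e0: "\<phi>0 (as @ cs) = pack M0 (\<phi>01 as - 1) (\<phi>02 cs - 1)"
        using l clip_id[OF pack_le[OF lt[OF R(1)] lt[OF R(4)] m0]] by (simp add: \<phi>0_def)
      have eX: "\<phi>X (as @ cs) = pack MX (\<phi>X1 as - 1) (\<phi>X2 cs - 1)"
        using l clip_id[OF pack_le[OF lt[OF R(2)] lt[OF R(5)] mX]] by (simp add: \<phi>X_def)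
      have "\<phi>Y (bs @ ds) (\<phi>0 (as @ cs)) = clip (msgs n RY) (pack MY (\<phi>Y1 bs (\<phi>01 as - 1 + 1) - 1) (\<phi>Y2 ds (\<phi>02 cs - 1 + 1) - 1))"
        unfolding \<phi>Y_def e0 unpack[OF lt[OF R(4)]] using l by simp
      also have "\<phi>01 as - 1 + 1 = \<phi>01 as" using R(1) by simp
      also have "\<phi>02 cs - 1 + 1 = \<phi>02 cs" using R(4) by simp
      also have "clip (msgs n RY) (pack MY (\<phi>Y1 bs (\<phi>01 as) - 1) (\<phi>Y2 ds (\<phi>02 cs) - 1)) = pack MY (\<phi>Y1 bs (\<phi>01 as) - 1) (\<phi>Y2 ds (\<phi>02 cs) - 1)"
        by (rule clip_id[OF pack_le[OF lt[OF R(3)] lt[OF R(6)] mY]])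
      finally show ?thesis using e0 eX by blast
    qed
    have dec: "concat_decoder n MX MY g h (\<phi>X (as @ cs)) (\<phi>Y (bs @ ds) (\<phi>0 (as @ cs))) = g (\<phi>X1 as) (\<phi>Y1 bs (\<phi>01 as)) @ h (\<phi>X2 cs) (\<phi>Y2 ds (\<phi>02 cs))"
      if l: "length as = n1" "length bs = n1" "length cs = n2" "length ds = n2"
        and g: "\<And>mx my. mx \<in> {1..msgs n1 RX1} \<Longrightarrow> my \<in> {1..msgs n1 RY1} \<Longrightarrow> length (g mx my) = n1"
        and h: "\<And>mx my. mx \<in> {1..MX} \<Longrightarrow> my \<in> {1..MY} \<Longrightarrow> length (h mx my) = n2"
      for as bs cs ds and g h :: "nat \<Rightarrow> nat \<Rightarrow> 'b list"
    proof -
      note R = r1(1)[OF l(1)] r1(2)[OF l(1)] r1(3)[OF l(2) r1(1)[OF l(1)]] r2'(1)[OF l(3)] r2'(2)[OF l(3)] r2'(3)[OF l(4) r2'(1)[OF l(3)]]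
      have lt: "k - 1 < M" if "k \<in> {1..M}" for k M :: nat using that by auto
      have e: "\<phi>X (as @ cs) = pack MX (\<phi>X1 as - 1) (\<phi>X2 cs - 1)"
        "\<phi>Y (bs @ ds) (\<phi>0 (as @ cs)) = pack MY (\<phi>Y1 bs (\<phi>01 as) - 1) (\<phi>Y2 ds (\<phi>02 cs) - 1)" using enc[OF l] by auto
      have suc: "k - 1 + 1 = k" if "k \<in> {1..M}" for k M :: nat using that by auto
      have "concat_decoder n MX MY g h (\<phi>X (as @ cs)) (\<phi>Y (bs @ ds) (\<phi>0 (as @ cs))) =
         take n ((g (\<phi>X1 as) (\<phi>Y1 bs (\<phi>01 as)) @ h (\<phi>X2 cs) (\<phi>Y2 ds (\<phi>02 cs))) @ replicate n undefined)"
        unfolding concat_decoder_def e unpack[OF lt[OF R(5)]] unpack[OF lt[OF R(6)]] suc[OF R(2)] suc[OF R(3)] suc[OF R(5)] suc[OF R(6)] ..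
      then show ?thesis using g[OF R(2,3)] h[OF R(5,6)] n12 by simp
    qed
    have big: "msgs n R0 \<ge> 1" "msgs n RX \<ge> 1" "msgs n RY \<ge> 1"
    proof -
      have "msgs n1 R0 \<ge> 1" "msgs n1 RX1 \<ge> 1" "M0 \<ge> 1" "MX \<ge> 1"
        using r1(1,2)[of "replicate n1 undefined"] r2'(1,2)[of "replicate n2 undefined"] by simp_all
      moreover have "msgs n1 RY1 \<ge> 1" "MY \<ge> 1"
        using r1(3)[of "replicate n1 undefined" 1] r2'(3)[of "replicate n2 undefined" 1] calculation by simp_all
      ultimately show "msgs n R0 \<ge> 1" "msgs n RX \<ge> 1" "msgs n RY \<ge> 1"
        using m0 mX mY by (metis le_trans mult_le_mono nat_mult_1)+
    qed
    have lenPsi: "length (concat_decoder n MX MY g h mx my) = n" for g h :: "nat \<Rightarrow> nat \<Rightarrow> 'b list" and mx my by (simp add: concat_decoder_def del: take_append)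
    have code: "is_code n R0 RX RY \<phi>0 \<phi>X \<phi>Y (concat_decoder n MX MY \<psi>11 \<psi>12) (concat_decoder n MX MY \<psi>21 \<psi>22)"
      unfolding is_code_def using big clip_range by (auto simp: \<phi>0_def \<phi>X_def \<phi>Y_def lenPsi)
    have avg: "avg_dist n p f d \<phi>0 \<phi>X \<phi>Y (concat_decoder n MX MY g h) \<le> E"
      if g: "\<And>mx my. mx \<in> {1..msgs n1 RX1} \<Longrightarrow> my \<in> {1..msgs n1 RY1} \<Longrightarrow> length (g mx my) = n1"
        and h: "\<And>mx my. mx \<in> {1..MX} \<Longrightarrow> my \<in> {1..MY} \<Longrightarrow> length (h mx my) = n2"
        and le: "avg_dist n1 p f d \<phi>01 \<phi>X1 \<phi>Y1 g \<le> E" "avg_dist n2 p f d \<phi>02 \<phi>X2 \<phi>Y2 h \<le> E"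
      for f :: "'x \<Rightarrow> 'y \<Rightarrow> 'b" and d g h E
    proof -
      have "avg_dist n p f d \<phi>0 \<phi>X \<phi>Y (concat_decoder n MX MY g h) = (real n1 * avg_dist n1 p f d \<phi>01 \<phi>X1 \<phi>Y1 g + real n2 * avg_dist n2 p f d \<phi>02 \<phi>X2 \<phi>Y2 h) / real (n1 + n2)"
        unfolding n12[symmetric]
        by (rule avg_dist_concat[OF n1(2) n2(2)]) (use dec[OF _ _ _ _ g h] g r1 in \<open>auto simp: n12\<close>)
      also have "\<dots> \<le> (real n1 * E + real n2 * E) / real (n1 + n2)"
        using le by (intro divide_right_mono add_mono mult_left_mono) auto
      also have "\<dots> = E" using n1 by (simp add: distrib_right[symmetric])
      finally show ?thesis .
    qed
    have "avg_dist n p f1 d1 \<phi>0 \<phi>X \<phi>Y (concat_decoder n MX MY \<psi>11 \<psi>12) \<le> D1 + \<epsilon>"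
      by (rule avg) (use c1 c2 in \<open>auto simp: is_code_def MX_def MY_def\<close>)
    moreover have "avg_dist n p f2 d2 \<phi>0 \<phi>X \<phi>Y (concat_decoder n MX MY \<psi>21 \<psi>22) \<le> D2 + \<epsilon>"
      by (rule avg) (use c1 c2 in \<open>auto simp: is_code_def MX_def MY_def\<close>)
    ultimately show "\<exists>\<phi>0 \<phi>X \<phi>Y \<psi>1 \<psi>2. is_code n R0 RX RY \<phi>0 \<phi>X \<phi>Y \<psi>1 \<psi>2 \<and>
        avg_dist n p f1 d1 \<phi>0 \<phi>X \<phi>Y \<psi>1 \<le> D1 + \<epsilon> \<and> avg_dist n p f2 d2 \<phi>0 \<phi>X \<phi>Y \<psi>2 \<le> D2 + \<epsilon>"
      using code by blast
  qed
qed

section \<open>Conditional mutual information and Markov chains\<close>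

text \<open>Mass of the atom containing z in the partition generated by A. Only that partition
  enters, not the values of A, which makes reordering, regrouping and relabelling of tuples
  transparent.\<close>

definition atom_prob :: "'o pmf \<Rightarrow> ('o \<Rightarrow> 'a) \<Rightarrow> 'o \<Rightarrow> real" where
  "atom_prob Q A z = measure Q {z'. A z' = A z}"

lemma pmf_map_measure: "pmf (map_pmf A Q) a = measure Q {z. A z = a}"
  by (simp add: pmf_map vimage_def)

lemma pmf_map_atom: "pmf (map_pmf A Q) (A z) = atom_prob Q A z"
  by (simp add: pmf_map_measure atom_prob_def)

lemma atom_prob_pos: "z \<in> set_pmf Q \<Longrightarrow> atom_prob Q A z > 0"
  unfolding atom_prob_def by (rule measure_pmf_posI) auto

lemma atom_prob_cong:
  assumes "\<And>z'. z' \<in> set_pmf Q \<Longrightarrow> A z' = A z \<longleftrightarrow> B z' = B z"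
  shows "atom_prob Q A z = atom_prob Q B z"
  unfolding atom_prob_def by (rule measure_pmf.finite_measure_eq_AE) (use assms in \<open>auto simp: AE_measure_pmf_iff\<close>)

text \<open>2 to the power of the conditional information density at the outcome z.\<close>

definition cmi_density :: "'o pmf \<Rightarrow> ('o \<Rightarrow> 'a) \<Rightarrow> ('o \<Rightarrow> 'b) \<Rightarrow> ('o \<Rightarrow> 'c) \<Rightarrow> 'o \<Rightarrow> real" where
  "cmi_density Q A B C z = atom_prob Q (\<lambda>z. (A z, B z, C z)) z * atom_prob Q C z /
     (atom_prob Q (\<lambda>z. (A z, C z)) z * atom_prob Q (\<lambda>z. (B z, C z)) z)"

lemma cmi_eq_expectation:
  assumes "finite (set_pmf Q)"
  shows "cmi Q A B C = measure_pmf.expectation Q (\<lambda>z. log 2 (cmi_density Q A B C z))"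
proof -
  let ?R = "map_pmf (\<lambda>z. (A z, B z, C z)) Q"
  let ?g = "\<lambda>(a, b, c). log 2 ((pmf ?R (a, b, c) * pmf (map_pmf C Q) c) /
     (pmf (map_pmf (\<lambda>z. (A z, C z)) Q) (a, c) * pmf (map_pmf (\<lambda>z. (B z, C z)) Q) (b, c)))"
  have "cmi Q A B C = (\<Sum>x\<in>set_pmf ?R. pmf ?R x *\<^sub>R ?g x)"
    unfolding cmi_def Let_def by (intro sum.cong refl) auto
  also have "\<dots> = measure_pmf.expectation ?R ?g"
    by (rule integral_measure_pmf[symmetric]) (use assms in auto)
  also have "\<dots> = measure_pmf.expectation Q (\<lambda>z. ?g (A z, B z, C z))" by simp
  also have "\<dots> = measure_pmf.expectation Q (\<lambda>z. log 2 (cmi_density Q A B C z))"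
    by (simp add: cmi_density_def pmf_map_measure atom_prob_def)
  finally show ?thesis .
qed

lemma cmi_density_pos: "z \<in> set_pmf Q \<Longrightarrow> cmi_density Q A B C z > 0"
  unfolding cmi_density_def by (intro divide_pos_pos mult_pos_pos atom_prob_pos)

lemma sum_pmf_map_fst:
  assumes "finite (set_pmf Q)"
  shows "(\<Sum>a\<in>A ` set_pmf Q. pmf (map_pmf (\<lambda>z. (A z, C z)) Q) (a, c)) = pmf (map_pmf C Q) c"
proof -
  have "pmf (map_pmf C Q) c = measure Q ({z. C z = c} \<inter> set_pmf Q)"
    by (simp add: pmf_map_measure measure_Int_set_pmf)
  also have "{z. C z = c} \<inter> set_pmf Q = (\<Union>a\<in>A ` set_pmf Q. {z. A z = a \<and> C z = c} \<inter> set_pmf Q)" by auto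
  also have "measure Q \<dots> = (\<Sum>a\<in>A ` set_pmf Q. measure Q ({z. A z = a \<and> C z = c} \<inter> set_pmf Q))"
    by (rule measure_pmf.finite_measure_finite_Union) (use assms in \<open>auto simp: disjoint_family_on_def\<close>)
  finally show ?thesis by (simp add: pmf_map_measure measure_Int_set_pmf)
qed

text \<open>The reciprocal of the density has mean at most 1: its sum over the support extends to a
  product of ranges, on which PA PB / PC sums to 1. Then 1 - 1 / x <= ln x is averaged.\<close>

lemma cmi_nonneg:
  assumes fin: "finite (set_pmf Q)"
  shows "cmi Q A B C \<ge> 0"
proof -
  let ?R = "map_pmf (\<lambda>z. (A z, B z, C z)) Q"
  define P where "P = pmf ?R"
  define PC where "PC = pmf (map_pmf C Q)"
  define PA where "PA = pmf (map_pmf (\<lambda>z. (A z, C z)) Q)"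
  define PB where "PB = pmf (map_pmf (\<lambda>z. (B z, C z)) Q)"
  let ?S = "set_pmf ?R"
  let ?A = "A ` set_pmf Q" and ?B = "B ` set_pmf Q" and ?C = "C ` set_pmf Q"
  have int: "integrable (measure_pmf Q) h" for h :: "'a \<Rightarrow> real" using fin by (rule integrable_measure_pmf_finite)
  have "measure_pmf.expectation Q (\<lambda>z. 1 / cmi_density Q A B C z) = measure_pmf.expectation ?R (\<lambda>(a, b, c). PA (a, c) * PB (b, c) / (P (a, b, c) * PC c))"
    by (simp add: cmi_density_def P_def PC_def PA_def PB_def pmf_map_measure atom_prob_def)
  also have "\<dots> = (\<Sum>x\<in>?S. P x *\<^sub>R (case x of (a, b, c) \<Rightarrow> PA (a, c) * PB (b, c) / (P (a, b, c) * PC c)))"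
    unfolding P_def by (rule integral_measure_pmf) (use fin in auto)
  also have "\<dots> = (\<Sum>(a, b, c)\<in>?S. PA (a, c) * PB (b, c) / PC c)"
    by (intro sum.cong refl) (auto simp: P_def set_pmf_iff[symmetric] pmf_eq_0_set_pmf)
  also have "\<dots> \<le> (\<Sum>(a, b, c)\<in>?A \<times> ?B \<times> ?C. PA (a, c) * PB (b, c) / PC c)"
    by (intro sum_mono2) (use fin in \<open>auto simp: PA_def PB_def PC_def\<close>)
  also have "\<dots> = (\<Sum>a\<in>?A. \<Sum>b\<in>?B. \<Sum>c\<in>?C. PA (a, c) * PB (b, c) / PC c)"
    by (simp add: sum.cartesian_product split_def)
  also have "\<dots> = (\<Sum>c\<in>?C. \<Sum>a\<in>?A. \<Sum>b\<in>?B. PA (a, c) * PB (b, c) / PC c)"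
    by (subst sum.swap[of _ ?C ?B], subst sum.swap[of _ ?C ?A], rule refl)
  also have "\<dots> = (\<Sum>c\<in>?C. (\<Sum>a\<in>?A. PA (a, c)) * (\<Sum>b\<in>?B. PB (b, c)) / PC c)"
    by (simp add: sum_product sum_divide_distrib)
  also have "\<dots> = (\<Sum>c\<in>?C. PC c)"
    using sum_pmf_map_fst[OF fin, of A C] sum_pmf_map_fst[OF fin, of B C] by (intro sum.cong refl) (simp add: PA_def PB_def PC_def)
  also have "\<dots> = 1" unfolding PC_def by (rule sum_pmf_eq_1) (use fin in auto)
  finally have le1: "measure_pmf.expectation Q (\<lambda>z. 1 / cmi_density Q A B C z) \<le> 1" .
  have "measure_pmf.expectation Q (\<lambda>z. (1 - 1 / cmi_density Q A B C z) / ln 2) \<le> cmi Q A B C"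
    unfolding cmi_eq_expectation[OF fin]
  proof (rule integral_mono_AE[OF int int], rule AE_pmfI)
    fix z assume "z \<in> set_pmf Q"
    then have pos: "cmi_density Q A B C z > 0" by (rule cmi_density_pos)
    have "- ln (cmi_density Q A B C z) = ln (1 / cmi_density Q A B C z)" using pos by (simp add: ln_div)
    also have "\<dots> \<le> 1 / cmi_density Q A B C z - 1" using pos by (intro ln_le_minus_one) simp
    finally show "(1 - 1 / cmi_density Q A B C z) / ln 2 \<le> log 2 (cmi_density Q A B C z)"
      unfolding log_def by (intro divide_right_mono) auto
  qed
  moreover have "measure_pmf.expectation Q (\<lambda>z. (1 - 1 / cmi_density Q A B C z) / ln 2)
     = (1 - measure_pmf.expectation Q (\<lambda>z. 1 / cmi_density Q A B C z)) / ln 2"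
    using int by simp
  ultimately show ?thesis using le1 by (smt (verit) divide_nonneg_nonneg ln_ge_zero)
qed

section \<open>Markov chains as product identities\<close>

lemma markov3_iff_measure:
  "markov3 Q A B C \<longleftrightarrow> (\<forall>a b c. measure Q {z. A z = a \<and> B z = b \<and> C z = c} * measure Q {z. B z = b}
     = measure Q {z. A z = a \<and> B z = b} * measure Q {z. B z = b \<and> C z = c})"
  by (simp add: markov3_def pmf_map_measure)

lemma markov3_sets:
  assumes fin: "finite (set_pmf Q)" and M: "markov3 Q A B C"
  shows "measure Q {z. A z \<in> S \<and> B z = b \<and> C z \<in> T} * measure Q {z. B z = b}
     = measure Q {z. A z \<in> S \<and> B z = b} * measure Q {z. B z = b \<and> C z \<in> T}"
proof -
  let ?A = "A ` set_pmf Q \<inter> S" and ?C = "C ` set_pmf Q \<inter> T"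
  have cut: "measure Q {z. A z \<in> S \<and> P z} = (\<Sum>a\<in>A ` set_pmf Q \<inter> S. measure Q {z. A z = a \<and> P z})" for P S and A :: "_ \<Rightarrow> 'z"
  proof -
    have "measure Q {z. A z \<in> S \<and> P z} = measure Q ({z. A z \<in> S \<and> P z} \<inter> set_pmf Q)" by (simp add: measure_Int_set_pmf)
    also have "{z. A z \<in> S \<and> P z} \<inter> set_pmf Q = (\<Union>a\<in>A ` set_pmf Q \<inter> S. {z. A z = a \<and> P z} \<inter> set_pmf Q)" by auto
    also have "measure Q \<dots> = (\<Sum>a\<in>A ` set_pmf Q \<inter> S. measure Q ({z. A z = a \<and> P z} \<inter> set_pmf Q))"
      by (rule measure_pmf.finite_measure_finite_Union) (use fin in \<open>auto simp: disjoint_family_on_def\<close>)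
    finally show ?thesis by (simp add: measure_Int_set_pmf)
  qed
  have cut2: "measure Q {z. P z \<and> C z \<in> T} = (\<Sum>c\<in>?C. measure Q {z. P z \<and> C z = c})" for P
    using cut[of C T P] by (simp add: conj_commute)
  have "measure Q {z. A z \<in> S \<and> B z = b \<and> C z \<in> T} = (\<Sum>a\<in>?A. \<Sum>c\<in>?C. measure Q {z. A z = a \<and> B z = b \<and> C z = c})"
    unfolding cut[of A S] by (intro sum.cong refl) (use cut2[of "\<lambda>z. A z = _ \<and> B z = b"] in simp)
  then have "measure Q {z. A z \<in> S \<and> B z = b \<and> C z \<in> T} * measure Q {z. B z = b}
      = (\<Sum>a\<in>?A. \<Sum>c\<in>?C. measure Q {z. A z = a \<and> B z = b \<and> C z = c} * measure Q {z. B z = b})"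
    by (simp add: sum_distrib_right)
  also have "\<dots> = (\<Sum>a\<in>?A. \<Sum>c\<in>?C. measure Q {z. A z = a \<and> B z = b} * measure Q {z. B z = b \<and> C z = c})"
    using M unfolding markov3_iff_measure by simp
  also have "\<dots> = (\<Sum>a\<in>?A. measure Q {z. A z = a \<and> B z = b}) * (\<Sum>c\<in>?C. measure Q {z. B z = b \<and> C z = c})"
    by (simp add: sum_product)
  finally show ?thesis unfolding cut[of A S "\<lambda>z. B z = b"] cut2[of "\<lambda>z. B z = b"] .
qed

text \<open>For a fixed value b of the middle variable, events in A' and C' are events in A and in
  C; hence the outer variables may be replaced by functions that also see the middle one.\<close>

lemma markov3_gen:
  assumes fin: "finite (set_pmf Q)" and M: "markov3 Q A B C"
    and A': "\<And>z. z \<in> set_pmf Q \<Longrightarrow> A' z = f (A z) (B z)" and C': "\<And>z. z \<in> set_pmf Q \<Longrightarrow> C' z = g (B z) (C z)"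
  shows "markov3 Q A' B C'"
  unfolding markov3_iff_measure
proof (intro allI)
  fix a b c
  have eq: "measure Q S = measure Q T" if "\<And>z. z \<in> set_pmf Q \<Longrightarrow> z \<in> S \<longleftrightarrow> z \<in> T" for S T
    by (rule measure_pmf.finite_measure_eq_AE) (use that in \<open>auto simp: AE_measure_pmf_iff\<close>)
  have "measure Q {z. A' z = a \<and> B z = b \<and> C' z = c} = measure Q {z. A z \<in> {x. f x b = a} \<and> B z = b \<and> C z \<in> {x. g b x = c}}"
    by (rule eq) (auto simp: A' C')
  moreover have "measure Q {z. A' z = a \<and> B z = b} = measure Q {z. A z \<in> {x. f x b = a} \<and> B z = b}"
    by (rule eq) (auto simp: A')
  moreover have "measure Q {z. B z = b \<and> C' z = c} = measure Q {z. B z = b \<and> C z \<in> {x. g b x = c}}"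
    by (rule eq) (auto simp: C')
  ultimately show "measure Q {z. A' z = a \<and> B z = b \<and> C' z = c} * measure Q {z. B z = b}
     = measure Q {z. A' z = a \<and> B z = b} * measure Q {z. B z = b \<and> C' z = c}"
    using markov3_sets[OF fin M, of "{x. f x b = a}" b "{x. g b x = c}"] by (simp only:)
qed

lemma markov3_sym: "markov3 Q A B C \<Longrightarrow> markov3 Q C B A"
  unfolding markov3_iff_measure by (simp add: conj_commute conj_left_commute mult.commute)

text \<open>Weak union for conditional independence: the identities for (A, A2) and for A2 alone are
  cross-multiplied and P(B = b) is cancelled; if it vanishes, so do both sides.\<close>

lemma markov3_weak_union:
  fixes B :: "'o \<Rightarrow> 'b" and A2 :: "'o \<Rightarrow> 'c"
  assumes fin: "finite (set_pmf Q)" and M: "markov3 Q (\<lambda>z. (A z, A2 z)) B C"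
  shows "markov3 Q A (\<lambda>z. (B z, A2 z)) C"
  unfolding markov3_iff_measure
proof (intro allI)
  fix a and ba :: "'b \<times> 'c" and c
  obtain b a2 where ba: "ba = (b, a2)" by (cases ba)
  have M2: "markov3 Q A2 B C" by (rule markov3_gen[OF fin M, where f = "\<lambda>x _. snd x" and g = "\<lambda>_ x. x"]) auto
  let ?P = "\<lambda>R. measure Q {z. R z}"
  have 1: "?P (\<lambda>z. A z = a \<and> A2 z = a2 \<and> B z = b \<and> C z = c) * ?P (\<lambda>z. B z = b) =
      ?P (\<lambda>z. A z = a \<and> A2 z = a2 \<and> B z = b) * ?P (\<lambda>z. B z = b \<and> C z = c)"
    using M[unfolded markov3_iff_measure, rule_format, of "(a, a2)" b c] by simp
  have 2: "?P (\<lambda>z. A2 z = a2 \<and> B z = b \<and> C z = c) * ?P (\<lambda>z. B z = b) =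
      ?P (\<lambda>z. A2 z = a2 \<and> B z = b) * ?P (\<lambda>z. B z = b \<and> C z = c)"
    using M2[unfolded markov3_iff_measure, rule_format, of a2 b c] .
  have goal: "?P (\<lambda>z. A z = a \<and> A2 z = a2 \<and> B z = b \<and> C z = c) * ?P (\<lambda>z. A2 z = a2 \<and> B z = b) =
     ?P (\<lambda>z. A z = a \<and> A2 z = a2 \<and> B z = b) * ?P (\<lambda>z. A2 z = a2 \<and> B z = b \<and> C z = c)"
  proof (cases "?P (\<lambda>z. B z = b) = 0")
    case True
    have "?P (\<lambda>z. A2 z = a2 \<and> B z = b) \<le> ?P (\<lambda>z. B z = b)" "?P (\<lambda>z. A z = a \<and> A2 z = a2 \<and> B z = b) \<le> ?P (\<lambda>z. B z = b)"
      by (auto intro: measure_pmf.finite_measure_mono)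
    then have "?P (\<lambda>z. A2 z = a2 \<and> B z = b) = 0" "?P (\<lambda>z. A z = a \<and> A2 z = a2 \<and> B z = b) = 0"
      using True by (metis measure_le_0_iff)+
    then show ?thesis by simp
  next
    case False
    have "?P (\<lambda>z. A z = a \<and> A2 z = a2 \<and> B z = b \<and> C z = c) * ?P (\<lambda>z. A2 z = a2 \<and> B z = b) * ?P (\<lambda>z. B z = b)
        = ?P (\<lambda>z. A z = a \<and> A2 z = a2 \<and> B z = b) * ?P (\<lambda>z. A2 z = a2 \<and> B z = b \<and> C z = c) * ?P (\<lambda>z. B z = b)"
      using 1 2 by algebra
    then show ?thesis using False by simp
  qed
  have r: "{z. A z = a \<and> (B z, A2 z) = (b, a2) \<and> C z = c} = {z. A z = a \<and> A2 z = a2 \<and> B z = b \<and> C z = c}"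
     "{z. (B z, A2 z) = (b, a2)} = {z. A2 z = a2 \<and> B z = b}"
     "{z. A z = a \<and> (B z, A2 z) = (b, a2)} = {z. A z = a \<and> A2 z = a2 \<and> B z = b}"
     "{z. (B z, A2 z) = (b, a2) \<and> C z = c} = {z. A2 z = a2 \<and> B z = b \<and> C z = c}" by auto
  show "?P (\<lambda>z. A z = a \<and> (B z, A2 z) = ba \<and> C z = c) * ?P (\<lambda>z. (B z, A2 z) = ba) =
     ?P (\<lambda>z. A z = a \<and> (B z, A2 z) = ba) * ?P (\<lambda>z. (B z, A2 z) = ba \<and> C z = c)"
    unfolding ba r by (rule goal)
qed

lemma markov3_atom:
  "markov3 Q A B C \<Longrightarrow> atom_prob Q (\<lambda>z. (A z, B z, C z)) z * atom_prob Q B z =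
     atom_prob Q (\<lambda>z. (A z, B z)) z * atom_prob Q (\<lambda>z. (B z, C z)) z"
  unfolding markov3_iff_measure atom_prob_def by simp

text \<open>Conditional law of S given A = a. Off the range of A it defaults to the law of S, which
  keeps the support inside the values of S for every argument, as the support conditions of
  \<open>coding_scheme\<close> demand.\<close>

definition cond_kernel :: "'o pmf \<Rightarrow> ('o \<Rightarrow> 's) \<Rightarrow> ('o \<Rightarrow> 'a) \<Rightarrow> 'a \<Rightarrow> 's pmf" where
  "cond_kernel Q S A a = (if a \<in> A ` set_pmf Q then map_pmf S (cond_pmf Q {z. A z = a}) else map_pmf S Q)"

lemma set_cond_kernel: "set_pmf (cond_kernel Q S A a) \<subseteq> S ` set_pmf Q"
proof (cases "a \<in> A ` set_pmf Q")
  case True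
  then have "set_pmf Q \<inter> {z. A z = a} \<noteq> {}" by auto
  then have "set_pmf (cond_pmf Q {z. A z = a}) = set_pmf Q \<inter> {z. A z = a}" by (rule set_cond_pmf)
  with True show ?thesis by (auto simp: cond_kernel_def)
qed (simp add: cond_kernel_def)

lemma pmf_cond_kernel:
  assumes "a \<in> A ` set_pmf Q"
  shows "pmf (cond_kernel Q S A a) s = measure Q {z. S z = s \<and> A z = a} / measure Q {z. A z = a}"
proof -
  have ne: "set_pmf Q \<inter> {z. A z = a} \<noteq> {}" using assms by auto
  have "pmf (cond_kernel Q S A a) s = measure (cond_pmf Q {z. A z = a}) {z. S z = s}"
    using assms by (simp add: cond_kernel_def pmf_map_measure)
  also have "\<dots> = measure Q ({z. A z = a} \<inter> {z. S z = s}) / measure Q {z. A z = a}"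
    unfolding cond_pmf.rep_eq[OF ne]
    by (rule measure_uniform_measure) (use ne in \<open>auto simp: emeasure_measure_pmf_not_zero\<close>)
  also have "{z. A z = a} \<inter> {z. S z = s} = {z. S z = s \<and> A z = a}" by auto
  finally show ?thesis .
qed

lemma pmf_cond_kernel_atom:
  assumes "z \<in> set_pmf Q"
  shows "pmf (cond_kernel Q S A (A z)) (S z) = atom_prob Q (\<lambda>z. (S z, A z)) z / atom_prob Q A z"
  using assms by (subst pmf_cond_kernel) (auto simp: atom_prob_def)

lemma pmf_bind_pair: "pmf (bind_pmf P (\<lambda>c. map_pmf (Pair c) (K c))) (c, s) = pmf P c * pmf (K c) s"
proof -
  have "pmf (map_pmf (Pair c') (K c')) (c, s) = indicator {c} c' * pmf (K c) s" for c'
    by (cases "c' = c") (auto simp: pmf_map_inj' inj_on_def intro!: pmf_map_outside)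
  then have "pmf (bind_pmf P (\<lambda>c. map_pmf (Pair c) (K c))) (c, s) = measure_pmf.expectation P (\<lambda>c'. indicator {c} c' * pmf (K c) s)"
    by (simp add: pmf_bind)
  then show ?thesis by (simp add: measure_pmf_single)
qed

text \<open>C determines A through \<open>h\<close>, and by the chain S depends on C only through A;
  hence resampling S from its law given A restores its joint law with C.\<close>

lemma bind_cond_kernel:
  fixes C :: "'o \<Rightarrow> 'c" and S :: "'o \<Rightarrow> 's"
  assumes M: "markov3 Q S A C" and h: "\<And>z. z \<in> set_pmf Q \<Longrightarrow> A z = h (C z)"
  shows "bind_pmf (map_pmf C Q) (\<lambda>c. map_pmf (Pair c) (cond_kernel Q S A (h c))) = map_pmf (\<lambda>z. (C z, S z)) Q"
proof (rule pmf_eqI)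
  fix cs :: "'c \<times> 's"
  obtain c s where cs: "cs = (c, s)" by (cases cs)
  have eq: "measure Q S = measure Q T" if "\<And>z. z \<in> set_pmf Q \<Longrightarrow> z \<in> S \<longleftrightarrow> z \<in> T" for S T
    by (rule measure_pmf.finite_measure_eq_AE) (use that in \<open>auto simp: AE_measure_pmf_iff\<close>)
  show "pmf (bind_pmf (map_pmf C Q) (\<lambda>c. map_pmf (Pair c) (cond_kernel Q S A (h c)))) cs = pmf (map_pmf (\<lambda>z. (C z, S z)) Q) cs"
  proof (cases "c \<in> C ` set_pmf Q")
    case False
    then show ?thesis unfolding cs pmf_bind_pair by (subst (1 2) pmf_map_outside) auto
  next
    case True
    then have hA: "h c \<in> A ` set_pmf Q" using h by force
    have pos: "measure Q {z. A z = h c} > 0" using hA by (auto intro: measure_pmf_posI)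
    have "measure Q {z. S z = s \<and> A z = h c \<and> C z = c} * measure Q {z. A z = h c} =
       measure Q {z. S z = s \<and> A z = h c} * measure Q {z. A z = h c \<and> C z = c}"
      using M unfolding markov3_iff_measure by blast
    moreover have "measure Q {z. A z = h c \<and> C z = c} = measure Q {z. C z = c}" by (rule eq) (auto simp: h)
    moreover have "measure Q {z. S z = s \<and> A z = h c \<and> C z = c} = measure Q {z. C z = c \<and> S z = s}" by (rule eq) (auto simp: h)
    ultimately have "measure Q {z. C z = c} * (measure Q {z. S z = s \<and> A z = h c} / measure Q {z. A z = h c}) = measure Q {z. C z = c \<and> S z = s}"
      using pos by (simp add: field_simps)
    then show ?thesis unfolding cs pmf_bind_pair pmf_cond_kernel[OF hA] by (simp add: pmf_map_measure)
  qed
qed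

text \<open>By the chain, the law of S given A is its law given (A, B), so the logarithm of the
  kernel ratio is the conditional information density. This turns the rates of the races into
  conditional mutual informations.\<close>

lemma expectation_kernel_ratio:
  assumes fin: "finite (set_pmf Q)" and M: "markov3 Q S A B"
  shows "measure_pmf.expectation Q (\<lambda>z. log 2 (pmf (cond_kernel Q S A (A z)) (S z) / pmf (cond_kernel Q S B (B z)) (S z))) = cmi Q S A B"
  unfolding cmi_eq_expectation[OF fin]
proof (rule integral_cong_AE)
  show "AE z in measure_pmf Q. log 2 (pmf (cond_kernel Q S A (A z)) (S z) / pmf (cond_kernel Q S B (B z)) (S z)) = log 2 (cmi_density Q S A B z)"
  proof (rule AE_pmfI)
    fix z assume z: "z \<in> set_pmf Q"
    note pos = atom_prob_pos[OF z]
    have "atom_prob Q (\<lambda>z. (S z, A z)) z / atom_prob Q A z = atom_prob Q (\<lambda>z. (S z, A z, B z)) z / atom_prob Q (\<lambda>z. (A z, B z)) z"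
      using markov3_atom[OF M, of z] pos[of A] pos[of "\<lambda>z. (A z, B z)"] by (simp add: frac_eq_eq mult.commute)
    then show "log 2 (pmf (cond_kernel Q S A (A z)) (S z) / pmf (cond_kernel Q S B (B z)) (S z)) = log 2 (cmi_density Q S A B z)"
      unfolding pmf_cond_kernel_atom[OF z] cmi_density_def by (simp add: mult.commute)
  qed
qed auto

section \<open>Achievability of the inner bound\<close>

definition ent :: "'o pmf \<Rightarrow> ('o \<Rightarrow> 'a) \<Rightarrow> real" where
  "ent Q A = - measure_pmf.expectation Q (\<lambda>z. log 2 (atom_prob Q A z))"

lemma atom_prob_neq_0: "z \<in> set_pmf Q \<Longrightarrow> atom_prob Q A z \<noteq> 0"
  using atom_prob_pos[of z Q A] by simp

lemma cmi_eq_ent: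
  assumes fin: "finite (set_pmf Q)"
  shows "cmi Q A B C = ent Q (\<lambda>z. (A z, C z)) + ent Q (\<lambda>z. (B z, C z)) - ent Q (\<lambda>z. (A z, B z, C z)) - ent Q C"
proof -
  have int: "integrable (measure_pmf Q) h" for h :: "'a \<Rightarrow> real" using fin by (rule integrable_measure_pmf_finite)
  have "cmi Q A B C = measure_pmf.expectation Q (\<lambda>z. log 2 (atom_prob Q (\<lambda>z. (A z, B z, C z)) z) + log 2 (atom_prob Q C z)
     - log 2 (atom_prob Q (\<lambda>z. (A z, C z)) z) - log 2 (atom_prob Q (\<lambda>z. (B z, C z)) z))"
    unfolding cmi_eq_expectation[OF fin]
    by (rule integral_cong_AE) (auto simp: AE_measure_pmf_iff cmi_density_def log_mult log_divide atom_prob_neq_0)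
  then show ?thesis by (simp add: ent_def int)
qed

text \<open>The additive form of the product identity: with it and \<open>cmi_eq_ent\<close>, the
  rate identities below become linear arithmetic in entropies.\<close>

lemma markov3_ent:
  assumes fin: "finite (set_pmf Q)" and M: "markov3 Q A B C"
  shows "ent Q (\<lambda>z. (A z, B z, C z)) + ent Q B = ent Q (\<lambda>z. (A z, B z)) + ent Q (\<lambda>z. (B z, C z))"
proof -
  have int: "integrable (measure_pmf Q) h" for h :: "'a \<Rightarrow> real" using fin by (rule integrable_measure_pmf_finite)
  have "measure_pmf.expectation Q (\<lambda>z. log 2 (atom_prob Q (\<lambda>z. (A z, B z, C z)) z) + log 2 (atom_prob Q B z)) =
    measure_pmf.expectation Q (\<lambda>z. log 2 (atom_prob Q (\<lambda>z. (A z, B z)) z) + log 2 (atom_prob Q (\<lambda>z. (B z, C z)) z))"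
  proof (rule integral_cong_AE)
    show "AE z in measure_pmf Q. log 2 (atom_prob Q (\<lambda>z. (A z, B z, C z)) z) + log 2 (atom_prob Q B z) =
       log 2 (atom_prob Q (\<lambda>z. (A z, B z)) z) + log 2 (atom_prob Q (\<lambda>z. (B z, C z)) z)"
    proof (rule AE_pmfI)
      fix z assume z: "z \<in> set_pmf Q"
      have "log 2 (atom_prob Q (\<lambda>z. (A z, B z, C z)) z * atom_prob Q B z) =
          log 2 (atom_prob Q (\<lambda>z. (A z, B z)) z * atom_prob Q (\<lambda>z. (B z, C z)) z)"
        using markov3_atom[OF M, of z] by simp
      then show "log 2 (atom_prob Q (\<lambda>z. (A z, B z, C z)) z) + log 2 (atom_prob Q B z) =
          log 2 (atom_prob Q (\<lambda>z. (A z, B z)) z) + log 2 (atom_prob Q (\<lambda>z. (B z, C z)) z)"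
        using z by (simp add: log_mult atom_prob_neq_0)
    qed
  qed auto
  then show ?thesis by (simp add: ent_def int)
qed

text \<open>The variables live on an arbitrary outcome space, because the same facts are later
  applied to reweighted distributions, relabelled variables and a product space.\<close>

locale markov_vars =
  fixes Q :: "'o pmf" and X :: "'o \<Rightarrow> 'x" and Y :: "'o \<Rightarrow> 'y" and T :: "'o \<Rightarrow> 't" and U :: "'o \<Rightarrow> 'u"
    and V :: "'o \<Rightarrow> 'v" and W :: "'o \<Rightarrow> 'w"
  assumes finQ: "finite (set_pmf Q)"
    and TUXY: "markov4 Q T U X Y"
    and VXTUYW: "markov4 Q V (\<lambda>s. (X s, T s)) (\<lambda>s. (U s, Y s)) W"
begin

lemma markov_T: "markov3 Q T X (\<lambda>z. g (X z) (Y z))"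
  by (rule markov3_gen[OF finQ TUXY[unfolded markov4_def, THEN conjunct2], where f = "\<lambda>x _. fst x"]) auto

text \<open>Weak union moves T from the left of the chain (U, T) - X - Y into the middle.\<close>

lemma markov_U: "markov3 Q U (\<lambda>z. (X z, T z)) (\<lambda>z. g (X z) (T z) (Y z))"
proof -
  have "markov3 Q (\<lambda>z. (U z, T z)) X Y"
    by (rule markov3_gen[OF finQ TUXY[unfolded markov4_def, THEN conjunct2], where f = "\<lambda>x _. (snd x, fst x)" and g = "\<lambda>_ y. y"]) auto
  from markov3_weak_union[OF finQ this] have "markov3 Q U (\<lambda>z. (X z, T z)) Y" .
  from markov3_gen[OF finQ this, where f = "\<lambda>x _. x" and g = "\<lambda>a y. g (fst a) (snd a) y"] show ?thesis by auto
qed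

lemma markov_XUY_T: "markov3 Q X (\<lambda>z. (U z, Y z)) T"
  by (rule markov3_weak_union[OF finQ], rule markov3_sym, rule TUXY[unfolded markov4_def, THEN conjunct1])

lemma markov_V: "markov3 Q V (\<lambda>z. (X z, T z)) (\<lambda>z. g (X z) (T z) (U z) (Y z) (W z))"
  by (rule markov3_gen[OF finQ VXTUYW[unfolded markov4_def, THEN conjunct1], where f = "\<lambda>x _. x"
     and g = "\<lambda>(x, t) ((u, y), w). g x t u y w"]) auto

lemma markov_W: "markov3 Q W (\<lambda>z. (U z, Y z)) (\<lambda>z. g (U z) (Y z) (V z) (X z) (T z))"
  by (rule markov3_gen[OF finQ markov3_sym[OF VXTUYW[unfolded markov4_def, THEN conjunct2]], where f = "\<lambda>x _. x"
     and g = "\<lambda>(u, y) (v, x, t). g u y v x t"]) auto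

definition sum_rate :: real where
  "sum_rate = mi Q (\<lambda>s. (X s, Y s)) (\<lambda>s. (V s, T s, W s)) + cmi Q U W (\<lambda>s. (V s, X s, T s, Y s))"

text \<open>Entropies of tuples unfold to measures of conjunctions of equations; sorting the
  conjuncts makes the entropies of reordered or regrouped tuples syntactically equal.\<close>

lemmas ent_normal_form = ent_def atom_prob_def conj_ac

text \<open>Chain rule: sending T and then U to transmitter Y costs I(T,U;X|Y), and T tells nothing
  more about X once (U, Y) is known, since X - (U, Y) - T is Markov.\<close>

lemma rate_0: "cmi Q T X Y + cmi Q U (\<lambda>z. (X z, T z)) (\<lambda>z. (Y z, T z)) = cmi Q X U Y"
  using markov3_ent[OF finQ markov_XUY_T] unfolding cmi_eq_ent[OF finQ] by (simp add: ent_normal_form)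

lemma rate_V: "cmi Q V (\<lambda>z. (X z, T z)) (\<lambda>z. (T z, W z)) = cmi Q V X (\<lambda>z. (T z, W z))"
  unfolding cmi_eq_ent[OF finQ] by (simp add: ent_normal_form)

lemma rate_W: "cmi Q W (\<lambda>z. (U z, Y z)) (\<lambda>z. (T z, V z)) = cmi Q (\<lambda>z. (U z, Y z)) W (\<lambda>z. (V z, T z))"
  unfolding cmi_eq_ent[OF finQ] by (simp add: ent_normal_form)

lemma rate_const: "cmi Q W (\<lambda>z. (U z, Y z)) (\<lambda>z. (T z, c)) = cmi Q W (\<lambda>z. (U z, Y z)) T"
    "cmi Q V (\<lambda>z. (X z, T z)) (\<lambda>z. (T z, c')) = cmi Q V (\<lambda>z. (X z, T z)) T"
  unfolding cmi_eq_ent[OF finQ] by (simp_all add: ent_normal_form)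

lemma ent_unit: "ent Q (\<lambda>z. ()) = 0"
  by (simp add: ent_normal_form)

text \<open>Total cost of the decoding order T, W, V. With the order T, V, W in the next lemma it
  shows that both corners lie on the same sum-rate line.\<close>

lemma sum_rate_A: "mi Q T X + cmi Q W (\<lambda>z. (U z, Y z)) T + cmi Q V X (\<lambda>z. (T z, W z)) = sum_rate"
  using markov3_ent[OF finQ markov_W[of "\<lambda>u y v x t. (v, x, t)"]] markov3_ent[OF finQ markov_W[of "\<lambda>u y v x t. t"]]
    markov3_ent[OF finQ markov_V[of "\<lambda>x t u y w. w"]] markov3_ent[OF finQ markov_V[of "\<lambda>x t u y w. y"]]
    markov3_ent[OF finQ markov_T[of "\<lambda>x y. y"]] ent_unit
  unfolding sum_rate_def mi_def cmi_eq_ent[OF finQ] by (simp add: ent_normal_form)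

lemma sum_rate_B: "mi Q T X + cmi Q V (\<lambda>z. (X z, T z)) T + cmi Q (\<lambda>z. (U z, Y z)) W (\<lambda>z. (V z, T z)) = sum_rate"
  using markov3_ent[OF finQ markov_W[of "\<lambda>u y v x t. (v, x, t)"]] markov3_ent[OF finQ markov_W[of "\<lambda>u y v x t. (t, v)"]]
    markov3_ent[OF finQ markov_V[of "\<lambda>x t u y w. y"]]
    markov3_ent[OF finQ markov_T[of "\<lambda>x y. y"]] ent_unit
  unfolding sum_rate_def mi_def cmi_eq_ent[OF finQ] by (simp add: ent_normal_form)

text \<open>The difference is I(T;X) + I(W;V|T). This inequality keeps the three rate constraints
  from being tight together in the bound on T.\<close>

lemma sum_rate_ge: "cmi Q V X (\<lambda>z. (T z, W z)) + cmi Q (\<lambda>z. (U z, Y z)) W (\<lambda>z. (V z, T z)) \<le> sum_rate"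
proof -
  have "cmi Q W (\<lambda>z. (U z, Y z)) T = cmi Q (\<lambda>z. (U z, Y z)) W (\<lambda>z. (V z, T z)) + cmi Q W V T"
    using markov3_ent[OF finQ markov_W[of "\<lambda>u y v x t. (t, v)"]] markov3_ent[OF finQ markov_W[of "\<lambda>u y v x t. t"]]
    unfolding cmi_eq_ent[OF finQ] by (simp add: ent_normal_form)
  moreover have "mi Q T X \<ge> 0" "cmi Q W V T \<ge> 0" using finQ by (simp_all add: mi_def cmi_nonneg)
  ultimately show ?thesis using sum_rate_A by linarith
qed

end

section \<open>Recovering the joint law from its conditional kernels\<close>

lemma bind_cond_kernel_step:
  assumes "markov3 Q S A C" "\<And>z. z \<in> set_pmf Q \<Longrightarrow> A z = h (C z)"
  shows "bind_pmf (map_pmf C Q) (\<lambda>c. bind_pmf (cond_kernel Q S A (h c)) (F c)) = bind_pmf (map_pmf (\<lambda>z. (C z, S z)) Q) (\<lambda>(c, s). F c s)"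
proof -
  have "bind_pmf (map_pmf (\<lambda>z. (C z, S z)) Q) (\<lambda>(c, s). F c s) =
    bind_pmf (bind_pmf (map_pmf C Q) (\<lambda>c. map_pmf (Pair c) (cond_kernel Q S A (h c)))) (\<lambda>(c, s). F c s)"
    by (subst bind_cond_kernel[of Q S A C h]) (use assms in auto)
  also have "\<dots> = bind_pmf (map_pmf C Q) (\<lambda>c. bind_pmf (cond_kernel Q S A (h c)) (F c))"
    by (simp only: bind_assoc_pmf bind_map_pmf prod.case)
  finally show ?thesis ..
qed

lemma cond_kernel_unit: "cond_kernel Q S (\<lambda>_. ()) () = map_pmf S Q"
proof (rule pmf_eqI)
  fix s
  have "() \<in> (\<lambda>_. ()) ` set_pmf Q" using set_pmf_not_empty[of Q] by auto
  from pmf_cond_kernel[OF this] show "pmf (cond_kernel Q S (\<lambda>_. ()) ()) s = pmf (map_pmf S Q) s"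
    by (simp add: pmf_map_measure)
qed

text \<open>Coordinates are attached one at a time; at each step a Markov chain says that the
  argument of the kernel carries everything the earlier coordinates tell about the new one.\<close>

lemma (in markov_vars) joint_cond_kernel:
  "coding_kernels.joint (map_pmf (\<lambda>z. (X z, Y z)) Q) (cond_kernel Q T X) (cond_kernel Q U (\<lambda>z. (X z, T z)))
     (cond_kernel Q V (\<lambda>z. (X z, T z))) (cond_kernel Q W (\<lambda>z. (U z, Y z))) = map_pmf (\<lambda>z. (X z, Y z, T z, U z, V z, W z)) Q"
proof -
  let ?KT = "cond_kernel Q T X" and ?KU = "cond_kernel Q U (\<lambda>z. (X z, T z))"
  let ?KV = "cond_kernel Q V (\<lambda>z. (X z, T z))" and ?KW = "cond_kernel Q W (\<lambda>z. (U z, Y z))"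
  have "coding_kernels.joint (map_pmf (\<lambda>z. (X z, Y z)) Q) ?KT ?KU ?KV ?KW =
    bind_pmf (map_pmf (\<lambda>z. (X z, Y z)) Q) (\<lambda>c. bind_pmf (?KT (fst c)) (\<lambda>t.
      do {u \<leftarrow> ?KU (fst c, t); v \<leftarrow> ?KV (fst c, t); w \<leftarrow> ?KW (u, snd c); return_pmf (fst c, snd c, t, u, v, w)}))"
    by (simp add: coding_kernels.joint_def split_def)
  also have "\<dots> = bind_pmf (map_pmf (\<lambda>z. ((X z, Y z), T z)) Q) (\<lambda>c. bind_pmf (?KU (fst (fst c), snd c)) (\<lambda>u.
      do {v \<leftarrow> ?KV (fst (fst c), snd c); w \<leftarrow> ?KW (u, snd (fst c)); return_pmf (fst (fst c), snd (fst c), snd c, u, v, w)}))"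
    by (subst bind_cond_kernel_step[where h = fst]) (auto intro: markov_T simp: split_def)
  also have "\<dots> = bind_pmf (map_pmf (\<lambda>z. (((X z, Y z), T z), U z)) Q) (\<lambda>c. bind_pmf (?KV (fst (fst (fst c)), snd (fst c))) (\<lambda>v.
      do {w \<leftarrow> ?KW (snd c, snd (fst (fst c))); return_pmf (fst (fst (fst c)), snd (fst (fst c)), snd (fst c), snd c, v, w)}))"
    by (subst bind_cond_kernel_step[where h = "\<lambda>c. (fst (fst c), snd c)"]) (auto intro: markov_U simp: split_def)
  also have "\<dots> = bind_pmf (map_pmf (\<lambda>z. ((((X z, Y z), T z), U z), V z)) Q) (\<lambda>c. bind_pmf (?KW (snd (fst c), snd (fst (fst (fst c))))) (\<lambda>w.
      return_pmf (fst (fst (fst (fst c))), snd (fst (fst (fst c))), snd (fst (fst c)), snd (fst c), snd c, w)))"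
    by (subst bind_cond_kernel_step[where h = "\<lambda>c. (fst (fst (fst c)), snd (fst c))"])
       (auto intro: markov_V[of "\<lambda>x t u y w. (((x, y), t), u)"] simp: split_def)
  also have "\<dots> = bind_pmf (map_pmf (\<lambda>z. (((((X z, Y z), T z), U z), V z), W z)) Q) (\<lambda>c.
      return_pmf (fst (fst (fst (fst (fst c)))), snd (fst (fst (fst (fst c)))), snd (fst (fst (fst c))), snd (fst (fst c)), snd (fst c), snd c))"
    by (subst bind_cond_kernel_step[where h = "\<lambda>c. (snd (fst c), snd (fst (fst (fst c))))"])
       (auto intro: markov_W[of "\<lambda>u y v x t. ((((x, y), t), u), v)"] simp: split_def)
  also have "\<dots> = map_pmf (\<lambda>z. (X z, Y z, T z, U z, V z, W z)) Q"
    unfolding bind_map_pmf fst_conv snd_conv by (simp only: map_pmf_def)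
  finally show ?thesis .
qed

text \<open>All encoding and decoding kernels are taken to be conditional laws of Q, so the
  thresholds of the five races become conditional mutual informations of Q.\<close>

lemma corner_rate_achievable:
  fixes Q :: "('x::finite \<times> 'y::finite \<times> 't \<times> 'u \<times> 'v \<times> 'w) pmf"
    and f1 :: "'x \<Rightarrow> 'y \<Rightarrow> 'f1::finite" and f2 :: "'x \<Rightarrow> 'y \<Rightarrow> 'f2::finite"
  assumes MV: "markov_vars Q oX oY oT oU oV oW" and p: "map_pmf (\<lambda>s. (oX s, oY s)) Q = p"
    and cV: "\<And>w. w \<in> oW ` set_pmf Q \<Longrightarrow> cV w \<in> oW ` set_pmf Q" and cW: "\<And>v. v \<in> oV ` set_pmf Q \<Longrightarrow> cW v \<in> oV ` set_pmf Q"
    and seq: "(\<forall>v v'. cW v = cW v') \<or> (\<forall>w w'. cV w = cV w')"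
    and R0: "R0 > cmi Q oX oU oY"
    and RXY: "(cmi Q oV (\<lambda>s. (oX s, oT s)) (\<lambda>s. (oT s, cV (oW s))) < RX \<and> mi Q oT oX + cmi Q oW (\<lambda>s. (oU s, oY s)) (\<lambda>s. (oT s, cW (oV s))) < RY) \<or>
       (mi Q oT oX + cmi Q oV (\<lambda>s. (oX s, oT s)) (\<lambda>s. (oT s, cV (oW s))) < RX \<and> cmi Q oW (\<lambda>s. (oU s, oY s)) (\<lambda>s. (oT s, cW (oV s))) < RY)"
    and D1: "measure_pmf.expectation Q (\<lambda>s. d1 (f1 (oX s) (oY s)) (g1 (oV s) (oT s) (oW s))) \<le> D1"
    and D2: "measure_pmf.expectation Q (\<lambda>s. d2 (f2 (oX s) (oY s)) (g2 (oV s) (oT s) (oW s))) \<le> D2"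
    and D0: "D1 \<ge> 0" "D2 \<ge> 0"
  shows "achievable p f1 f2 d1 d2 D1 D2 R0 RX RY"
proof -
  interpret markov_vars Q oX oY oT oU oV oW by (rule MV)
  define rV where "rV = cmi Q oV (\<lambda>s. (oX s, oT s)) (\<lambda>s. (oT s, cV (oW s)))"
  define rW where "rW = cmi Q oW (\<lambda>s. (oU s, oY s)) (\<lambda>s. (oT s, cW (oV s)))"
  define rT where "rT = mi Q oT oX"
  define r0a where "r0a = cmi Q oT oX oY"
  define r0b where "r0b = cmi Q oU (\<lambda>s. (oX s, oT s)) (\<lambda>s. (oY s, oT s))"
  have nn: "rV \<ge> 0" "rW \<ge> 0" "rT \<ge> 0" "r0a \<ge> 0" "r0b \<ge> 0"
    unfolding rV_def rW_def rT_def r0a_def r0b_def mi_def using finQ by (rule cmi_nonneg)+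
  define \<delta> where "\<delta> = (R0 - r0a - r0b) / 2"
  have \<delta>: "\<delta> > 0" using R0 rate_0 by (simp add: \<delta>_def r0a_def r0b_def)
  \<comment> \<open>The strict slack of the link that also carries T is halved between its two
    messages; the other link uses its full rate.\<close>
  obtain \<rho>T \<rho>V \<rho>W where \<rho>: "\<rho>T > rT" "\<rho>V > rV" "\<rho>W > rW" "(\<rho>V \<le> RX \<and> \<rho>T + \<rho>W \<le> RY) \<or> (\<rho>T + \<rho>V \<le> RX \<and> \<rho>W \<le> RY)"
  proof (cases "rV < RX \<and> rT + rW < RY")
    case True
    then show ?thesis using that[of "rT + (RY - rT - rW) / 2" RX "rW + (RY - rT - rW) / 2"] by (simp add: field_simps)
  next
    case False
    then have "rT + rV < RX" "rW < RY" using RXY by (auto simp: rT_def rV_def rW_def)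
    then show ?thesis using that[of "rT + (RX - rT - rV) / 2" "rV + (RX - rT - rV) / 2" RY] by (simp add: field_simps)
  qed
  have J: "Q = coding_kernels.joint p (cond_kernel Q oT oX) (cond_kernel Q oU (\<lambda>z. (oX z, oT z)))
     (cond_kernel Q oV (\<lambda>z. (oX z, oT z))) (cond_kernel Q oW (\<lambda>z. (oU z, oY z)))"
    unfolding p[symmetric] joint_cond_kernel by (rule map_pmf_idI[symmetric]) auto
  have e: "measure_pmf.expectation Q (\<lambda>z. log 2 (pmf (cond_kernel Q S A (A z)) (S z) / pmf (cond_kernel Q S B (B z)) (S z))) < r"
    if "markov3 Q S A B" "cmi Q S A B < r" for S A B r
    using that expectation_kernel_ratio[OF finQ that(1)] by simp
  have e': "measure_pmf.expectation Q (\<lambda>z. log 2 (pmf (cond_kernel Q oT oX (oX z)) (oT z) / pmf (map_pmf oT Q) (oT z))) < \<rho>T"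
    by (rule e[OF markov_T[of "\<lambda>_ _. ()"], unfolded cond_kernel_unit]) (use \<rho>(1) in \<open>simp only: rT_def mi_def\<close>)
  have pos: "pmf (cond_kernel Q S A (A z)) (S z) > 0" if "z \<in> set_pmf Q" for S A z
    unfolding pmf_cond_kernel_atom[OF that] by (intro divide_pos_pos atom_prob_pos[OF that])
  have scheme: "coding_scheme p (cond_kernel Q oT oX) (cond_kernel Q oU (\<lambda>z. (oX z, oT z))) (cond_kernel Q oV (\<lambda>z. (oX z, oT z)))
      (cond_kernel Q oW (\<lambda>z. (oU z, oY z))) (cond_kernel Q oT oY) (map_pmf oT Q) (cond_kernel Q oU (\<lambda>z. (oY z, oT z)))
      (cond_kernel Q oV (\<lambda>z. (oT z, cV (oW z)))) (cond_kernel Q oW (\<lambda>z. (oT z, cW (oV z)))) cV cW UNIV UNIV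
      (oT ` set_pmf Q) (oU ` set_pmf Q) (oV ` set_pmf Q) (oW ` set_pmf Q)"
    by (unfold_locales; (rule set_cond_kernel | erule cV | erule cW | (rule finite_imageI, rule finQ) | rule finite
       | simp only: set_map_pmf order_refl subset_UNIV UNIV_Times_UNIV))
  have pos': "pmf (cond_kernel Q oT oY y) t > 0 \<and> pmf (map_pmf oT Q) t > 0 \<and> pmf (cond_kernel Q oU (\<lambda>z. (oY z, oT z)) (y, t)) u > 0 \<and>
      pmf (cond_kernel Q oV (\<lambda>z. (oT z, cV (oW z))) (t, cV w)) v > 0 \<and> pmf (cond_kernel Q oW (\<lambda>z. (oT z, cW (oV z))) (t, cW v)) w > 0"
    if z: "(x, y, t, u, v, w) \<in> set_pmf Q" for x y t u v w
      using pos[OF z, of oT oY] pos[OF z, of oU "\<lambda>z. (oY z, oT z)"] pos[OF z, of oV "\<lambda>z. (oT z, cV (oW z))"]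
        pos[OF z, of oW "\<lambda>z. (oT z, cW (oV z))"] z by (force simp: pmf_positive_iff)
  have e1: "measure_pmf.expectation Q (\<lambda>s. log 2 (pmf (cond_kernel Q oT oX (oX s)) (oT s) / pmf (cond_kernel Q oT oY (oY s)) (oT s))) < r0a + \<delta>"
      by (rule e[OF markov_T]) (use \<delta> in \<open>simp add: r0a_def\<close>)
  have e2: "measure_pmf.expectation Q (\<lambda>s. log 2 (pmf (cond_kernel Q oU (\<lambda>z. (oX z, oT z)) (oX s, oT s)) (oU s) /
       pmf (cond_kernel Q oU (\<lambda>z. (oY z, oT z)) (oY s, oT s)) (oU s))) < r0b + \<delta>"
      by (rule e[OF markov_U[of "\<lambda>x t y. (y, t)"]]) (use \<delta> in \<open>simp add: r0b_def\<close>)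
  have e3: "measure_pmf.expectation Q (\<lambda>s. log 2 (pmf (cond_kernel Q oV (\<lambda>z. (oX z, oT z)) (oX s, oT s)) (oV s) /
       pmf (cond_kernel Q oV (\<lambda>z. (oT z, cV (oW z))) (oT s, cV (oW s))) (oV s))) < \<rho>V"
      by (rule e[OF markov_V[of "\<lambda>x t u y w. (t, cV w)"]]) (use \<rho> in \<open>simp add: rV_def\<close>)
  have e4: "measure_pmf.expectation Q (\<lambda>s. log 2 (pmf (cond_kernel Q oW (\<lambda>z. (oU z, oY z)) (oU s, oY s)) (oW s) /
       pmf (cond_kernel Q oW (\<lambda>z. (oT z, cW (oV z))) (oT s, cW (oV s))) (oW s))) < \<rho>W"
      by (rule e[OF markov_W[of "\<lambda>u y v x t. (t, cW v)"]]) (use \<rho> in \<open>simp add: rW_def\<close>)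
  have e5: "r0a + \<delta> + (r0b + \<delta>) \<le> R0" by (simp add: \<delta>_def field_simps)
  show ?thesis
    by (rule corner_achievable[OF scheme J seq pos' e1 e' e2 e3 e4 _ _ _ _ _ e5 \<rho>(4) D1 D2 D0]) (use nn \<rho> \<delta> in auto)
qed

text \<open>The corners are (a, s - a) and (s - b, b). If RX > s - b or RY > s - a, both rates
  exceed those of one corner; otherwise the point lies above the segment between the corners and
  time sharing reaches it.\<close>

lemma achievable_pentagon:
  fixes p :: "('x::finite \<times> 'y::finite) pmf"
  assumes A: "\<And>rx ry. a < rx \<Longrightarrow> s - a < ry \<Longrightarrow> achievable p f1 f2 d1 d2 D1 D2 R0 rx ry"
    and B: "\<And>rx ry. s - b < rx \<Longrightarrow> b < ry \<Longrightarrow> achievable p f1 f2 d1 d2 D1 D2 R0 rx ry"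
    and ab: "a < RX" "b < RY" and S: "s < RX + RY"
  shows "achievable p f1 f2 d1 d2 D1 D2 R0 RX RY"
proof -
  consider "s - b < RX" | "s - a < RY" | "RX \<le> s - b" "RY \<le> s - a" by linarith
  then show ?thesis
  proof cases
    case 1 then show ?thesis using B ab by blast
  next
    case 2 then show ?thesis using A ab by blast
  next
    case 3
    \<comment> \<open>With the weight \<open>\<alpha>\<close> chosen below, the mixed rates are RX -
      \<eta> and s - RX + 3 \<eta>, so 4 \<eta> <= RX + RY - s suffices; 3 \<eta> <= RX - a gives
      \<alpha> < 1.\<close>
    define \<eta> where "\<eta> = min ((RX + RY - s) / 4) ((RX - a) / 3)"
    have "\<eta> \<le> (RX + RY - s) / 4" "\<eta> \<le> (RX - a) / 3"
      unfolding \<eta>_def by (rule min.cobounded1, rule min.cobounded2)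
    moreover have "(RX + RY - s) / 4 > 0" "(RX - a) / 3 > 0" using S ab by simp_all
    then have "\<eta> > 0" unfolding \<eta>_def by (simp only: min_less_iff_conj)
    ultimately have \<eta>: "\<eta> > 0" "4 * \<eta> \<le> RX + RY - s" "3 * \<eta> \<le> RX - a" by simp_all
    define L where "L = s - b - a"
    have L: "L > 0" using 3 ab by (simp add: L_def)
    define \<alpha> where "\<alpha> = (s - b - (RX - 2 * \<eta>)) / L"
    have \<alpha>L: "\<alpha> * L = s - b - (RX - 2 * \<eta>)" using L by (simp add: \<alpha>_def)
    have \<alpha>: "0 < \<alpha>" "\<alpha> < 1" using 3 \<eta> L by (auto simp: \<alpha>_def L_def divide_simps)
    show ?thesis
    proof (rule achievable_time_share[OF A B \<alpha>])
      show "a < a + \<eta>" "s - a < s - a + \<eta>" "s - b < s - b + \<eta>" "b < b + \<eta>" using \<eta> by auto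
      have "\<alpha> * (a + \<eta>) + (1 - \<alpha>) * (s - b + \<eta>) = s - b + \<eta> - \<alpha> * L" by (simp add: L_def algebra_simps)
      also have "\<dots> < RX" using \<alpha>L \<eta> by simp
      finally show "\<alpha> * (a + \<eta>) + (1 - \<alpha>) * (s - b + \<eta>) < RX" .
      have "\<alpha> * (s - a + \<eta>) + (1 - \<alpha>) * (b + \<eta>) = b + \<eta> + \<alpha> * L" by (simp add: L_def algebra_simps)
      also have "\<dots> = s - RX + 3 * \<eta>" using \<alpha>L by simp
      also have "\<dots> < RY" using \<eta> by simp
      finally show "\<alpha> * (s - a + \<eta>) + (1 - \<alpha>) * (b + \<eta>) < RY" .
    qed
  qed
qed

lemma inner_cond_achievable:
  fixes p :: "('x::finite \<times> 'y::finite) pmf"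
    and f1 :: "'x \<Rightarrow> 'y \<Rightarrow> 'f1::finite" and f2 :: "'x \<Rightarrow> 'y \<Rightarrow> 'f2::finite"
  assumes inner: "inner_cond p f1 f2 d1 d2 D1 D2 R0 RX RY Q g1 g2" and D0: "D1 \<ge> 0" "D2 \<ge> 0"
  shows "achievable p f1 f2 d1 d2 D1 D2 R0 RX RY"
proof -
  have MV: "markov_vars Q oX oY oT oU oV oW" and p: "map_pmf (\<lambda>s. (oX s, oY s)) Q = p"
    and D: "measure_pmf.expectation Q (\<lambda>s. d1 (f1 (oX s) (oY s)) (g1 (oV s) (oT s) (oW s))) \<le> D1"
       "measure_pmf.expectation Q (\<lambda>s. d2 (f2 (oX s) (oY s)) (g2 (oV s) (oT s) (oW s))) \<le> D2"
    and R0: "R0 > cmi Q oX oU oY" and RX: "RX > cmi Q oV oX (\<lambda>s. (oT s, oW s))"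
    and RY: "RY > cmi Q (\<lambda>s. (oU s, oY s)) oW (\<lambda>s. (oV s, oT s))"
    using inner unfolding inner_cond_def Let_def by (auto simp: markov_vars_def)
  interpret markov_vars Q oX oY oT oU oV oW by (rule MV)
  have S: "RX + RY > sum_rate" using inner unfolding inner_cond_def Let_def sum_rate_def by blast
  define a where "a = cmi Q oV oX (\<lambda>s. (oT s, oW s))"
  define b where "b = cmi Q (\<lambda>s. (oU s, oY s)) oW (\<lambda>s. (oV s, oT s))"
  have ab: "a < RX" "b < RY" unfolding a_def b_def by (rule RX, rule RY)
  \<comment> \<open>Values from the support keep the constant filters inside the alphabets of V and
    W.\<close>
  obtain v0 w0 where v0: "v0 \<in> oV ` set_pmf Q" and w0: "w0 \<in> oW ` set_pmf Q"
    using set_pmf_not_empty[of Q] by blast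
  have A: "achievable p f1 f2 d1 d2 D1 D2 R0 rx ry" if "a < rx" "sum_rate - a < ry" for rx ry
  proof -
    have "cmi Q oV (\<lambda>s. (oX s, oT s)) (\<lambda>s. (oT s, oW s)) < rx \<and> mi Q oT oX + cmi Q oW (\<lambda>s. (oU s, oY s)) (\<lambda>s. (oT s, v0)) < ry"
      unfolding rate_V rate_const a_def[symmetric] using that sum_rate_A[folded a_def] by linarith
    from corner_rate_achievable[where cV = "\<lambda>w. w" and cW = "\<lambda>_. v0", OF MV p _ _ _ R0 disjI1[OF this] D D0] v0 show ?thesis by blast
  qed
  have B: "achievable p f1 f2 d1 d2 D1 D2 R0 rx ry" if "sum_rate - b < rx" "b < ry" for rx ry
  proof -
    have "mi Q oT oX + cmi Q oV (\<lambda>s. (oX s, oT s)) (\<lambda>s. (oT s, w0)) < rx \<and> cmi Q oW (\<lambda>s. (oU s, oY s)) (\<lambda>s. (oT s, oV s)) < ry"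
      unfolding rate_W rate_const b_def[symmetric] using that sum_rate_B[folded b_def] by linarith
    from corner_rate_achievable[where cV = "\<lambda>_. w0" and cW = "\<lambda>v. v", OF MV p _ _ _ R0 disjI2[OF this] D D0] w0 show ?thesis by blast
  qed
  show ?thesis by (rule achievable_pentagon[OF A B ab S])
qed

section \<open>Support reduction\<close>

text \<open>Gaussian elimination, by induction on the equations: one with a nonzero coefficient at j
  is solved for the unknown j and substituted into the others.\<close>

lemma homogeneous_system_nontrivial:
  fixes c :: "'k \<Rightarrow> 'i \<Rightarrow> real"
  assumes "finite K" "finite I" "card K < card I"
  shows "\<exists>d. (\<exists>i\<in>I. d i \<noteq> 0) \<and> (\<forall>i. i \<notin> I \<longrightarrow> d i = 0) \<and> (\<forall>k\<in>K. (\<Sum>i\<in>I. c k i * d i) = 0)"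
  using assms
proof (induction K arbitrary: I c rule: finite_induct)
  case empty
  then obtain j where "j \<in> I" by fastforce
  then show ?case by (intro exI[of _ "\<lambda>i. if i = j then 1 else 0"]) auto
next
  case (insert k K)
  show ?case
  proof (cases "\<exists>j\<in>I. c k j \<noteq> 0")
    case False
    have "card K < card I" using insert.prems insert.hyps by simp
    from insert.IH[OF insert.prems(1) this, of c] False show ?thesis by (auto intro!: sum.neutral)
  next
    case True
    then obtain j where j: "j \<in> I" "c k j \<noteq> 0" by auto
    have "card K < card (I - {j})" using insert.prems insert.hyps j by simp
    from insert.IH[OF _ this, of "\<lambda>l i. c l i - c l j * c k i / c k j"] insert.prems(1) obtain d where
      d: "\<exists>i\<in>I - {j}. d i \<noteq> 0" "\<forall>i. i \<notin> I - {j} \<longrightarrow> d i = 0"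
        "\<forall>l\<in>K. (\<Sum>i\<in>I - {j}. (c l i - c l j * c k i / c k j) * d i) = 0" by auto
    define s where "s = (\<Sum>i\<in>I - {j}. c k i * d i)"
    define d' where "d' = d(j := - s / c k j)"
    have sum: "(\<Sum>i\<in>I. c l i * d' i) = c l j * (- s / c k j) + (\<Sum>i\<in>I - {j}. c l i * d i)" for l
      using j insert.prems(1) by (subst sum.remove[of I j]) (auto simp: d'_def intro!: sum.cong)
    have "(\<Sum>i\<in>I. c l i * d' i) = 0" if "l \<in> insert k K" for l
    proof (cases "l = k")
      case True
      then show ?thesis using j sum[of l] by (simp add: s_def)
    next
      case False
      then have "(\<Sum>i\<in>I - {j}. (c l i - c l j * c k i / c k j) * d i) = 0" using d(3) that by auto
      then have "(\<Sum>i\<in>I - {j}. c l i * d i) = (\<Sum>i\<in>I - {j}. c l j / c k j * (c k i * d i))"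
        by (simp add: left_diff_distrib sum_subtractf mult.assoc)
      also have "\<dots> = c l j / c k j * s" by (simp add: s_def sum_distrib_left)
      finally show ?thesis using sum[of l] by simp
    qed
    moreover have "\<exists>i\<in>I. d' i \<noteq> 0" using d(1) by (auto simp: d'_def)
    moreover have "\<forall>i. i \<notin> I \<longrightarrow> d' i = 0" using d(2) j by (auto simp: d'_def)
    ultimately show ?thesis by blast
  qed
qed

text \<open>Move along a direction that preserves all equalities and all tight inequalities and does not
  increase the objective, until a coordinate vanishes or a further inequality becomes tight.\<close>

lemma support_reduction:
  fixes q :: "'i \<Rightarrow> real" and e :: "'e \<Rightarrow> 'i \<Rightarrow> real" and a :: "'f \<Rightarrow> 'i \<Rightarrow> real"
  assumes fin: "finite I" "finite E" "finite F"
    and pos: "\<And>i. i \<in> I \<Longrightarrow> (\<Sum>k\<in>E. e k i) > 0"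
    and q: "\<And>i. i \<in> I \<Longrightarrow> q i \<ge> 0" and le: "\<And>k. k \<in> F \<Longrightarrow> (\<Sum>i\<in>I. a k i * q i) \<le> b k"
  shows "\<exists>q'. (\<forall>i\<in>I. q' i \<ge> 0) \<and> (\<forall>k\<in>E. (\<Sum>i\<in>I. e k i * q' i) = (\<Sum>i\<in>I. e k i * q i)) \<and>
    (\<forall>k\<in>F. (\<Sum>i\<in>I. a k i * q' i) \<le> b k) \<and> (\<Sum>i\<in>I. c i * q' i) \<le> (\<Sum>i\<in>I. c i * q i) \<and>
    card {i \<in> I. q' i \<noteq> 0} \<le> card E + card {k \<in> F. (\<Sum>i\<in>I. a k i * q' i) = b k}"
  using q le
proof (induction "card {i \<in> I. q i \<noteq> 0} + card {k \<in> F. (\<Sum>i\<in>I. a k i * q i) \<noteq> b k}" arbitrary: q rule: less_induct)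
  case (less q)
  define S where "S = {i \<in> I. q i \<noteq> 0}"
  define A where "A k = (\<Sum>i\<in>I. a k i * q i)" for k
  define Ti where "Ti = {k \<in> F. A k = b k}"
  show ?case
  proof (cases "card S \<le> card E + card Ti")
    case True
    then show ?thesis using less.prems by (intro exI[of _ q]) (auto simp: S_def Ti_def A_def)
  next
    case False
    have finS: "finite S" "finite Ti" using fin by (auto simp: S_def Ti_def)
    have "card (Inl ` E \<union> Inr ` Ti) = card E + card Ti"
      using fin finS by (subst card_Un_disjoint) (auto simp: card_image)
    then have lt: "card (Inl ` E \<union> Inr ` Ti :: ('e + 'f) set) < card S" using False by simp
    from homogeneous_system_nontrivial[of "Inl ` E \<union> Inr ` Ti" S "case_sum e a"] lt fin finS
    obtain d0 where "\<exists>i\<in>S. d0 i \<noteq> 0" "\<forall>i. i \<notin> S \<longrightarrow> d0 i = 0"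
      and sys: "\<forall>k\<in>Inl ` E \<union> Inr ` Ti. (\<Sum>i\<in>S. case_sum e a k i * d0 i) = 0" by blast
    then have d0: "\<exists>i\<in>S. d0 i \<noteq> 0" "\<forall>i. i \<notin> S \<longrightarrow> d0 i = 0" "\<forall>k\<in>E. (\<Sum>i\<in>S. e k i * d0 i) = 0" "\<forall>k\<in>Ti. (\<Sum>i\<in>S. a k i * d0 i) = 0"
      using sys[rule_format, of "Inl _"] sys[rule_format, of "Inr _"] by auto
    define d where "d = (if (\<Sum>i\<in>I. c i * d0 i) \<le> 0 then d0 else (\<lambda>i. - d0 i))"
    have "S \<subseteq> I" by (auto simp: S_def)
    have toI: "(\<Sum>i\<in>I. h i * d0 i) = (\<Sum>i\<in>S. h i * d0 i)" for h
      using fin d0(2) by (intro sum.mono_neutral_right) (auto simp: S_def)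
    have d: "\<exists>i\<in>I. d i \<noteq> 0" "\<And>i. i \<notin> S \<Longrightarrow> d i = 0" "\<And>k. k \<in> E \<Longrightarrow> (\<Sum>i\<in>I. e k i * d i) = 0"
      "\<And>k. k \<in> Ti \<Longrightarrow> (\<Sum>i\<in>I. a k i * d i) = 0" "(\<Sum>i\<in>I. c i * d i) \<le> 0"
      using d0 \<open>S \<subseteq> I\<close> by (auto simp: d_def toI sum_negf)
    \<comment> \<open>By \<open>pos\<close> the equality functionals add up to one that is strictly
      positive on nonzero nonnegative vectors. A nonzero direction on which all of them vanish
      therefore has a negative entry, and the motion along it is bounded.\<close>
    have neg: "\<exists>i\<in>I. d i < 0"
    proof (rule ccontr)
      assume "\<not> ?thesis"
      then have nn: "\<And>i. i \<in> I \<Longrightarrow> d i \<ge> 0" by (simp add: not_less)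
      have "(\<Sum>i\<in>I. (\<Sum>k\<in>E. e k i) * d i) = (\<Sum>k\<in>E. \<Sum>i\<in>I. e k i * d i)"
        unfolding sum_distrib_right by (rule sum.swap)
      also have "\<dots> = 0" using d(3) by simp
      finally have "(\<Sum>i\<in>I. (\<Sum>k\<in>E. e k i) * d i) = 0" .
      then have "\<forall>i\<in>I. (\<Sum>k\<in>E. e k i) * d i = 0"
        using fin nn pos by (subst (asm) sum_nonneg_eq_0_iff) (auto simp: less_imp_le)
      then have "\<forall>i\<in>I. d i = 0" using pos by (metis less_irrefl mult_eq_0_iff)
      then show False using d(1) by auto
    qed
    define Ad where "Ad k = (\<Sum>i\<in>I. a k i * d i)" for k
    define N where "N = {i \<in> I. d i < 0}"
    define P where "P = {k \<in> F. Ad k > 0}"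
    \<comment> \<open>Step lengths at which a shrinking coordinate reaches 0 or a growing functional
      reaches its bound. The least of them preserves feasibility and strictly decreases the
      induction measure.\<close>
    define H where "H = (\<lambda>i. - q i / d i) ` N \<union> (\<lambda>k. (b k - A k) / Ad k) ` P"
    define s where "s = Min H"
    have H: "finite H" "H \<noteq> {}" using fin neg by (auto simp: H_def N_def P_def)
    have sH: "s \<in> H" and smin: "\<And>h. h \<in> H \<Longrightarrow> s \<le> h" using H by (auto simp: s_def)
    have Hnn: "h \<ge> 0" if "h \<in> H" for h
      using that less.prems by (auto simp: H_def N_def P_def A_def divide_nonneg_neg)
    have s0: "s \<ge> 0" using Hnn sH by auto
    define q' where "q' i = q i + s * d i" for i
    have sum': "(\<Sum>i\<in>I. h i * q' i) = (\<Sum>i\<in>I. h i * q i) + s * (\<Sum>i\<in>I. h i * d i)" for h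
      by (simp add: q'_def algebra_simps sum.distrib sum_distrib_left)
    have q'0: "q' i \<ge> 0" if i: "i \<in> I" for i
    proof (cases "d i < 0")
      case True
      then have "s \<le> - q i / d i" using i by (intro smin) (auto simp: H_def N_def)
      then show ?thesis using True by (simp add: q'_def field_simps)
    qed (use s0 less.prems(1)[OF i] in \<open>simp add: q'_def\<close>)
    have A': "(\<Sum>i\<in>I. a k i * q' i) \<le> b k" if k: "k \<in> F" for k
    proof (cases "Ad k > 0")
      case True
      then have "s \<le> (b k - A k) / Ad k" using k by (intro smin) (auto simp: H_def P_def)
      then have "A k + s * Ad k \<le> b k" using True by (simp add: field_simps)
      then show ?thesis by (simp add: sum' A_def Ad_def)
    next
      case False
      then have "s * Ad k \<le> 0" using s0 by (simp add: mult_nonneg_nonpos)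
      then show ?thesis using less.prems(2)[OF k] by (simp add: sum' Ad_def)
    qed
    have supp: "{i \<in> I. q' i \<noteq> 0} \<subseteq> S" using d(2) by (auto simp: q'_def S_def)
    have tight: "{k \<in> F. (\<Sum>i\<in>I. a k i * q' i) \<noteq> b k} \<subseteq> {k \<in> F. A k \<noteq> b k}"
      using d(4) by (auto simp: sum' A_def[symmetric] Ti_def)
    have fins: "finite S" "finite {k \<in> F. A k \<noteq> b k}" using fin by (auto simp: S_def)
    have "card {i \<in> I. q' i \<noteq> 0} + card {k \<in> F. (\<Sum>i\<in>I. a k i * q' i) \<noteq> b k} < card S + card {k \<in> F. A k \<noteq> b k}"
      using sH unfolding H_def
    proof
      assume "s \<in> (\<lambda>i. - q i / d i) ` N"
      then obtain i where i: "i \<in> N" "s = - q i / d i" by auto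
      then have "q' i = 0" by (auto simp: q'_def N_def)
      moreover have "i \<in> S" using i d(2)[of i] by (auto simp: N_def)
      ultimately have "{i \<in> I. q' i \<noteq> 0} \<subset> S" using supp by auto
      then show ?thesis using tight fins by (intro add_less_le_mono psubset_card_mono card_mono)
    next
      assume "s \<in> (\<lambda>k. (b k - A k) / Ad k) ` P"
      then obtain k where k: "k \<in> P" "s = (b k - A k) / Ad k" by auto
      then have "(\<Sum>i\<in>I. a k i * q' i) = b k" by (auto simp: sum' A_def[symmetric] Ad_def[symmetric] P_def)
      moreover have "A k \<noteq> b k" using k d(4)[of k] by (auto simp: P_def Ti_def Ad_def)
      moreover have "k \<in> F" using k by (simp add: P_def)
      ultimately have "{k \<in> F. (\<Sum>i\<in>I. a k i * q' i) \<noteq> b k} \<subset> {k \<in> F. A k \<noteq> b k}" using tight by blast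
      then show ?thesis using supp fins by (intro add_le_less_mono psubset_card_mono card_mono)
    qed
    from less.hyps[OF this[unfolded S_def A_def] q'0 A'] obtain q'' where
      q'': "\<forall>i\<in>I. q'' i \<ge> 0" "\<forall>k\<in>E. (\<Sum>i\<in>I. e k i * q'' i) = (\<Sum>i\<in>I. e k i * q' i)"
        "\<forall>k\<in>F. (\<Sum>i\<in>I. a k i * q'' i) \<le> b k" "(\<Sum>i\<in>I. c i * q'' i) \<le> (\<Sum>i\<in>I. c i * q' i)"
        "card {i \<in> I. q'' i \<noteq> 0} \<le> card E + card {k \<in> F. (\<Sum>i\<in>I. a k i * q'' i) = b k}" by auto
    have "(\<Sum>i\<in>I. c i * q' i) \<le> (\<Sum>i\<in>I. c i * q i)" using s0 d(5) by (simp add: sum' mult_nonneg_nonpos)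
    with q'' d(3) show ?thesis by (intro exI[of _ q'']) (auto simp: sum')
  qed
qed

section \<open>Reweighted distributions\<close>

definition reweight :: "'o pmf \<Rightarrow> ('o \<Rightarrow> real) \<Rightarrow> 'o pmf" where
  "reweight Q r = embed_pmf (\<lambda>z. r z * pmf Q z)"

locale reweighting =
  fixes Q :: "'o pmf" and r :: "'o \<Rightarrow> real"
  assumes fin: "finite (set_pmf Q)" and nonneg: "\<And>z. z \<in> set_pmf Q \<Longrightarrow> r z \<ge> 0"
    and total: "measure_pmf.expectation Q r = 1"
begin

abbreviation Q' :: "'o pmf" where "Q' \<equiv> reweight Q r"

lemma pmf_Q': "pmf Q' z = r z * pmf Q z"
  unfolding reweight_def
proof (rule pmf_embed_pmf)
  have nn: "0 \<le> r z * pmf Q z" for z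
    using nonneg[of z] by (cases "z \<in> set_pmf Q") (auto simp: set_pmf_iff)
  then show "0 \<le> r z * pmf Q z" for z .
  have "(\<integral>\<^sup>+z. ennreal (r z * pmf Q z) \<partial>count_space UNIV) = (\<Sum>z\<in>set_pmf Q. ennreal (r z * pmf Q z))"
    by (rule nn_integral_count_space'[OF fin]) (auto simp: set_pmf_iff)
  also have "\<dots> = ennreal (\<Sum>z\<in>set_pmf Q. r z * pmf Q z)" using nn by (intro sum_ennreal) auto
  also have "(\<Sum>z\<in>set_pmf Q. r z * pmf Q z) = 1"
    using total fin by (simp add: integral_measure_pmf_real[where A = "set_pmf Q"])
  finally show "(\<integral>\<^sup>+z. ennreal (r z * pmf Q z) \<partial>count_space UNIV) = 1" by simp
qed

lemma set_Q': "set_pmf Q' = {z \<in> set_pmf Q. r z \<noteq> 0}"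
  by (auto simp: set_pmf_eq pmf_Q')

lemma finite_Q': "finite (set_pmf Q')"
  using fin by (simp add: set_Q')

lemma expectation_Q': "measure_pmf.expectation Q' f = measure_pmf.expectation Q (\<lambda>z. r z * f z)"
proof -
  have "measure_pmf.expectation Q' f = (\<Sum>z\<in>set_pmf Q. f z * pmf Q' z)"
    by (rule integral_measure_pmf_real[OF fin]) (auto simp: set_Q')
  also have "\<dots> = (\<Sum>z\<in>set_pmf Q. (r z * f z) * pmf Q z)" by (simp add: pmf_Q' mult_ac)
  also have "\<dots> = measure_pmf.expectation Q (\<lambda>z. r z * f z)"
    by (rule integral_measure_pmf_real[OF fin, symmetric]) auto
  finally show ?thesis .
qed

lemma measure_Q': "measure Q' A = (\<Sum>z\<in>set_pmf Q \<inter> A. r z * pmf Q z)"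
proof -
  have "measure Q' A = measure_pmf.expectation Q' (indicator A)" by simp
  also have "\<dots> = (\<Sum>z\<in>set_pmf Q. r z * indicator A z * pmf Q z)"
    unfolding expectation_Q' by (rule integral_measure_pmf_real[OF fin]) auto
  also have "\<dots> = (\<Sum>z\<in>set_pmf Q \<inter> A. r z * pmf Q z)"
    using fin by (intro sum.mono_neutral_cong_right) (auto simp: indicator_def)
  finally show ?thesis .
qed

lemma measure_Q_sum: "measure Q A = (\<Sum>z\<in>set_pmf Q \<inter> A. pmf Q z)"
proof -
  have "measure Q A = measure Q (set_pmf Q \<inter> A)" by (simp add: measure_Int_set_pmf Int_commute)
  also have "\<dots> = (\<Sum>z\<in>set_pmf Q \<inter> A. pmf Q z)" using fin by (intro measure_measure_pmf_finite) auto
  finally show ?thesis .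
qed

lemma measure_Q'_scale: "(\<And>z. z \<in> set_pmf Q \<Longrightarrow> z \<in> A \<Longrightarrow> r z = c) \<Longrightarrow> measure Q' A = c * measure Q A"
  by (simp add: measure_Q' measure_Q_sum sum_distrib_left)

lemma measure_Q'_split: "measure Q' {z. P z} = (\<Sum>a\<in>A ` set_pmf Q. measure Q' {z. A z = a \<and> P z})"
proof -
  have "measure Q' {z. P z} = measure Q' ({z. P z} \<inter> set_pmf Q')" by (simp add: measure_Int_set_pmf)
  also have "{z. P z} \<inter> set_pmf Q' = (\<Union>a\<in>A ` set_pmf Q. {z. A z = a \<and> P z} \<inter> set_pmf Q')" by (auto simp: set_Q')
  also have "measure Q' \<dots> = (\<Sum>a\<in>A ` set_pmf Q. measure Q' ({z. A z = a \<and> P z} \<inter> set_pmf Q'))"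
    by (rule measure_pmf.finite_measure_finite_Union) (use fin in \<open>auto simp: disjoint_family_on_def\<close>)
  finally show ?thesis by (simp add: measure_Int_set_pmf)
qed

text \<open>Weights that depend on A and B leave the law of C given B alone, since C is independent
  of A given B. The cross-multiplied form also covers null events.\<close>

lemma conditional_law_unchanged:
  assumes M: "markov3 Q A B C" and k: "\<And>z. z \<in> set_pmf Q \<Longrightarrow> r z = k (A z) (B z)"
  shows "measure Q' {z. B z = b \<and> C z = c} * measure Q {z. B z = b} = measure Q' {z. B z = b} * measure Q {z. B z = b \<and> C z = c}"
proof -
  have 1: "measure Q' {z. A z = a \<and> B z = b \<and> C z = c} = k a b * measure Q {z. A z = a \<and> B z = b \<and> C z = c}" for a
    by (rule measure_Q'_scale) (auto simp: k)
  have 2: "measure Q' {z. A z = a \<and> B z = b} = k a b * measure Q {z. A z = a \<and> B z = b}" for a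
    by (rule measure_Q'_scale) (auto simp: k)
  have "measure Q' {z. B z = b \<and> C z = c} * measure Q {z. B z = b} =
     (\<Sum>a\<in>A ` set_pmf Q. k a b * (measure Q {z. A z = a \<and> B z = b \<and> C z = c} * measure Q {z. B z = b}))"
    unfolding measure_Q'_split[of "\<lambda>z. B z = b \<and> C z = c" A] 1 by (simp add: sum_distrib_right mult.assoc)
  also have "\<dots> = (\<Sum>a\<in>A ` set_pmf Q. k a b * (measure Q {z. A z = a \<and> B z = b} * measure Q {z. B z = b \<and> C z = c}))"
    using M unfolding markov3_iff_measure by simp
  also have "\<dots> = measure Q' {z. B z = b} * measure Q {z. B z = b \<and> C z = c}"
    unfolding measure_Q'_split[of "\<lambda>z. B z = b" A] 2 by (simp add: sum_distrib_right mult.assoc)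
  finally show ?thesis .
qed

text \<open>The factor \<open>k a b\<close> scales both terms that contain A, and the law of C given
  B is that under Q.\<close>

lemma markov3_Q':
  assumes M: "markov3 Q A B C" and k: "\<And>z. z \<in> set_pmf Q \<Longrightarrow> r z = k (A z) (B z)"
  shows "markov3 Q' A B C"
  unfolding markov3_iff_measure
proof (intro allI)
  fix a b c
  have 1: "measure Q' {z. A z = a \<and> B z = b \<and> C z = c} = k a b * measure Q {z. A z = a \<and> B z = b \<and> C z = c}"
    by (rule measure_Q'_scale) (auto simp: k)
  have 2: "measure Q' {z. A z = a \<and> B z = b} = k a b * measure Q {z. A z = a \<and> B z = b}"
    by (rule measure_Q'_scale) (auto simp: k)
  have 3: "measure Q {z. A z = a \<and> B z = b \<and> C z = c} * measure Q {z. B z = b} = measure Q {z. A z = a \<and> B z = b} * measure Q {z. B z = b \<and> C z = c}"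
    using M unfolding markov3_iff_measure by blast
  note 4 = conditional_law_unchanged[OF M k, of b c]
  show "measure Q' {z. A z = a \<and> B z = b \<and> C z = c} * measure Q' {z. B z = b} = measure Q' {z. A z = a \<and> B z = b} * measure Q' {z. B z = b \<and> C z = c}"
  proof (cases "measure Q {z. B z = b} = 0")
    case True
    have "measure Q {z. A z = a \<and> B z = b \<and> C z = c} \<le> measure Q {z. B z = b}" "measure Q {z. A z = a \<and> B z = b} \<le> measure Q {z. B z = b}"
      by (auto intro: measure_pmf.finite_measure_mono)
    then have "measure Q {z. A z = a \<and> B z = b \<and> C z = c} = 0" "measure Q {z. A z = a \<and> B z = b} = 0"
      using True by (metis measure_le_0_iff)+
    then show ?thesis by (simp add: 1 2)
  next
    case False
    have "(k a b * measure Q {z. A z = a \<and> B z = b \<and> C z = c} * measure Q' {z. B z = b}) * measure Q {z. B z = b} =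
      (k a b * measure Q {z. A z = a \<and> B z = b} * measure Q' {z. B z = b \<and> C z = c}) * measure Q {z. B z = b}"
      using 3 4 by algebra
    then show ?thesis using False by (simp add: 1 2)
  qed
qed

lemma law_unchanged:
  fixes B :: "'o \<Rightarrow> 'b" and C :: "'o \<Rightarrow> 'c"
  assumes M: "markov3 Q A B C" and k: "\<And>z. z \<in> set_pmf Q \<Longrightarrow> r z = k (A z) (B z)"
    and B: "map_pmf B Q' = map_pmf B Q"
  shows "map_pmf (\<lambda>z. (B z, C z)) Q' = map_pmf (\<lambda>z. (B z, C z)) Q"
proof (rule pmf_eqI)
  fix bc :: "'b \<times> 'c"
  obtain b c where bc: "bc = (b, c)" by (cases bc)
  have Bb: "measure Q' {z. B z = b} = measure Q {z. B z = b}" using arg_cong[OF B, of "\<lambda>p. pmf p b"] by (simp add: pmf_map_measure)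
  have "measure Q' {z. B z = b \<and> C z = c} = measure Q {z. B z = b \<and> C z = c}"
  proof (cases "measure Q {z. B z = b} = 0")
    case True
    have "measure Q {z. B z = b \<and> C z = c} \<le> measure Q {z. B z = b}" "measure Q' {z. B z = b \<and> C z = c} \<le> measure Q' {z. B z = b}"
      by (auto intro: measure_pmf.finite_measure_mono)
    then show ?thesis using True Bb by (metis measure_le_0_iff)
  qed (use conditional_law_unchanged[OF M k, of b c] Bb in auto)
  then show "pmf (map_pmf (\<lambda>z. (B z, C z)) Q') bc = pmf (map_pmf (\<lambda>z. (B z, C z)) Q) bc"
    by (simp add: bc pmf_map_measure)
qed

lemma atom_prob_scale:
  assumes "z \<in> set_pmf Q" "\<And>z. z \<in> set_pmf Q \<Longrightarrow> r z = k (A z)"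
  shows "atom_prob Q' A z = r z * atom_prob Q A z"
  unfolding atom_prob_def by (rule measure_Q'_scale) (use assms in auto)

lemma atom_prob_same: "map_pmf A Q' = map_pmf A Q \<Longrightarrow> atom_prob Q' A z = atom_prob Q A z"
  by (simp add: pmf_map_atom[symmetric])

text \<open>Once reweighting leaves the density unchanged, the new conditional mutual information is
  the mean of a fixed function, hence linear in the weights.\<close>

lemma cmi_Q':
  assumes "\<And>z. z \<in> set_pmf Q' \<Longrightarrow> cmi_density Q' A B C z = cmi_density Q A B C z"
  shows "cmi Q' A B C = measure_pmf.expectation Q' (\<lambda>z. log 2 (cmi_density Q A B C z))"
  unfolding cmi_eq_expectation[OF finite_Q']
  by (rule integral_cong_AE) (use assms in \<open>auto simp: AE_measure_pmf_iff\<close>)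

text \<open>All four atoms lie inside an atom of C, where r is constant, so numerator and
  denominator both scale by the square of r z.\<close>

lemma cmi_density_scale_all:
  assumes "\<And>z. z \<in> set_pmf Q \<Longrightarrow> r z = k (C z)" "z \<in> set_pmf Q'"
  shows "cmi_density Q' A B C z = cmi_density Q A B C z"
proof -
  have z: "z \<in> set_pmf Q" "r z \<noteq> 0" using assms(2) by (auto simp: set_Q')
  have "atom_prob Q' (\<lambda>z. (A z, B z, C z)) z = r z * atom_prob Q (\<lambda>z. (A z, B z, C z)) z"
    by (rule atom_prob_scale[OF z(1), where k = "\<lambda>(a, b, c). k c"]) (simp add: assms(1))
  moreover have "atom_prob Q' (\<lambda>z. (A z, C z)) z = r z * atom_prob Q (\<lambda>z. (A z, C z)) z"
    by (rule atom_prob_scale[OF z(1), where k = "\<lambda>(a, c). k c"]) (simp add: assms(1))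
  moreover have "atom_prob Q' (\<lambda>z. (B z, C z)) z = r z * atom_prob Q (\<lambda>z. (B z, C z)) z"
    by (rule atom_prob_scale[OF z(1), where k = "\<lambda>(a, c). k c"]) (simp add: assms(1))
  moreover have "atom_prob Q' C z = r z * atom_prob Q C z"
    by (rule atom_prob_scale[OF z(1), where k = k]) (simp add: assms(1))
  ultimately show ?thesis using z by (simp add: cmi_density_def)
qed

text \<open>The two atoms that involve A scale by r z and cancel; the two without A keep their
  mass.\<close>

lemma cmi_density_scale_AC:
  assumes k: "\<And>z. z \<in> set_pmf Q \<Longrightarrow> r z = k (A z) (C z)" and z': "z \<in> set_pmf Q'"
    and law: "map_pmf (\<lambda>z. (B z, C z)) Q' = map_pmf (\<lambda>z. (B z, C z)) Q"
  shows "cmi_density Q' A B C z = cmi_density Q A B C z"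
proof -
  have z: "z \<in> set_pmf Q" "r z \<noteq> 0" using z' by (auto simp: set_Q')
  have lawC: "map_pmf C Q' = map_pmf C Q" using arg_cong[OF law, of "map_pmf snd"] by (simp add: map_pmf_comp)
  have "atom_prob Q' (\<lambda>z. (A z, B z, C z)) z = r z * atom_prob Q (\<lambda>z. (A z, B z, C z)) z"
    by (rule atom_prob_scale[OF z(1), where k = "\<lambda>(a, b, c). k a c"]) (simp add: k)
  moreover have "atom_prob Q' (\<lambda>z. (A z, C z)) z = r z * atom_prob Q (\<lambda>z. (A z, C z)) z"
    by (rule atom_prob_scale[OF z(1), where k = "\<lambda>(a, c). k a c"]) (simp add: k)
  ultimately show ?thesis using z by (simp add: cmi_density_def atom_prob_same[OF law] atom_prob_same[OF lawC])
qed

lemma cmi_density_sym: "cmi_density P A B C z = cmi_density P B A C z"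
proof -
  have "atom_prob P (\<lambda>z. (A z, B z, C z)) z = atom_prob P (\<lambda>z. (B z, A z, C z)) z" by (rule atom_prob_cong) auto
  then show ?thesis by (simp add: cmi_density_def mult.commute)
qed

end

section \<open>Cardinality bounds\<close>

text \<open>The unknowns are weights, one for each value of \<open>h\<close>; means become linear
  forms by summing over the fibres of \<open>h\<close>. Each value of \<open>\<kappa>\<close>
  contributes one equality, and together these fix the total mass, so normalisation takes no extra
  constraint.\<close>

lemma reweight_reduction:
  fixes Q :: "'o pmf" and h :: "'o \<Rightarrow> 'i" and \<kappa> :: "'o \<Rightarrow> 'e" and \<phi> :: "'f \<Rightarrow> 'o \<Rightarrow> real" and \<psi> :: "'o \<Rightarrow> real"
  assumes fin: "finite (set_pmf Q)" "finite F" and le: "\<And>k. k \<in> F \<Longrightarrow> measure_pmf.expectation Q (\<phi> k) \<le> b k"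
  shows "\<exists>\<rho>. reweighting Q (\<lambda>z. \<rho> (h z)) \<and> map_pmf \<kappa> (reweight Q (\<lambda>z. \<rho> (h z))) = map_pmf \<kappa> Q \<and>
    (\<forall>k\<in>F. measure_pmf.expectation (reweight Q (\<lambda>z. \<rho> (h z))) (\<phi> k) \<le> b k) \<and>
    measure_pmf.expectation (reweight Q (\<lambda>z. \<rho> (h z))) \<psi> \<le> measure_pmf.expectation Q \<psi> \<and>
    card (h ` set_pmf (reweight Q (\<lambda>z. \<rho> (h z)))) \<le>
       card (\<kappa> ` set_pmf Q) + card {k \<in> F. measure_pmf.expectation (reweight Q (\<lambda>z. \<rho> (h z))) (\<phi> k) = b k}"
proof -
  define I where "I = h ` set_pmf Q"
  define E where "E = \<kappa> ` set_pmf Q"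
  define coef where "coef f i = (\<Sum>z\<in>{z \<in> set_pmf Q. h z = i}. f z * pmf Q z)" for f :: "'o \<Rightarrow> real" and i
  have lin: "measure_pmf.expectation Q (\<lambda>z. \<rho> (h z) * f z) = (\<Sum>i\<in>I. coef f i * \<rho> i)" for \<rho> f
  proof -
    have "measure_pmf.expectation Q (\<lambda>z. \<rho> (h z) * f z) = (\<Sum>z\<in>set_pmf Q. \<rho> (h z) * f z * pmf Q z)"
      by (rule integral_measure_pmf_real) (use fin in auto)
    also have "\<dots> = (\<Sum>i\<in>I. \<Sum>z\<in>{z \<in> set_pmf Q. h z = i}. \<rho> (h z) * f z * pmf Q z)"
      unfolding I_def by (rule sum.image_gen[OF fin(1)])
    also have "\<dots> = (\<Sum>i\<in>I. coef f i * \<rho> i)"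
      by (intro sum.cong refl) (simp add: coef_def sum_distrib_right sum_distrib_left mult_ac)
    finally show ?thesis .
  qed
  have lin1: "measure_pmf.expectation Q f = (\<Sum>i\<in>I. coef f i * 1)" for f
    using lin[of "\<lambda>_. 1" f] by simp
  define e where "e x = coef (indicator {z. \<kappa> z = x})" for x
  \<comment> \<open>The classes of \<open>\<kappa>\<close> partition the support, so the equality
    coefficients of each i add up to the mass of its fibre; this gives the positivity that the
    support reduction asks for.\<close>
  have ones: "(\<Sum>x\<in>E. indicator {z. \<kappa> z = x} z) = (1 :: real)" if "z \<in> set_pmf Q" for z
  proof -
    have "(\<Sum>x\<in>E. indicator {z. \<kappa> z = x} z) = (\<Sum>x\<in>E. if x = \<kappa> z then 1 else 0 :: real)"
      by (intro sum.cong refl) (auto simp: indicator_def)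
    then show ?thesis using that fin by (simp add: E_def)
  qed
  have pos: "(\<Sum>x\<in>E. e x i) > 0" if "i \<in> I" for i
  proof -
    have "(\<Sum>x\<in>E. e x i) = (\<Sum>z\<in>{z \<in> set_pmf Q. h z = i}. (\<Sum>x\<in>E. indicator {z. \<kappa> z = x} z) * pmf Q z)"
      unfolding e_def coef_def sum_distrib_right by (rule sum.swap)
    also have "\<dots> = (\<Sum>z\<in>{z \<in> set_pmf Q. h z = i}. pmf Q z)" by (intro sum.cong refl) (simp add: ones)
    also have "\<dots> > 0" using that fin by (intro sum_pos) (auto simp: I_def pmf_positive)
    finally show ?thesis .
  qed
  have "\<exists>q'. (\<forall>i\<in>I. q' i \<ge> 0) \<and> (\<forall>x\<in>E. (\<Sum>i\<in>I. e x i * q' i) = (\<Sum>i\<in>I. e x i * 1)) \<and>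
    (\<forall>k\<in>F. (\<Sum>i\<in>I. coef (\<phi> k) i * q' i) \<le> b k) \<and> (\<Sum>i\<in>I. coef \<psi> i * q' i) \<le> (\<Sum>i\<in>I. coef \<psi> i * 1) \<and>
    card {i \<in> I. q' i \<noteq> 0} \<le> card E + card {k \<in> F. (\<Sum>i\<in>I. coef (\<phi> k) i * q' i) = b k}"
    by (rule support_reduction) (use fin pos le lin1 in \<open>auto simp: I_def E_def\<close>)
  then obtain \<rho> where \<rho>: "\<forall>i\<in>I. \<rho> i \<ge> 0" "\<forall>x\<in>E. (\<Sum>i\<in>I. e x i * \<rho> i) = (\<Sum>i\<in>I. e x i * 1)"
    "\<forall>k\<in>F. (\<Sum>i\<in>I. coef (\<phi> k) i * \<rho> i) \<le> b k" "(\<Sum>i\<in>I. coef \<psi> i * \<rho> i) \<le> (\<Sum>i\<in>I. coef \<psi> i * 1)"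
    "card {i \<in> I. \<rho> i \<noteq> 0} \<le> card E + card {k \<in> F. (\<Sum>i\<in>I. coef (\<phi> k) i * \<rho> i) = b k}" by blast
  have key: "measure_pmf.expectation Q (\<lambda>z. \<rho> (h z) * indicator {z. \<kappa> z = x} z) = measure Q {z. \<kappa> z = x}" if "x \<in> E" for x
  proof -
    have "measure_pmf.expectation Q (\<lambda>z. \<rho> (h z) * indicator {z. \<kappa> z = x} z) = (\<Sum>i\<in>I. e x i * \<rho> i)"
      unfolding e_def by (rule lin)
    also have "\<dots> = (\<Sum>i\<in>I. e x i * 1)" using \<rho>(2) that by blast
    also have "\<dots> = measure_pmf.expectation Q (indicator {z. \<kappa> z = x})" unfolding e_def by (rule lin1[symmetric])
    finally show ?thesis by simp
  qed
  have int: "integrable (measure_pmf Q) f" for f :: "'o \<Rightarrow> real" using fin(1) by (rule integrable_measure_pmf_finite)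
  have decompose: "measure_pmf.expectation Q f = (\<Sum>x\<in>E. measure_pmf.expectation Q (\<lambda>z. f z * indicator {z. \<kappa> z = x} z))" for f :: "'o \<Rightarrow> real"
  proof -
    have "measure_pmf.expectation Q f = measure_pmf.expectation Q (\<lambda>z. \<Sum>x\<in>E. f z * indicator {z. \<kappa> z = x} z)"
      by (rule integral_cong_AE) (auto simp: AE_measure_pmf_iff sum_distrib_left[symmetric] ones)
    then show ?thesis by (simp add: int)
  qed
  have tot: "measure_pmf.expectation Q (\<lambda>z. \<rho> (h z)) = 1"
  proof -
    have "measure_pmf.expectation Q (\<lambda>z. \<rho> (h z)) = (\<Sum>x\<in>E. measure Q {z. \<kappa> z = x})"
      unfolding decompose[of "\<lambda>z. \<rho> (h z)"] by (intro sum.cong refl key)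
    also have "\<dots> = measure_pmf.expectation Q (\<lambda>z. 1)" unfolding decompose[of "\<lambda>z. 1"] by simp
    finally show ?thesis by simp
  qed
  interpret R: reweighting Q "\<lambda>z. \<rho> (h z)"
    by standard (use fin \<rho>(1) tot in \<open>auto simp: I_def\<close>)
  have exp': "measure_pmf.expectation R.Q' f = (\<Sum>i\<in>I. coef f i * \<rho> i)" for f
    unfolding R.expectation_Q' by (rule lin)
  show ?thesis
  proof (intro exI[of _ \<rho>] conjI ballI)
    show "reweighting Q (\<lambda>z. \<rho> (h z))" by (rule R.reweighting_axioms)
    show "map_pmf \<kappa> R.Q' = map_pmf \<kappa> Q"
    proof (rule pmf_eqI)
      fix x
      have m: "pmf (map_pmf \<kappa> R.Q') x = measure_pmf.expectation Q (\<lambda>z. \<rho> (h z) * indicator {z. \<kappa> z = x} z)"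
      proof -
        have "pmf (map_pmf \<kappa> R.Q') x = measure_pmf.expectation R.Q' (indicator {z. \<kappa> z = x})" by (simp add: pmf_map_measure)
        then show ?thesis unfolding R.expectation_Q' .
      qed
      show "pmf (map_pmf \<kappa> R.Q') x = pmf (map_pmf \<kappa> Q) x"
      proof (cases "x \<in> E")
        case True
        then show ?thesis unfolding m key[OF True] by (simp add: pmf_map_measure)
      next
        case False
        then have "x \<notin> \<kappa> ` set_pmf Q" "x \<notin> \<kappa> ` set_pmf R.Q'" by (auto simp: E_def R.set_Q')
        then show ?thesis by (metis pmf_map_outside)
      qed
    qed
    show "measure_pmf.expectation R.Q' (\<phi> k) \<le> b k" if "k \<in> F" for k using \<rho>(3) that by (simp add: exp')
    show "measure_pmf.expectation R.Q' \<psi> \<le> measure_pmf.expectation Q \<psi>" using \<rho>(4) unfolding exp' lin1 .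
    have "h ` set_pmf R.Q' \<subseteq> {i \<in> I. \<rho> i \<noteq> 0}" by (auto simp: R.set_Q' I_def)
    then have "card (h ` set_pmf R.Q') \<le> card {i \<in> I. \<rho> i \<noteq> 0}" using fin by (intro card_mono) (auto simp: I_def)
    also note \<rho>(5)
    finally show "card (h ` set_pmf R.Q') \<le> card (\<kappa> ` set_pmf Q) + card {k \<in> F. measure_pmf.expectation R.Q' (\<phi> k) = b k}"
      by (simp add: exp' E_def)
  qed
qed

text \<open>\<open>inner_cond\<close> for variables on any outcome space, so that the distribution
  and the variables U and V can be changed separately before a joint pmf is rebuilt.\<close>

definition inner_vars ::
  "('x \<times> 'y) pmf \<Rightarrow> ('x \<Rightarrow> 'y \<Rightarrow> 'f1) \<Rightarrow> ('x \<Rightarrow> 'y \<Rightarrow> 'f2) \<Rightarrow> ('f1 \<Rightarrow> 'f1 \<Rightarrow> real) \<Rightarrow> ('f2 \<Rightarrow> 'f2 \<Rightarrow> real) \<Rightarrow> real \<Rightarrow> real \<Rightarrow>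
   real \<Rightarrow> real \<Rightarrow> real \<Rightarrow> 'o pmf \<Rightarrow> ('o \<Rightarrow> 'x) \<Rightarrow> ('o \<Rightarrow> 'y) \<Rightarrow> ('o \<Rightarrow> 't) \<Rightarrow> ('o \<Rightarrow> 'u) \<Rightarrow> ('o \<Rightarrow> 'v) \<Rightarrow> ('o \<Rightarrow> 'w) \<Rightarrow>
   ('v \<Rightarrow> 't \<Rightarrow> 'w \<Rightarrow> 'f1) \<Rightarrow> ('v \<Rightarrow> 't \<Rightarrow> 'w \<Rightarrow> 'f2) \<Rightarrow> bool" where
  "inner_vars p f1 f2 d1 d2 D1 D2 R0 RX RY Q X Y T U V W g1 g2 \<longleftrightarrow>
     markov_vars Q X Y T U V W \<and> map_pmf (\<lambda>s. (X s, Y s)) Q = p \<and>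
     measure_pmf.expectation Q (\<lambda>s. d1 (f1 (X s) (Y s)) (g1 (V s) (T s) (W s))) \<le> D1 \<and>
     measure_pmf.expectation Q (\<lambda>s. d2 (f2 (X s) (Y s)) (g2 (V s) (T s) (W s))) \<le> D2 \<and>
     R0 > cmi Q X U Y \<and> RX > cmi Q V X (\<lambda>s. (T s, W s)) \<and> RY > cmi Q (\<lambda>s. (U s, Y s)) W (\<lambda>s. (V s, T s)) \<and>
     RX + RY > markov_vars.sum_rate Q X Y T U V W"

lemma inner_cond_iff_vars:
  "inner_cond p f1 f2 d1 d2 D1 D2 R0 RX RY Q g1 g2 \<longleftrightarrow>
   inner_vars p f1 f2 d1 d2 D1 D2 R0 RX RY Q oX oY oT oU oV oW g1 g2"
  unfolding inner_cond_def inner_vars_def Let_def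
  by (auto simp: markov_vars_def markov_vars.sum_rate_def)

lemma cmi_map_pmf: "cmi (map_pmf h P) A B C = cmi P (\<lambda>z. A (h z)) (\<lambda>z. B (h z)) (\<lambda>z. C (h z))"
  by (simp only: cmi_def map_pmf_comp)

lemma markov3_map_pmf: "markov3 (map_pmf h P) A B C \<longleftrightarrow> markov3 P (\<lambda>z. A (h z)) (\<lambda>z. B (h z)) (\<lambda>z. C (h z))"
  by (simp only: markov3_def map_pmf_comp)

lemma inner_cond_map_pmf:
  assumes "inner_vars p f1 f2 d1 d2 D1 D2 R0 RX RY P X Y T U V W g1 g2"
  shows "inner_cond p f1 f2 d1 d2 D1 D2 R0 RX RY (map_pmf (\<lambda>z. (X z, Y z, T z, U z, V z, W z)) P) g1 g2"
proof -
  have MV: "markov_vars P X Y T U V W" using assms by (simp add: inner_vars_def)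
  have s: "RX + RY > mi P (\<lambda>s. (X s, Y s)) (\<lambda>s. (V s, T s, W s)) + cmi P U W (\<lambda>s. (V s, X s, T s, Y s))"
    using assms markov_vars.sum_rate_def[OF MV] by (simp add: inner_vars_def)
  show ?thesis
    using assms s MV unfolding inner_cond_def Let_def inner_vars_def markov_vars_def
    by (simp add: markov4_def markov3_map_pmf cmi_map_pmf mi_def map_pmf_comp)
qed

text \<open>Weights depend on T and preserve the law of X, hence of (X, Y); this takes at most
  \<open>CARD('x)\<close> equalities. The inequalities are the second distortion and the four rates,
  of which at most four can be tight at once.\<close>

lemma inner_vars_reduce_T:
  fixes X :: "'o \<Rightarrow> 'x::finite"
  assumes inner: "inner_vars p f1 f2 d1 d2 D1 D2 R0 RX RY Q X Y T U V W g1 g2"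
  shows "\<exists>Q'. inner_vars p f1 f2 d1 d2 D1 D2 R0 RX RY Q' X Y T U V W g1 g2 \<and> card (T ` set_pmf Q') \<le> CARD('x) + 4"
proof -
  have MV: "markov_vars Q X Y T U V W" using inner by (simp add: inner_vars_def)
  interpret markov_vars Q X Y T U V W by (rule MV)
  define \<phi>1 where "\<phi>1 z = log 2 (cmi_density Q X U Y z)" for z
  define \<phi>2 where "\<phi>2 z = log 2 (cmi_density Q V X (\<lambda>s. (T s, W s)) z)" for z
  define \<phi>3 where "\<phi>3 z = log 2 (cmi_density Q (\<lambda>s. (U s, Y s)) W (\<lambda>s. (V s, T s)) z)" for z
  define \<phi>4a where "\<phi>4a z = log 2 (cmi_density Q (\<lambda>s. (X s, Y s)) (\<lambda>s. (V s, T s, W s)) (\<lambda>_. ()) z)" for z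
  define \<phi>4b where "\<phi>4b z = log 2 (cmi_density Q U W (\<lambda>s. (V s, X s, T s, Y s)) z)" for z
  define dd1 where "dd1 s = d1 (f1 (X s) (Y s)) (g1 (V s) (T s) (W s))" for s
  define dd2 where "dd2 s = d2 (f2 (X s) (Y s)) (g2 (V s) (T s) (W s))" for s
  define rX where "rX = cmi Q V X (\<lambda>s. (T s, W s))"
  define rY where "rY = cmi Q (\<lambda>s. (U s, Y s)) W (\<lambda>s. (V s, T s))"
  \<comment> \<open>The bounds imposed on the two single rates are RX - \<eta> and RY - \<eta>. If
    both and the sum rate were tight, \<open>sum_rate_ge\<close> would give RX + RY - 2 \<eta> <=
    sum_rate, which a third of the gap rules out.\<close>
  define \<eta> where "\<eta> = min (min (RX - rX) (RY - rY)) ((RX + RY - sum_rate) / 3)"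
  have i: "measure_pmf.expectation Q dd1 \<le> D1" "measure_pmf.expectation Q dd2 \<le> D2" "cmi Q X U Y < R0" "rX < RX" "rY < RY"
    "sum_rate < RX + RY" "map_pmf (\<lambda>s. (X s, Y s)) Q = p"
    using inner by (auto simp: inner_vars_def dd1_def[abs_def] dd2_def[abs_def] rX_def rY_def)
  have "\<eta> \<le> (RX + RY - sum_rate) / 3" unfolding \<eta>_def by (rule min.cobounded2)
  then have \<eta>: "\<eta> > 0" "\<eta> \<le> RX - rX" "\<eta> \<le> RY - rY" "\<eta> \<le> (RX + RY - sum_rate) / 3" using i by (auto simp: \<eta>_def)
  define \<phi> where "\<phi> k = (if k = 0 then dd2 else if k = 1 then \<phi>1 else if k = 2 then \<phi>2 else if k = 3 then \<phi>3 else (\<lambda>z. \<phi>4a z + \<phi>4b z))" for k :: nat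
  define b where "b k = (if k = 0 then D2 else if k = 1 then cmi Q X U Y else if k = 2 then RX - \<eta> else if k = 3 then RY - \<eta> else sum_rate)" for k :: nat
  have int: "integrable (measure_pmf Q) f" for f :: "'o \<Rightarrow> real" using finQ by (rule integrable_measure_pmf_finite)
  define F where "F = {0, 1, 2, 3, 4 :: nat}"
  have finF: "finite F" by (simp add: F_def)
  have le0: "measure_pmf.expectation Q (\<phi> k) \<le> b k" if "k \<in> F" for k
    using that i \<eta> by (auto simp: F_def \<phi>_def b_def \<phi>1_def[abs_def] \<phi>2_def[abs_def] \<phi>3_def[abs_def] \<phi>4a_def[abs_def] \<phi>4b_def[abs_def]
        cmi_eq_expectation[OF finQ] rX_def rY_def sum_rate_def mi_def int)
  obtain \<rho> where R: "reweighting Q (\<lambda>z. \<rho> (T z))"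
    and law: "map_pmf X (reweight Q (\<lambda>z. \<rho> (T z))) = map_pmf X Q"
    and le: "\<forall>k\<in>F. measure_pmf.expectation (reweight Q (\<lambda>z. \<rho> (T z))) (\<phi> k) \<le> b k"
    and obj: "measure_pmf.expectation (reweight Q (\<lambda>z. \<rho> (T z))) dd1 \<le> measure_pmf.expectation Q dd1"
    and card: "card (T ` set_pmf (reweight Q (\<lambda>z. \<rho> (T z)))) \<le> card (X ` set_pmf Q) +
        card {k \<in> F. measure_pmf.expectation (reweight Q (\<lambda>z. \<rho> (T z))) (\<phi> k) = b k}"
    using reweight_reduction[where Q = Q and F = F and \<phi> = \<phi> and b = b and h = T and \<kappa> = X and \<psi> = dd1, OF finQ finF] le0
    by blast
  interpret R: reweighting Q "\<lambda>z. \<rho> (T z)" by (rule R)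
  have lawXY: "map_pmf (\<lambda>z. (X z, Y z)) R.Q' = map_pmf (\<lambda>z. (X z, Y z)) Q"
    by (rule R.law_unchanged[OF markov_T[of "\<lambda>x y. y"], where k = "\<lambda>t x. \<rho> t"]) (use law in auto)
  have M4: "markov3 Q T U (\<lambda>s. (X s, Y s))" "markov3 Q (\<lambda>s. (T s, U s)) X Y"
    "markov3 Q V (\<lambda>s. (X s, T s)) (\<lambda>s. ((U s, Y s), W s))" "markov3 Q (\<lambda>s. (V s, (X s, T s))) (\<lambda>s. (U s, Y s)) W"
    using TUXY VXTUYW by (auto simp: markov4_def)
  have MV': "markov_vars R.Q' X Y T U V W"
  proof
    show "markov4 R.Q' T U X Y" unfolding markov4_def
      using R.markov3_Q'[OF M4(1), of "\<lambda>t _. \<rho> t"] R.markov3_Q'[OF M4(2), of "\<lambda>a _. \<rho> (fst a)"] by simp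
    show "markov4 R.Q' V (\<lambda>s. (X s, T s)) (\<lambda>s. (U s, Y s)) W" unfolding markov4_def
      using R.markov3_Q'[OF M4(3), of "\<lambda>_ b. \<rho> (snd b)"] R.markov3_Q'[OF M4(4), of "\<lambda>a _. \<rho> (snd (snd a))"] by simp
  qed (rule R.finite_Q')
  interpret M': markov_vars R.Q' X Y T U V W by (rule MV')
  have int': "integrable (measure_pmf R.Q') f" for f :: "'o \<Rightarrow> real" using R.finite_Q' by (rule integrable_measure_pmf_finite)
  have c1: "cmi R.Q' X U Y = measure_pmf.expectation R.Q' \<phi>1"
    unfolding \<phi>1_def
  proof (rule R.cmi_Q')
    fix z assume z': "z \<in> set_pmf R.Q'"
    then have z: "z \<in> set_pmf Q" by (simp add: R.set_Q')
    have lawY: "map_pmf Y R.Q' = map_pmf Y Q" using arg_cong[OF lawXY, of "map_pmf snd"] by (simp add: map_pmf_comp)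
    \<comment> \<open>T is absent from I(X;U|Y), so the density does not scale with the weight.
      Instead X keeps its law given (U, Y), because T - (U, Y) - X is Markov, and the law of (X, Y)
      is preserved.\<close>
    have "measure R.Q' {z'. (U z', Y z') = (U z, Y z) \<and> X z' = X z} * measure Q {z'. (U z', Y z') = (U z, Y z)} =
       measure R.Q' {z'. (U z', Y z') = (U z, Y z)} * measure Q {z'. (U z', Y z') = (U z, Y z) \<and> X z' = X z}"
      by (rule R.conditional_law_unchanged[OF markov3_sym[OF markov_XUY_T], where k = "\<lambda>t _. \<rho> t"]) simp
    then have eq: "atom_prob R.Q' (\<lambda>z. (X z, U z, Y z)) z * atom_prob Q (\<lambda>z. (U z, Y z)) z =
       atom_prob R.Q' (\<lambda>z. (U z, Y z)) z * atom_prob Q (\<lambda>z. (X z, U z, Y z)) z"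
      unfolding atom_prob_def by (simp add: conj_ac)
    have "atom_prob R.Q' (\<lambda>z. (X z, U z, Y z)) z / atom_prob R.Q' (\<lambda>z. (U z, Y z)) z =
       atom_prob Q (\<lambda>z. (X z, U z, Y z)) z / atom_prob Q (\<lambda>z. (U z, Y z)) z"
      using eq atom_prob_neq_0[OF z', of "\<lambda>z. (U z, Y z)"] atom_prob_neq_0[OF z, of "\<lambda>z. (U z, Y z)"] by (simp add: frac_eq_eq mult.commute)
    then show "cmi_density R.Q' X U Y z = cmi_density Q X U Y z"
      unfolding cmi_density_def R.atom_prob_same[OF lawXY] R.atom_prob_same[OF lawY]
      by (metis (no_types, lifting) mult.commute times_divide_times_eq)
  qed
  have c2: "cmi R.Q' V X (\<lambda>s. (T s, W s)) = measure_pmf.expectation R.Q' \<phi>2"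
    unfolding \<phi>2_def by (rule R.cmi_Q', rule R.cmi_density_scale_all[where k = "\<lambda>(t, w). \<rho> t"]) auto
  have c3: "cmi R.Q' (\<lambda>s. (U s, Y s)) W (\<lambda>s. (V s, T s)) = measure_pmf.expectation R.Q' \<phi>3"
    unfolding \<phi>3_def by (rule R.cmi_Q', rule R.cmi_density_scale_all[where k = "\<lambda>(v, t). \<rho> t"]) auto
  have c4a: "mi R.Q' (\<lambda>s. (X s, Y s)) (\<lambda>s. (V s, T s, W s)) = measure_pmf.expectation R.Q' \<phi>4a"
    unfolding \<phi>4a_def mi_def
  proof (rule R.cmi_Q')
    fix z assume z': "z \<in> set_pmf R.Q'"
    have "map_pmf (\<lambda>z. ((X z, Y z), ())) R.Q' = map_pmf (\<lambda>z. ((X z, Y z), ())) Q"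
      using arg_cong[OF lawXY, of "map_pmf (\<lambda>a. (a, ()))"] by (simp add: map_pmf_comp)
    then show "cmi_density R.Q' (\<lambda>s. (X s, Y s)) (\<lambda>s. (V s, T s, W s)) (\<lambda>_. ()) z = cmi_density Q (\<lambda>s. (X s, Y s)) (\<lambda>s. (V s, T s, W s)) (\<lambda>_. ()) z"
      \<comment> \<open>Symmetry puts the tuple with T, which carries the weight, in the first place
        and (X, Y), whose law is fixed, in the second.\<close>
      unfolding R.cmi_density_sym[of _ "\<lambda>s. (X s, Y s)"]
      by (intro R.cmi_density_scale_AC[where k = "\<lambda>(v, t, w) _. \<rho> t"] z') auto
  qed
  have c4b: "cmi R.Q' U W (\<lambda>s. (V s, X s, T s, Y s)) = measure_pmf.expectation R.Q' \<phi>4b"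
    unfolding \<phi>4b_def by (rule R.cmi_Q', rule R.cmi_density_scale_all[where k = "\<lambda>(v, x, t, y). \<rho> t"]) auto
  have c4: "M'.sum_rate = measure_pmf.expectation R.Q' (\<lambda>z. \<phi>4a z + \<phi>4b z)"
    unfolding M'.sum_rate_def c4a c4b by (simp add: int')
  have ex: "measure_pmf.expectation R.Q' (\<phi> 0) = measure_pmf.expectation R.Q' dd2"
    "measure_pmf.expectation R.Q' (\<phi> 1) = cmi R.Q' X U Y"
    "measure_pmf.expectation R.Q' (\<phi> 2) = cmi R.Q' V X (\<lambda>s. (T s, W s))"
    "measure_pmf.expectation R.Q' (\<phi> 3) = cmi R.Q' (\<lambda>s. (U s, Y s)) W (\<lambda>s. (V s, T s))"
    "measure_pmf.expectation R.Q' (\<phi> 4) = M'.sum_rate"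
    unfolding c1 c2 c3 c4 by (simp_all add: \<phi>_def)
  have bb: "b 0 = D2" "b 1 = cmi Q X U Y" "b 2 = RX - \<eta>" "b 3 = RY - \<eta>" "b 4 = sum_rate" by (simp_all add: b_def)
  have "inner_vars p f1 f2 d1 d2 D1 D2 R0 RX RY R.Q' X Y T U V W g1 g2"
    unfolding inner_vars_def dd1_def[symmetric] dd2_def[symmetric]
    using MV' lawXY i obj \<eta> le[rule_format, of 0] le[rule_format, of 1] le[rule_format, of 2] le[rule_format, of 3] le[rule_format, of 4]
    unfolding ex bb by (simp add: F_def)
  moreover have "card {k \<in> F. measure_pmf.expectation R.Q' (\<phi> k) = b k} \<le> 4"
  proof -
    have "{k \<in> F. measure_pmf.expectation R.Q' (\<phi> k) = b k} \<noteq> F"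
    proof
      assume *: "{k \<in> F. measure_pmf.expectation R.Q' (\<phi> k) = b k} = F"
      have "k \<in> {k \<in> F. measure_pmf.expectation R.Q' (\<phi> k) = b k}" if "k \<in> F" for k
        unfolding * by (rule that)
      then have "measure_pmf.expectation R.Q' (\<phi> k) = b k" if "k \<in> {2, 3, 4}" for k using that by (auto simp: F_def)
      from this[of 2] this[of 3] this[of 4] have "RX - \<eta> + (RY - \<eta>) \<le> sum_rate"
        using M'.sum_rate_ge unfolding ex bb by simp
      then show False using \<eta> by simp
    qed
    then have "{k \<in> F. measure_pmf.expectation R.Q' (\<phi> k) = b k} \<subset> F" by blast
    from psubset_card_mono[OF finF this] show ?thesis by (simp add: F_def)
  qed
  moreover have "card (X ` set_pmf Q) \<le> CARD('x)" by (rule card_mono) auto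
  ultimately show ?thesis using card by (intro exI[of _ R.Q'] conjI) auto
qed

lemma markov3_law:
  assumes "map_pmf (\<lambda>z. (A z, B z, C z)) P = map_pmf (\<lambda>z. (A z, B z, C z)) Q" "markov3 Q A B C"
  shows "markov3 P A B C"
proof -
  have *: "markov3 R A B C \<longleftrightarrow> markov3 (map_pmf (\<lambda>z. (A z, B z, C z)) R) fst (\<lambda>x. fst (snd x)) (\<lambda>x. snd (snd x))" for R
    by (simp add: markov3_map_pmf)
  show ?thesis using assms unfolding *[of P] *[of Q] by simp
qed

lemma cmi_law:
  assumes "map_pmf (\<lambda>z. (A z, B z, C z)) P = map_pmf (\<lambda>z. (A z, B z, C z)) Q"
  shows "cmi P A B C = cmi Q A B C"
proof -
  have *: "cmi R A B C = cmi (map_pmf (\<lambda>z. (A z, B z, C z)) R) fst (\<lambda>x. fst (snd x)) (\<lambda>x. snd (snd x))" for R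
    by (simp add: cmi_map_pmf)
  show ?thesis using assms unfolding *[of P] *[of Q] by simp
qed

text \<open>Weights depend on (T, V) and preserve the law of (X, T). Since V is independent of (U,
  Y, W) given (X, T), the joint law of the other variables is unchanged and R0 takes no constraint.
  The second distortion and the three remaining rates account for the 4.\<close>

lemma inner_vars_reduce_V:
  fixes X :: "'o \<Rightarrow> 'x::finite"
  assumes inner: "inner_vars p f1 f2 d1 d2 D1 D2 R0 RX RY Q X Y T U V W g1 g2"
  shows "\<exists>Q'. inner_vars p f1 f2 d1 d2 D1 D2 R0 RX RY Q' X Y T U V W g1 g2 \<and> T ` set_pmf Q' = T ` set_pmf Q \<and>
    card ((\<lambda>z. (T z, V z)) ` set_pmf Q') \<le> CARD('x) * card (T ` set_pmf Q) + 4"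
proof -
  have MV: "markov_vars Q X Y T U V W" using inner by (simp add: inner_vars_def)
  interpret markov_vars Q X Y T U V W by (rule MV)
  define \<phi>2 where "\<phi>2 z = log 2 (cmi_density Q V X (\<lambda>s. (T s, W s)) z)" for z
  define \<phi>3 where "\<phi>3 z = log 2 (cmi_density Q (\<lambda>s. (U s, Y s)) W (\<lambda>s. (V s, T s)) z)" for z
  define \<phi>4a where "\<phi>4a z = log 2 (cmi_density Q (\<lambda>s. (X s, Y s)) (\<lambda>s. (V s, T s, W s)) (\<lambda>_. ()) z)" for z
  define \<phi>4b where "\<phi>4b z = log 2 (cmi_density Q U W (\<lambda>s. (V s, X s, T s, Y s)) z)" for z
  define dd1 where "dd1 s = d1 (f1 (X s) (Y s)) (g1 (V s) (T s) (W s))" for s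
  define dd2 where "dd2 s = d2 (f2 (X s) (Y s)) (g2 (V s) (T s) (W s))" for s
  define rX where "rX = cmi Q V X (\<lambda>s. (T s, W s))"
  define rY where "rY = cmi Q (\<lambda>s. (U s, Y s)) W (\<lambda>s. (V s, T s))"
  have i: "measure_pmf.expectation Q dd1 \<le> D1" "measure_pmf.expectation Q dd2 \<le> D2" "cmi Q X U Y < R0" "rX < RX" "rY < RY"
    "sum_rate < RX + RY" "map_pmf (\<lambda>s. (X s, Y s)) Q = p"
    using inner by (auto simp: inner_vars_def dd1_def[abs_def] dd2_def[abs_def] rX_def rY_def)
  define \<phi> where "\<phi> k = (if k = 0 then dd2 else if k = 1 then \<phi>2 else if k = 2 then \<phi>3 else (\<lambda>z. \<phi>4a z + \<phi>4b z))" for k :: nat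
  define b where "b k = (if k = 0 then D2 else if k = 1 then rX else if k = 2 then rY else sum_rate)" for k :: nat
  have int: "integrable (measure_pmf Q) f" for f :: "'o \<Rightarrow> real" using finQ by (rule integrable_measure_pmf_finite)
  define F where "F = {0, 1, 2, 3 :: nat}"
  have finF: "finite F" by (simp add: F_def)
  have le0: "measure_pmf.expectation Q (\<phi> k) \<le> b k" if "k \<in> F" for k
    using that i by (auto simp: F_def \<phi>_def b_def \<phi>2_def[abs_def] \<phi>3_def[abs_def] \<phi>4a_def[abs_def] \<phi>4b_def[abs_def]
        cmi_eq_expectation[OF finQ] rX_def rY_def sum_rate_def mi_def int)
  obtain \<rho> where R: "reweighting Q (\<lambda>z. \<rho> (T z, V z))"
    and law: "map_pmf (\<lambda>z. (X z, T z)) (reweight Q (\<lambda>z. \<rho> (T z, V z))) = map_pmf (\<lambda>z. (X z, T z)) Q"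
    and le: "\<forall>k\<in>F. measure_pmf.expectation (reweight Q (\<lambda>z. \<rho> (T z, V z))) (\<phi> k) \<le> b k"
    and obj: "measure_pmf.expectation (reweight Q (\<lambda>z. \<rho> (T z, V z))) dd1 \<le> measure_pmf.expectation Q dd1"
    and card: "card ((\<lambda>z. (T z, V z)) ` set_pmf (reweight Q (\<lambda>z. \<rho> (T z, V z)))) \<le> card ((\<lambda>z. (X z, T z)) ` set_pmf Q) +
        card {k \<in> F. measure_pmf.expectation (reweight Q (\<lambda>z. \<rho> (T z, V z))) (\<phi> k) = b k}"
    using reweight_reduction[where Q = Q and F = F and \<phi> = \<phi> and b = b and h = "\<lambda>z. (T z, V z)" and \<kappa> = "\<lambda>z. (X z, T z)" and \<psi> = dd1,
        OF finQ finF] le0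
    by blast
  interpret R: reweighting Q "\<lambda>z. \<rho> (T z, V z)" by (rule R)
  have M4: "markov3 Q T U (\<lambda>s. (X s, Y s))" "markov3 Q (\<lambda>s. (T s, U s)) X Y"
    "markov3 Q V (\<lambda>s. (X s, T s)) (\<lambda>s. ((U s, Y s), W s))" "markov3 Q (\<lambda>s. (V s, (X s, T s))) (\<lambda>s. (U s, Y s)) W"
    using TUXY VXTUYW by (auto simp: markov4_def)
  have law0: "map_pmf (\<lambda>z. ((X z, T z), ((U z, Y z), W z))) R.Q' = map_pmf (\<lambda>z. ((X z, T z), ((U z, Y z), W z))) Q"
    by (rule R.law_unchanged[OF M4(3), where k = "\<lambda>v xt. \<rho> (snd xt, v)"]) (use law in auto)
  have law_f: "map_pmf (\<lambda>z. f (X z) (T z) (U z) (Y z) (W z)) R.Q' = map_pmf (\<lambda>z. f (X z) (T z) (U z) (Y z) (W z)) Q" for f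
    using arg_cong[OF law0, of "map_pmf (\<lambda>((x, t), ((u, y), w)). f x t u y w)"] by (simp add: map_pmf_comp)
  have MV': "markov_vars R.Q' X Y T U V W"
  proof
    show "markov4 R.Q' T U X Y" unfolding markov4_def
      using markov3_law[OF law_f[of "\<lambda>x t u y w. (t, u, (x, y))"] M4(1)] markov3_law[OF law_f[of "\<lambda>x t u y w. ((t, u), x, y)"] M4(2)] by simp
    show "markov4 R.Q' V (\<lambda>s. (X s, T s)) (\<lambda>s. (U s, Y s)) W" unfolding markov4_def
      using R.markov3_Q'[OF M4(3), of "\<lambda>v b. \<rho> (snd b, v)"] R.markov3_Q'[OF M4(4), of "\<lambda>a _. \<rho> (snd (snd a), fst a)"] by simp
  qed (rule R.finite_Q')
  interpret M': markov_vars R.Q' X Y T U V W by (rule MV')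
  have int': "integrable (measure_pmf R.Q') f" for f :: "'o \<Rightarrow> real" using R.finite_Q' by (rule integrable_measure_pmf_finite)
  have c1: "cmi R.Q' X U Y = cmi Q X U Y" by (rule cmi_law, rule law_f[of "\<lambda>x t u y w. (x, u, y)"])
  have c2: "cmi R.Q' V X (\<lambda>s. (T s, W s)) = measure_pmf.expectation R.Q' \<phi>2"
    unfolding \<phi>2_def by (rule R.cmi_Q', rule R.cmi_density_scale_AC[where k = "\<lambda>v (t, w). \<rho> (t, v)"])
      (auto intro: law_f[of "\<lambda>x t u y w. (x, t, w)"])
  have c3: "cmi R.Q' (\<lambda>s. (U s, Y s)) W (\<lambda>s. (V s, T s)) = measure_pmf.expectation R.Q' \<phi>3"
    unfolding \<phi>3_def by (rule R.cmi_Q', rule R.cmi_density_scale_all[where k = "\<lambda>(v, t). \<rho> (t, v)"]) auto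
  have c4a: "mi R.Q' (\<lambda>s. (X s, Y s)) (\<lambda>s. (V s, T s, W s)) = measure_pmf.expectation R.Q' \<phi>4a"
    unfolding \<phi>4a_def mi_def
  proof (rule R.cmi_Q')
    fix z assume z': "z \<in> set_pmf R.Q'"
    show "cmi_density R.Q' (\<lambda>s. (X s, Y s)) (\<lambda>s. (V s, T s, W s)) (\<lambda>_. ()) z = cmi_density Q (\<lambda>s. (X s, Y s)) (\<lambda>s. (V s, T s, W s)) (\<lambda>_. ()) z"
      unfolding R.cmi_density_sym[of _ "\<lambda>s. (X s, Y s)"]
      by (rule R.cmi_density_scale_AC[where k = "\<lambda>(v, t, w) _. \<rho> (t, v)", OF _ z'])
         (simp_all add: law_f[of "\<lambda>x t u y w. ((x, y), ())"])
  qed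
  have c4b: "cmi R.Q' U W (\<lambda>s. (V s, X s, T s, Y s)) = measure_pmf.expectation R.Q' \<phi>4b"
    unfolding \<phi>4b_def by (rule R.cmi_Q', rule R.cmi_density_scale_all[where k = "\<lambda>(v, x, t, y). \<rho> (t, v)"]) auto
  have c4: "M'.sum_rate = measure_pmf.expectation R.Q' (\<lambda>z. \<phi>4a z + \<phi>4b z)"
    unfolding M'.sum_rate_def c4a c4b by (simp add: int')
  have ex: "measure_pmf.expectation R.Q' (\<phi> 0) = measure_pmf.expectation R.Q' dd2"
    "measure_pmf.expectation R.Q' (\<phi> 1) = cmi R.Q' V X (\<lambda>s. (T s, W s))"
    "measure_pmf.expectation R.Q' (\<phi> 2) = cmi R.Q' (\<lambda>s. (U s, Y s)) W (\<lambda>s. (V s, T s))"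
    "measure_pmf.expectation R.Q' (\<phi> 3) = M'.sum_rate"
    unfolding c2 c3 c4 by (simp_all add: \<phi>_def)
  have bb: "b 0 = D2" "b 1 = rX" "b 2 = rY" "b 3 = sum_rate" by (simp_all add: b_def)
  have "map_pmf (\<lambda>s. (X s, Y s)) R.Q' = p" unfolding i(7)[symmetric] by (rule law_f[of "\<lambda>x t u y w. (x, y)"])
  then have "inner_vars p f1 f2 d1 d2 D1 D2 R0 RX RY R.Q' X Y T U V W g1 g2"
    unfolding inner_vars_def dd1_def[symmetric] dd2_def[symmetric]
    using MV' i c1 obj le[rule_format, of 0] le[rule_format, of 1] le[rule_format, of 2] le[rule_format, of 3]
    unfolding ex bb by (simp add: F_def)
  moreover have "T ` set_pmf R.Q' = T ` set_pmf Q"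
    using arg_cong[OF law_f[of "\<lambda>x t u y w. t"], of set_pmf] by simp
  moreover have "card {k \<in> F. measure_pmf.expectation R.Q' (\<phi> k) = b k} \<le> card F"
    by (rule card_mono[OF finF]) auto
  moreover have "card F = 4" by (simp add: F_def)
  moreover have "card ((\<lambda>z. (X z, T z)) ` set_pmf Q) \<le> card ((UNIV :: 'x set) \<times> T ` set_pmf Q)"
    using finQ by (intro card_mono) auto
  ultimately show ?thesis using card by (intro exI[of _ R.Q'] conjI) (auto simp: card_cartesian_product)
qed

section \<open>Relabelling V and enlarging U\<close>

lemma ent_cong:
  assumes "\<And>z z'. z \<in> set_pmf Q \<Longrightarrow> z' \<in> set_pmf Q \<Longrightarrow> A z' = A z \<longleftrightarrow> B z' = B z"
  shows "ent Q A = ent Q B"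
proof -
  have "measure_pmf.expectation Q (\<lambda>z. log 2 (atom_prob Q A z)) = measure_pmf.expectation Q (\<lambda>z. log 2 (atom_prob Q B z))"
    using assms by (intro integral_cong_AE) (auto simp: AE_measure_pmf_iff intro!: arg_cong[where f = "log 2"] atom_prob_cong)
  then show ?thesis by (simp add: ent_def)
qed

text \<open>V never occurs without T in the rates and in the reconstructions, so each t may use its
  own labels \<open>e t\<close>, undone by \<open>e' t\<close>.\<close>

lemma inner_vars_relabel_V:
  fixes e :: "'t \<Rightarrow> 'v \<Rightarrow> 'v2"
  assumes inner: "inner_vars p f1 f2 d1 d2 D1 D2 R0 RX RY Q X Y T U V W g1 g2"
    and inv: "\<And>z. z \<in> set_pmf Q \<Longrightarrow> e' (T z) (e (T z) (V z)) = V z"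
  shows "inner_vars p f1 f2 d1 d2 D1 D2 R0 RX RY Q X Y T U (\<lambda>z. e (T z) (V z)) W
     (\<lambda>v t w. g1 (e' t v) t w) (\<lambda>v t w. g2 (e' t v) t w)"
proof -
  have MV: "markov_vars Q X Y T U V W" using inner by (simp add: inner_vars_def)
  interpret markov_vars Q X Y T U V W by (rule MV)
  have MV': "markov_vars Q X Y T U (\<lambda>z. e (T z) (V z)) W"
  proof
    show "markov4 Q (\<lambda>z. e (T z) (V z)) (\<lambda>s. (X s, T s)) (\<lambda>s. (U s, Y s)) W" unfolding markov4_def
    proof
      show "markov3 Q (\<lambda>z. e (T z) (V z)) (\<lambda>s. (X s, T s)) (\<lambda>s. ((U s, Y s), W s))"
        by (rule markov3_gen[OF finQ VXTUYW[unfolded markov4_def, THEN conjunct1], where f = "\<lambda>v b. e (snd b) v" and g = "\<lambda>_ c. c"]) auto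
      show "markov3 Q (\<lambda>s. (e (T s) (V s), (X s, T s))) (\<lambda>s. (U s, Y s)) W"
        by (rule markov3_gen[OF finQ VXTUYW[unfolded markov4_def, THEN conjunct2], where f = "\<lambda>(v, x, t) b. (e t v, x, t)" and g = "\<lambda>_ c. c"]) auto
    qed
  qed (rule finQ, rule TUXY)
  have inj: "e (T z) (V z') = e (T z) (V z) \<longleftrightarrow> V z' = V z" if "z \<in> set_pmf Q" "z' \<in> set_pmf Q" "T z' = T z" for z z'
    using inv[OF that(1)] inv[OF that(2)] that(3) by metis
  have c: "cmi Q (\<lambda>z. e (T z) (V z)) X (\<lambda>s. (T s, W s)) = cmi Q V X (\<lambda>s. (T s, W s))"
    "cmi Q (\<lambda>s. (U s, Y s)) W (\<lambda>s. (e (T s) (V s), T s)) = cmi Q (\<lambda>s. (U s, Y s)) W (\<lambda>s. (V s, T s))"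
    "mi Q (\<lambda>s. (X s, Y s)) (\<lambda>s. (e (T s) (V s), T s, W s)) = mi Q (\<lambda>s. (X s, Y s)) (\<lambda>s. (V s, T s, W s))"
    "cmi Q U W (\<lambda>s. (e (T s) (V s), X s, T s, Y s)) = cmi Q U W (\<lambda>s. (V s, X s, T s, Y s))"
    unfolding mi_def cmi_eq_ent[OF finQ]
    by (intro arg_cong2[where f = "(-)"] arg_cong2[where f = "(+)"] refl ent_cong; use inj in force)+
  have D: "measure_pmf.expectation Q (\<lambda>s. d1 (f1 (X s) (Y s)) (g1 (e' (T s) (e (T s) (V s))) (T s) (W s))) =
      measure_pmf.expectation Q (\<lambda>s. d1 (f1 (X s) (Y s)) (g1 (V s) (T s) (W s)))"
    "measure_pmf.expectation Q (\<lambda>s. d2 (f2 (X s) (Y s)) (g2 (e' (T s) (e (T s) (V s))) (T s) (W s))) =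
      measure_pmf.expectation Q (\<lambda>s. d2 (f2 (X s) (Y s)) (g2 (V s) (T s) (W s)))"
    by (rule integral_cong_AE; auto simp: AE_measure_pmf_iff inv)+
  have "markov_vars.sum_rate Q X Y T U (\<lambda>z. e (T z) (V z)) W = sum_rate"
    unfolding markov_vars.sum_rate_def[OF MV'] sum_rate_def c ..
  then show ?thesis using inner MV' unfolding inner_vars_def D c by simp
qed

lemma measure_pair_fst: "measure (pair_pmf Q R) {x. P (fst x)} = measure Q {z. P z}"
  using measure_map_pmf[of fst "pair_pmf Q R" "{z. P z}"] by (simp add: map_fst_pair_pmf vimage_def)

lemma measure_pair_snd: "measure (pair_pmf Q R) {x. P (fst x) \<and> snd x = b} = measure Q {z. P z} * pmf R b"
proof -
  have "{x. P (fst x) \<and> snd x = b} = {z. P z} \<times> {b}" by auto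
  then have "emeasure (pair_pmf Q R) {x. P (fst x) \<and> snd x = b} = (\<integral>\<^sup>+z. \<integral>\<^sup>+c. indicator ({z. P z} \<times> {b}) (z, c) \<partial>R \<partial>Q)"
    by (simp only: nn_integral_pair_pmf'[symmetric]) simp
  also have "\<dots> = (\<integral>\<^sup>+z. indicator {z. P z} z * (\<integral>\<^sup>+c. indicator {b} c \<partial>R) \<partial>Q)"
    by (simp add: indicator_times nn_integral_cmult)
  also have "\<dots> = emeasure Q {z. P z} * emeasure R {b}" by (simp add: nn_integral_multc)
  finally show ?thesis
    by (simp add: measure_pmf.emeasure_eq_measure ennreal_mult[symmetric] measure_pmf_single)
qed

lemma markov3_pair_B:
  fixes A :: "'o \<Rightarrow> 'a" and B :: "'o \<Rightarrow> 'b" and R :: "'i pmf"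
  assumes "markov3 Q A B C"
  shows "markov3 (pair_pmf Q R) (\<lambda>x. A (fst x)) (\<lambda>x. (B (fst x), snd x)) (\<lambda>x. C (fst x))"
  unfolding markov3_iff_measure
proof (intro allI)
  fix a and bb :: "'b \<times> 'i" and c
  obtain b i where bb: "bb = (b, i)" by (cases bb)
  have "measure Q {z. A z = a \<and> B z = b \<and> C z = c} * measure Q {z. B z = b} = measure Q {z. A z = a \<and> B z = b} * measure Q {z. B z = b \<and> C z = c}"
    using assms unfolding markov3_iff_measure by blast
  then show "measure (pair_pmf Q R) {z. A (fst z) = a \<and> (B (fst z), snd z) = bb \<and> C (fst z) = c} * measure (pair_pmf Q R) {z. (B (fst z), snd z) = bb} =
    measure (pair_pmf Q R) {z. A (fst z) = a \<and> (B (fst z), snd z) = bb} * measure (pair_pmf Q R) {z. (B (fst z), snd z) = bb \<and> C (fst z) = c}"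
    using measure_pair_snd[of Q R "\<lambda>z. A z = a \<and> B z = b \<and> C z = c" i] measure_pair_snd[of Q R "\<lambda>z. B z = b" i]
      measure_pair_snd[of Q R "\<lambda>z. A z = a \<and> B z = b" i] measure_pair_snd[of Q R "\<lambda>z. B z = b \<and> C z = c" i]
    by (simp add: bb conj_ac)
qed

lemma markov3_pair_A:
  fixes A :: "'o \<Rightarrow> 'a" and B :: "'o \<Rightarrow> 'b" and R :: "'i pmf"
  assumes "markov3 Q A B C"
  shows "markov3 (pair_pmf Q R) (\<lambda>x. (A (fst x), snd x)) (\<lambda>x. B (fst x)) (\<lambda>x. C (fst x))"
  unfolding markov3_iff_measure
proof (intro allI)
  fix aa :: "'a \<times> 'i" and b c
  obtain a i where aa: "aa = (a, i)" by (cases aa)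
  have "measure Q {z. A z = a \<and> B z = b \<and> C z = c} * measure Q {z. B z = b} = measure Q {z. A z = a \<and> B z = b} * measure Q {z. B z = b \<and> C z = c}"
    using assms unfolding markov3_iff_measure by blast
  then show "measure (pair_pmf Q R) {z. (A (fst z), snd z) = aa \<and> B (fst z) = b \<and> C (fst z) = c} * measure (pair_pmf Q R) {z. B (fst z) = b} =
    measure (pair_pmf Q R) {z. (A (fst z), snd z) = aa \<and> B (fst z) = b} * measure (pair_pmf Q R) {z. B (fst z) = b \<and> C (fst z) = c}"
    using measure_pair_snd[of Q R "\<lambda>z. A z = a \<and> B z = b \<and> C z = c" i] measure_pair_fst[of Q R "\<lambda>z. B z = b"]
      measure_pair_snd[of Q R "\<lambda>z. A z = a \<and> B z = b" i] measure_pair_fst[of Q R "\<lambda>z. B z = b \<and> C z = c"]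
    by (simp add: aa conj_ac)
qed

lemma markov3_inj_B:
  assumes M: "markov3 Q A B C" and "inj e"
  shows "markov3 Q A (\<lambda>z. e (B z)) C"
  unfolding markov3_iff_measure
proof (intro allI)
  fix a b' c
  show "measure Q {z. A z = a \<and> e (B z) = b' \<and> C z = c} * measure Q {z. e (B z) = b'} =
    measure Q {z. A z = a \<and> e (B z) = b'} * measure Q {z. e (B z) = b' \<and> C z = c}"
  proof (cases "b' \<in> range e")
    case True
    then obtain b where b: "b' = e b" by auto
    have "e (B z) = b' \<longleftrightarrow> B z = b" for z using \<open>inj e\<close> by (simp add: b inj_eq)
    then show ?thesis using M unfolding markov3_iff_measure by simp
  next
    case False
    then have "\<And>z. e (B z) \<noteq> b'" by auto
    then show ?thesis by simp
  qed
qed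

text \<open>An independent uniform index adds \<open>log 2 k\<close> to every entropy that involves
  U, and in each rate such entropies occur in pairs of opposite sign. \<open>prod_encode\<close>
  keeps U valued in the naturals.\<close>

lemma inner_vars_augment_U:
  fixes U :: "'o \<Rightarrow> nat"
  assumes inner: "inner_vars p f1 f2 d1 d2 D1 D2 R0 RX RY Q X Y T U V W g1 g2" and k: "k > 0"
  shows "inner_vars p f1 f2 d1 d2 D1 D2 R0 RX RY (pair_pmf Q (pmf_of_set {..<k})) (\<lambda>x. X (fst x)) (\<lambda>x. Y (fst x)) (\<lambda>x. T (fst x))
     (\<lambda>x. prod_encode (U (fst x), snd x)) (\<lambda>x. V (fst x)) (\<lambda>x. W (fst x)) g1 g2"
proof -
  have MV: "markov_vars Q X Y T U V W" using inner by (simp add: inner_vars_def)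
  interpret markov_vars Q X Y T U V W by (rule MV)
  define R where "R = pmf_of_set {..<k}"
  define P where "P = pair_pmf Q R"
  have ne: "{..<k} \<noteq> {}" using k by (auto simp: lessThan_empty_iff)
  have setR: "set_pmf R = {..<k}" "\<And>i. i < k \<Longrightarrow> pmf R i = 1 / k" using ne by (auto simp: R_def)
  have finP: "finite (set_pmf P)" using finQ setR by (simp add: P_def)
  define U' where "U' x = prod_encode (U (fst x), snd x)" for x
  have M4: "markov3 Q T U (\<lambda>s. (X s, Y s))" "markov3 Q (\<lambda>s. (T s, U s)) X Y"
    "markov3 Q V (\<lambda>s. (X s, T s)) (\<lambda>s. ((U s, Y s), W s))" "markov3 Q (\<lambda>s. (V s, (X s, T s))) (\<lambda>s. (U s, Y s)) W"
    using TUXY VXTUYW by (auto simp: markov4_def)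
  have MV': "markov_vars P (\<lambda>x. X (fst x)) (\<lambda>x. Y (fst x)) (\<lambda>x. T (fst x)) U' (\<lambda>x. V (fst x)) (\<lambda>x. W (fst x))"
  proof
    show "markov4 P (\<lambda>x. T (fst x)) U' (\<lambda>x. X (fst x)) (\<lambda>x. Y (fst x))" unfolding markov4_def
    proof
      show "markov3 P (\<lambda>x. T (fst x)) U' (\<lambda>x. (X (fst x), Y (fst x)))"
        unfolding P_def U'_def by (rule markov3_inj_B[OF markov3_pair_B[OF M4(1)] inj_prod_encode])
      show "markov3 P (\<lambda>x. (T (fst x), U' x)) (\<lambda>x. X (fst x)) (\<lambda>x. Y (fst x))"
        by (rule markov3_gen[OF finP markov3_pair_A[OF M4(2), of R, folded P_def], where f = "\<lambda>((t, u), i) _. (t, prod_encode (u, i))" and g = "\<lambda>_ c. c"])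
          (auto simp: U'_def)
    qed
    show "markov4 P (\<lambda>x. V (fst x)) (\<lambda>x. (X (fst x), T (fst x))) (\<lambda>x. (U' x, Y (fst x))) (\<lambda>x. W (fst x))" unfolding markov4_def
    proof
      show "markov3 P (\<lambda>x. V (fst x)) (\<lambda>x. (X (fst x), T (fst x))) (\<lambda>x. ((U' x, Y (fst x)), W (fst x)))"
        by (rule markov3_gen[OF finP markov3_sym[OF markov3_pair_A[OF markov3_sym[OF M4(3)], of R, folded P_def]],
             where g = "\<lambda>_ (((u, y), w), i). ((prod_encode (u, i), y), w)" and f = "\<lambda>c _. c"]) (auto simp: U'_def)
      have "inj (\<lambda>((u :: nat, y :: 'b), i). (prod_encode (u, i), y))" by (auto simp: inj_def prod_encode_eq)
      from markov3_inj_B[OF markov3_pair_B[OF M4(4), of R, folded P_def] this]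
      show "markov3 P (\<lambda>x. (V (fst x), (X (fst x), T (fst x)))) (\<lambda>x. (U' x, Y (fst x))) (\<lambda>x. W (fst x))"
        by (simp add: U'_def)
    qed
  qed (rule finP)
  have ent1: "ent P (\<lambda>x. A (fst x)) = ent Q A" for A :: "'o \<Rightarrow> 'z"
  proof -
    have "atom_prob P (\<lambda>x. A (fst x)) x = atom_prob Q A (fst x)" for x
      unfolding atom_prob_def P_def by (rule measure_pair_fst)
    then show ?thesis unfolding ent_def using expectation_pair_pmf_fst[of Q R "\<lambda>z. log 2 (atom_prob Q A z)"] by (simp only: P_def)
  qed
  have ent2: "ent P B = ent Q A + log 2 k"
    if "\<And>x x'. B x' = B x \<longleftrightarrow> (A (fst x'), snd x') = (A (fst x), snd x)" for A :: "'o \<Rightarrow> 'z" and B :: "'o \<times> nat \<Rightarrow> 'y"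
  proof -
    have intQ: "integrable (measure_pmf Q) f" for f :: "'o \<Rightarrow> real" using finQ by (rule integrable_measure_pmf_finite)
    have "ent P B = - measure_pmf.expectation P (\<lambda>x. log 2 (atom_prob Q A (fst x)) - log 2 k)"
      unfolding ent_def
    proof (rule arg_cong[where f = uminus], rule integral_cong_AE)
      show "AE x in measure_pmf P. log 2 (atom_prob P B x) = log 2 (atom_prob Q A (fst x)) - log 2 k"
      proof (rule AE_pmfI)
        fix x assume x: "x \<in> set_pmf P"
        then have z: "fst x \<in> set_pmf Q" "snd x < k" using setR by (auto simp: P_def)
        have "atom_prob P B x = atom_prob Q A (fst x) * pmf R (snd x)"
          unfolding atom_prob_def that P_def using measure_pair_snd[of Q R "\<lambda>z. A z = A (fst x)" "snd x"] by simp
        then show "log 2 (atom_prob P B x) = log 2 (atom_prob Q A (fst x)) - log 2 k"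
          using z k setR atom_prob_pos[OF z(1), of A] by (simp add: log_divide)
      qed
    qed auto
    also have "\<dots> = - measure_pmf.expectation Q (\<lambda>z. log 2 (atom_prob Q A z) - log 2 k)"
      unfolding P_def using expectation_pair_pmf_fst[of Q R "\<lambda>z. log 2 (atom_prob Q A z) - log 2 k"] by (simp only:)
    also have "\<dots> = ent Q A + log 2 k" by (simp add: ent_def intQ)
    finally show ?thesis .
  qed
  have U'_eq: "U' x' = U' x \<longleftrightarrow> U (fst x') = U (fst x) \<and> snd x' = snd x" for x x' by (simp add: U'_def prod_encode_eq)
  have c0: "cmi P (\<lambda>x. X (fst x)) U' (\<lambda>x. Y (fst x)) = cmi Q X U Y"
    unfolding cmi_eq_ent[OF finP] cmi_eq_ent[OF finQ]
    using ent1[of "\<lambda>z. (X z, Y z)"] ent2[of "\<lambda>x. (U' x, Y (fst x))" "\<lambda>z. (U z, Y z)"] ent1[of Y]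
      ent2[of "\<lambda>x. (X (fst x), U' x, Y (fst x))" "\<lambda>z. (X z, U z, Y z)"] by (simp add: U'_eq conj_ac)
  have cX: "cmi P (\<lambda>x. V (fst x)) (\<lambda>x. X (fst x)) (\<lambda>x. (T (fst x), W (fst x))) = cmi Q V X (\<lambda>z. (T z, W z))"
    unfolding cmi_eq_ent[OF finP] cmi_eq_ent[OF finQ]
    using ent1[of "\<lambda>z. (V z, T z, W z)"] ent1[of "\<lambda>z. (X z, T z, W z)"] ent1[of "\<lambda>z. (V z, X z, T z, W z)"] ent1[of "\<lambda>z. (T z, W z)"] by simp
  have cY: "cmi P (\<lambda>x. (U' x, Y (fst x))) (\<lambda>x. W (fst x)) (\<lambda>x. (V (fst x), T (fst x))) = cmi Q (\<lambda>z. (U z, Y z)) W (\<lambda>z. (V z, T z))"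
    unfolding cmi_eq_ent[OF finP] cmi_eq_ent[OF finQ]
    using ent2[of "\<lambda>x. ((U' x, Y (fst x)), (V (fst x), T (fst x)))" "\<lambda>z. ((U z, Y z), (V z, T z))"]
      ent2[of "\<lambda>x. ((U' x, Y (fst x)), W (fst x), (V (fst x), T (fst x)))" "\<lambda>z. ((U z, Y z), W z, (V z, T z))"]
      ent1[of "\<lambda>z. (W z, V z, T z)"] ent1[of "\<lambda>z. (V z, T z)"] by (simp add: U'_eq conj_ac)
  have cS: "mi P (\<lambda>x. (X (fst x), Y (fst x))) (\<lambda>x. (V (fst x), T (fst x), W (fst x))) = mi Q (\<lambda>z. (X z, Y z)) (\<lambda>z. (V z, T z, W z))"
    unfolding mi_def cmi_eq_ent[OF finP] cmi_eq_ent[OF finQ]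
    using ent1[of "\<lambda>z. ((X z, Y z), ())"] ent1[of "\<lambda>z. ((V z, T z, W z), ())"] ent1[of "\<lambda>z. ((X z, Y z), (V z, T z, W z), ())"] ent1[of "\<lambda>z. ()"] by simp
  have cS2: "cmi P U' (\<lambda>x. W (fst x)) (\<lambda>x. (V (fst x), X (fst x), T (fst x), Y (fst x))) = cmi Q U W (\<lambda>z. (V z, X z, T z, Y z))"
    unfolding cmi_eq_ent[OF finP] cmi_eq_ent[OF finQ]
    using ent2[of "\<lambda>x. (U' x, (V (fst x), X (fst x), T (fst x), Y (fst x)))" "\<lambda>z. (U z, (V z, X z, T z, Y z))"]
      ent2[of "\<lambda>x. (U' x, W (fst x), (V (fst x), X (fst x), T (fst x), Y (fst x)))" "\<lambda>z. (U z, W z, (V z, X z, T z, Y z))"]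
      ent1[of "\<lambda>z. (W z, V z, X z, T z, Y z)"] ent1[of "\<lambda>z. (V z, X z, T z, Y z)"] by (simp add: U'_eq conj_ac)
  have law: "map_pmf (\<lambda>x. (X (fst x), Y (fst x))) P = p"
  proof -
    have "map_pmf (\<lambda>x. (X (fst x), Y (fst x))) P = map_pmf (\<lambda>z. (X z, Y z)) (map_pmf fst P)" by (simp add: map_pmf_comp)
    also have "map_pmf fst P = Q" by (simp add: P_def map_fst_pair_pmf)
    also have "map_pmf (\<lambda>z. (X z, Y z)) Q = p" using inner by (simp add: inner_vars_def)
    finally show ?thesis .
  qed
  have ex: "measure_pmf.expectation P (\<lambda>x. f (fst x)) = measure_pmf.expectation Q f" for f :: "'o \<Rightarrow> real"
    unfolding P_def by (rule expectation_pair_pmf_fst)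
  have "markov_vars.sum_rate P (\<lambda>x. X (fst x)) (\<lambda>x. Y (fst x)) (\<lambda>x. T (fst x)) U' (\<lambda>x. V (fst x)) (\<lambda>x. W (fst x)) = sum_rate"
    unfolding markov_vars.sum_rate_def[OF MV'] sum_rate_def cS cS2 ..
  then show ?thesis
    using inner MV' law unfolding R_def[symmetric] P_def[symmetric] U'_def[symmetric] inner_vars_def c0 cX cY
      ex[of "\<lambda>z. d1 (f1 (X z) (Y z)) (g1 (V z) (T z) (W z))"] ex[of "\<lambda>z. d2 (f2 (X z) (Y z)) (g2 (V z) (T z) (W z))"] by simp
qed

text \<open>Besides the fibre over t, the set contains at least one further pair for each of the
  other first components.\<close>

lemma card_fibre_le:
  assumes fin: "finite A" and t: "t \<in> fst ` A"
  shows "card {v. (t, v) \<in> A} + card (fst ` A) \<le> card A + 1"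
proof -
  define s where "s t' = (SOME v. (t', v) \<in> A)" for t'
  have s: "(t', s t') \<in> A" if "t' \<in> fst ` A" for t'
    unfolding s_def by (rule someI_ex[of "\<lambda>v. (t', v) \<in> A"]) (use that in force)
  let ?F = "Pair t ` {v. (t, v) \<in> A}" and ?G = "(\<lambda>t'. (t', s t')) ` (fst ` A - {t})"
  have sub: "?F \<subseteq> A" "?G \<subseteq> A" using s by auto
  have finFG: "finite ?F" "finite ?G" by (rule finite_subset[OF sub(1) fin], rule finite_subset[OF sub(2) fin])
  have "card {v. (t, v) \<in> A} = card ?F" by (subst card_image) (auto simp: inj_on_def)
  moreover have "card (fst ` A) - 1 = card ?G"
    using t fin by (subst card_image) (auto simp: inj_on_def)
  moreover have "card (?F \<union> ?G) = card ?F + card ?G" using finFG by (intro card_Un_disjoint) auto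
  moreover have "card (?F \<union> ?G) \<le> card A" using sub fin by (intro card_mono) auto
  ultimately show ?thesis by linarith
qed

theorem inner_cond_cardinality:
  fixes p :: "('x::finite \<times> 'y::finite) pmf"
  assumes "inner_cond p f1 f2 d1 d2 D1 D2 R0 RX RY Q g1 g2"
  shows "\<exists>Q' g1' g2'. inner_cond p f1 f2 d1 d2 D1 D2 R0 RX RY Q' g1' g2' \<and>
    alph Q' oT \<le> CARD('x) + 4 \<and> alph Q' oV \<le> (CARD('x) + 4) * CARD('x) + 1 \<and> alph Q' oW \<le> alph Q' oU * CARD('y) + 1"
proof -
  from inner_vars_reduce_T[OF assms[unfolded inner_cond_iff_vars]] obtain Q1 :: "('x, 'y) joint" where
    Q1: "inner_vars p f1 f2 d1 d2 D1 D2 R0 RX RY Q1 oX oY oT oU oV oW g1 g2" "card (oT ` set_pmf Q1) \<le> CARD('x) + 4" by blast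
  from inner_vars_reduce_V[OF Q1(1)] obtain Q2 :: "('x, 'y) joint" where
    Q2: "inner_vars p f1 f2 d1 d2 D1 D2 R0 RX RY Q2 oX oY oT oU oV oW g1 g2" "oT ` set_pmf Q2 = oT ` set_pmf Q1"
      "card ((\<lambda>z. (oT z, oV z)) ` set_pmf Q2) \<le> CARD('x) * card (oT ` set_pmf Q1) + 4" by blast
  have fin2: "finite (set_pmf Q2)" using Q2(1) by (simp add: inner_vars_def markov_vars_def)
  define A where "A = (\<lambda>z. (oT z, oV z)) ` set_pmf Q2"
  define N where "N = card (oT ` set_pmf Q2)"
  have finA: "finite A" and fstA: "fst ` A = oT ` set_pmf Q2" using fin2 by (auto simp: A_def image_image)
  define S where "S t = {v. (t, v) \<in> A}" for t
  have finS: "finite (S t)" for t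
  proof -
    have "S t \<subseteq> snd ` A" by (force simp: S_def)
    then show ?thesis by (rule finite_subset) (use finA in simp)
  qed
  \<comment> \<open>With \<open>CARD('x)\<close> = c + 1 and N values of T, the fibre has at most c
    N + 5 elements: 4 from the inequalities and 1 from \<open>card_fibre_le\<close>. Then N <= c + 5
    gives the bound.\<close>
  have cardS: "card (S t) \<le> (CARD('x) + 4) * CARD('x) + 1" if t: "t \<in> oT ` set_pmf Q2" for t
  proof -
    have "card (S t) + N \<le> card A + 1" using card_fibre_le[OF finA, of t] t by (simp add: S_def N_def fstA)
    also have "card A \<le> CARD('x) * N + 4" using Q2(2,3) by (simp add: A_def N_def)
    finally have 1: "card (S t) + N \<le> CARD('x) * N + 5" by simp
    have NX: "N \<le> CARD('x) + 4" using Q1(2) Q2(2) by (simp add: N_def)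
    obtain c where c: "CARD('x) = Suc c" using zero_less_card_finite[where 'a = 'x] by (cases "CARD('x)") auto
    have "card (S t) \<le> c * N + 5" using 1 by (simp add: c)
    also have "c * N \<le> c * (Suc c + 4)" using NX by (intro mult_le_mono) (auto simp: c)
    finally show ?thesis by (simp add: c algebra_simps)
  qed
  \<comment> \<open>Every fibre is numbered from 0, so that different t share labels and V needs
    only as many values as the largest fibre has.\<close>
  have "\<exists>e. \<forall>t. bij_betw (e t) (S t) {0..<card (S t)}"
    using ex_bij_betw_finite_nat[OF finS] by metis
  then obtain e where e: "\<And>t. bij_betw (e t) (S t) {0..<card (S t)}" by blast
  define e' where "e' t = inv_into (S t) (e t)" for t
  have VS: "oV z \<in> S (oT z)" if "z \<in> set_pmf Q2" for z using that by (auto simp: S_def A_def)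
  have inv: "e' (oT z) (e (oT z) (oV z)) = oV z" if "z \<in> set_pmf Q2" for z
    unfolding e'_def by (rule inv_into_f_f[OF bij_betw_imp_inj_on[OF e] VS[OF that]])
  \<comment> \<open>Giving each value of U as many copies as W has values makes the alphabet of U at
    least as large as that of W; the bound on W refers to the enlarged U.\<close>
  define k where "k = card (oW ` set_pmf Q2)"
  have k: "k > 0" using fin2 set_pmf_not_empty[of Q2] by (simp add: k_def card_gt_0_iff)
  define h where "h x = (oX (fst x), oY (fst x), oT (fst x), prod_encode (oU (fst x), snd x), e (oT (fst x)) (oV (fst x)), oW (fst x))"
    for x :: "('x \<times> 'y \<times> nat \<times> nat \<times> nat \<times> nat) \<times> nat"
  define Q3 where "Q3 = map_pmf h (pair_pmf Q2 (pmf_of_set {..<k}))"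
  have "inner_cond p f1 f2 d1 d2 D1 D2 R0 RX RY Q3 (\<lambda>v t w. g1 (e' t v) t w) (\<lambda>v t w. g2 (e' t v) t w)"
    unfolding Q3_def h_def
    by (rule inner_cond_map_pmf[OF inner_vars_augment_U[OF inner_vars_relabel_V[where e = e and e' = e', OF Q2(1)] k]]) (rule inv)
  moreover have ne: "{..<k} \<noteq> {}" using k by (auto simp: lessThan_empty_iff)
  have set3: "set_pmf Q3 = h ` (set_pmf Q2 \<times> {..<k})" using ne by (simp add: Q3_def)
  have "oT ` set_pmf Q3 \<subseteq> oT ` set_pmf Q2" by (auto simp: set3 h_def)
  then have "alph Q3 oT \<le> CARD('x) + 4"
    using card_mono[OF finite_imageI[OF fin2], of "oT ` set_pmf Q3" oT] Q1(2) unfolding alph_def Q2(2) by linarith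
  moreover have "alph Q3 oV \<le> (CARD('x) + 4) * CARD('x) + 1"
  proof -
    have "oV ` set_pmf Q3 \<subseteq> {..<(CARD('x) + 4) * CARD('x) + 1}"
    proof
      fix v assume "v \<in> oV ` set_pmf Q3"
      then obtain z where z: "z \<in> set_pmf Q2" "v = e (oT z) (oV z)" by (auto simp: set3 h_def)
      have "v \<in> {0..<card (S (oT z))}" unfolding z(2) by (rule bij_betwE[OF e, rule_format, OF VS[OF z(1)]])
      moreover have "card (S (oT z)) \<le> (CARD('x) + 4) * CARD('x) + 1" using z(1) by (intro cardS imageI)
      ultimately show "v \<in> {..<(CARD('x) + 4) * CARD('x) + 1}" by simp
    qed
    from card_mono[OF _ this] show ?thesis by (simp add: alph_def)
  qed
  moreover have "alph Q3 oW \<le> alph Q3 oU * CARD('y) + 1"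
  proof -
    have "oW ` set_pmf Q3 \<subseteq> oW ` set_pmf Q2" by (auto simp: set3 h_def)
    then have W: "alph Q3 oW \<le> k" unfolding alph_def k_def by (rule card_mono[OF finite_imageI[OF fin2]])
    obtain z where z: "z \<in> set_pmf Q2" using set_pmf_not_empty[of Q2] by blast
    have "(\<lambda>i. prod_encode (oU z, i)) ` {..<k} \<subseteq> oU ` set_pmf Q3"
    proof
      fix u assume "u \<in> (\<lambda>i. prod_encode (oU z, i)) ` {..<k}"
      then obtain i where i: "i < k" "u = prod_encode (oU z, i)" by auto
      have "oU (h (z, i)) = u" by (simp add: h_def i)
      then show "u \<in> oU ` set_pmf Q3" unfolding set3 using z i(1) by blast
    qed
    moreover have "finite (oU ` set_pmf Q3)" unfolding set3 using fin2 by simp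
    ultimately have "card ((\<lambda>i. prod_encode (oU z, i)) ` {..<k}) \<le> alph Q3 oU" unfolding alph_def by (intro card_mono)
    then have "k \<le> alph Q3 oU" by (subst (asm) card_image) (auto simp: inj_on_def prod_encode_eq)
    also have "\<dots> \<le> alph Q3 oU * CARD('y)" using zero_less_card_finite[where 'a = 'y] by simp
    finally show ?thesis using W by simp
  qed
  ultimately show ?thesis by blast
qed

theorem theorem7:
  fixes p :: "('x::finite \<times> 'y::finite) pmf"
    and f1 :: "'x \<Rightarrow> 'y \<Rightarrow> 'f1::finite" and f2 :: "'x \<Rightarrow> 'y \<Rightarrow> 'f2::finite"
    and d1 :: "'f1 \<Rightarrow> 'f1 \<Rightarrow> real" and d2 :: "'f2 \<Rightarrow> 'f2 \<Rightarrow> real"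
    and D1 D2 :: real
  assumes "\<forall>a b. d1 a b \<ge> 0" and "\<forall>a b. d2 a b \<ge> 0"
    and "D1 \<ge> 0" and "D2 \<ge> 0"
  shows "(\<forall>R0 RX RY Q g1 g2. inner_cond p f1 f2 d1 d2 D1 D2 R0 RX RY Q g1 g2 \<longrightarrow>
            achievable p f1 f2 d1 d2 D1 D2 R0 RX RY)
       \<and> (\<forall>R0 RX RY Q g1 g2. inner_cond p f1 f2 d1 d2 D1 D2 R0 RX RY Q g1 g2 \<longrightarrow>
            (\<exists>Q' g1' g2'. inner_cond p f1 f2 d1 d2 D1 D2 R0 RX RY Q' g1' g2' \<and>
               alph Q' (\<lambda>(x,y,t,u,v,w). t) \<le> CARD('x) + 4 \<and>
               alph Q' (\<lambda>(x,y,t,u,v,w). v) \<le> (CARD('x) + 4) * CARD('x) + 1 \<and>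
               alph Q' (\<lambda>(x,y,t,u,v,w). w) \<le> alph Q' (\<lambda>(x,y,t,u,v,w). u) * CARD('y) + 1))"
proof (intro conjI allI impI)
  fix R0 RX RY Q g1 g2
  assume inner: "inner_cond p f1 f2 d1 d2 D1 D2 R0 RX RY Q g1 g2"
  show "achievable p f1 f2 d1 d2 D1 D2 R0 RX RY"
    by (rule inner_cond_achievable[OF inner assms(3,4)])
  show "\<exists>Q' g1' g2'. inner_cond p f1 f2 d1 d2 D1 D2 R0 RX RY Q' g1' g2' \<and>
               alph Q' (\<lambda>(x,y,t,u,v,w). t) \<le> CARD('x) + 4 \<and>
               alph Q' (\<lambda>(x,y,t,u,v,w). v) \<le> (CARD('x) + 4) * CARD('x) + 1 \<and>
               alph Q' (\<lambda>(x,y,t,u,v,w). w) \<le> alph Q' (\<lambda>(x,y,t,u,v,w). u) * CARD('y) + 1"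
    by (rule inner_cond_cardinality[OF inner])
qed

end
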